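(* Let $m\ge2$ be an integer, and consider the one-sided and two-sided Dyck shifts $(\Sigma_D^+,\sigma_+)$ and $(\Sigma_D,\sigma)$ on $2m$ symbols. Then all of $(\sigma_+,\nu_\alpha^+)$, $(\sigma_+,\nu_\beta^+)$, $(\sigma,\nu_\alpha)$, $(\sigma,\nu_\beta)$ are exponentially mixing (with Hölder continuity understood with respect to the metrics $d$ on $\Sigma_D^+$ and $\Sigma_D$).
   Context: Dyck shift. Let $m\ge2$ and $D=\{\alpha_1,\dots,\alpha_m\}\cup\{\beta_1,\dots,\beta_m\}$ ($2m$ distinct symbols), and let $D^*$ be the set of finite words in $D$. Consider the monoid with zero generated by $D$, with unit element $1$, and relations $\alpha_i\cdot\beta_j=\delta_{i,j}$ (i.e. $1$ if $i=j$ and $0$ otherwise), $0\cdot0=0$, $\gamma\cdot1=1\cdot\gamma=\gamma$, $\gamma\cdot0=0\cdot\gamma=0$ for $\gamma\in D^*\cup\{1\}$. For a word $\gamma_1\cdots\gamma_n$ let $\mathrm{red}(\gamma_1\cdots\gamma_n)=\prod_{i=1}^n\gamma_i$ in this monoid. With $\mathbb Z_+=\{0,1,2,\dots\}$, put $\Sigma_D^+=\{\omega\in D^{\mathbb Z_+}:\mathrm{red}(\omega_i\cdots\omega_j)\ne0\text{ for all }i,j\in\mathbb Z_+,\ i<j\}$ and $\Sigma_D=\{\omega\in D^{\mathbb Z}:\mathrm{red}(\omega_i\cdots\omega_j)\neq0\text{ for all }i,j\in\mathbb Z,\ i<j\}$; $\sigma_+$, $\sigma$ are the left shifts on them. The metrics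 are, for distinct points, $d(\omega,\omega')=\exp(-\min\{i\ge0:\omega_i\ne\omega_i'\})$ on $\Sigma_D^+$ and $d(\omega,\omega')=\exp(-\min\{i\ge0:\omega_i\ne\omega'_i\text{ or }\omega_{-i}\ne\omega'_{-i}\})$ on $\Sigma_D$. Measures of maximal entropy. For $\omega\in\Sigma_D$ and $i\in\mathbb Z$ put $H_i(\omega)=\sum_{j=0}^{i-1}\sum_{l=1}^m(\delta_{\alpha_l,\omega_j}-\delta_{\beta_l,\omega_j})$ for $i\ge1$, $H_i(\omega)=\sum_{j=i}^{-1}\sum_{l=1}^m(\delta_{\beta_l,\omega_j}-\delta_{\alpha_l,\omega_j})$ for $i\le-1$, and $H_0(\omega)=0$. Let $A_\alpha=\{\omega\in\Sigma_D:\lim_{i\to\infty}H_i(\omega)=\infty,\ \lim_{i\to-\infty}H_i(\omega)=-\infty\}$ and $A_\beta=\{\omega\in\Sigma_D:\lim_{i\to\infty}H_i(\omega)=-\infty,\ \lim_{i\to-\infty}H_i(\omega)=\infty\}$. A measure of maximal entropy is an invariant Borel probability measure attaining the supremum of the measure-theoretic entropy over invariant Borel probability measures. By a theorem of Krieger, the two-sided Dyck shift has exactly two ergodic measures of maximal entropy $\nu_\alpha,\nu_\beta$; they have entropy $\log(m+1)$, are Bernoulli, and are distinguished by $\nu_\alpha(A_\alpha)=1$, $\nu_\beta(A_\beta)=1$. The measures $\nu_\alpha^+,\nu_\beta^+$ are the push-forwards of $\nu_\alpha,\nu_\beta$ under the canonical projection $\Sigma_D\to\Sigma_D^+$, $(\omega_n)_{n\in\mathbb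 Z}\mapsto(\omega_n)_{n\in\mathbb Z_+}$; they are exactly the ergodic measures of maximal entropy of the one-sided Dyck shift. Exponential mixing. Let $X$ be a metric space, $\nu$ a Borel probability measure on $X$ and $T\colon X\to X$ a measurable map preserving $\nu$. For real-valued $\varphi,\psi\in L^2(\nu)$ and $n\ge1$ put $\mathrm{Cor}_n(T;\varphi,\psi;\nu)=\left|\int\varphi(\psi\circ T^n)\,d\nu-\int\varphi\,d\nu\int\psi\,d\nu\right|$. For $\eta\in(0,1]$ let $\mathscr H_\eta(X)$ be the set of real-valued Hölder continuous functions on $X$ with exponent $\eta$. $(T,\nu)$ is exponentially mixing if for each $\eta\in(0,1]$ there exists $\lambda=\lambda(\eta)\in(0,1)$ such that for any pair $\varphi,\psi\in\mathscr H_\eta(X)$ there exists $C=C(\varphi,\psi)>0$ such that $\mathrm{Cor}_n(T;\varphi,\psi;\nu)\le C\lambda^n$ for all $n\ge1$. *)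

theory Defs
  imports "HOL-Probability.Probability"
begin

section \<open>The Dyck shift\<close>

text \<open>
  The \<open>m\<close> indices are the elements of a finite type \<open>'m\<close>, so that \<open>m = CARD('m)\<close> and the
  alphabet \<open>D\<close> is the whole type \<open>'m dyck_symbol\<close>, with \<open>2 * m\<close> elements.
\<close>

datatype 'm dyck_symbol = DAlpha 'm | DBeta 'm

text \<open>
  The monoid with zero is given by its presentation: the free monoid with zero on the symbols
  (\<open>None\<close> is the zero, \<open>Some w\<close> a word), modulo the least congruence that contains the
  relations \<open>\<alpha>\<^sub>i \<cdot> \<beta>\<^sub>j = \<delta>\<^sub>i\<^sub>j\<close>.
\<close>

fun word0_mult :: "'a list option \<Rightarrow> 'a list option \<Rightarrow> 'a list option" where
  "word0_mult (Some u) (Some v) = Some (u @ v)"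
| "word0_mult _ _ = None"

inductive dyck_cong :: "'m dyck_symbol list option \<Rightarrow> 'm dyck_symbol list option \<Rightarrow> bool" where
  relation: "dyck_cong (Some [DAlpha i, DBeta j]) (if i = j then Some [] else None)"
| refl: "dyck_cong x x"
| sym: "dyck_cong x y \<Longrightarrow> dyck_cong y x"
| trans: "dyck_cong x y \<Longrightarrow> dyck_cong y z \<Longrightarrow> dyck_cong x z"
| mult: "dyck_cong x x' \<Longrightarrow> dyck_cong y y' \<Longrightarrow> dyck_cong (word0_mult x y) (word0_mult x' y')"

quotient_type 'm dyck_monoid = "'m dyck_symbol list option" / dyck_cong
  by (intro equivpI reflpI sympI transpI) (blast intro: dyck_cong.intros)+

instantiation dyck_monoid :: (type) "{monoid_mult, mult_zero}"
begin

lift_definition zero_dyck_monoid :: "'a dyck_monoid" is None .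
lift_definition one_dyck_monoid :: "'a dyck_monoid" is "Some []" .
lift_definition times_dyck_monoid :: "'a dyck_monoid \<Rightarrow> 'a dyck_monoid \<Rightarrow> 'a dyck_monoid"
  is word0_mult by (rule dyck_cong.mult)

instance
proof
  fix a b c :: "'a dyck_monoid"
  have assoc: "word0_mult (word0_mult x y) z = word0_mult x (word0_mult y z)"
    for x y z :: "'b list option"
    by (cases x; cases y; cases z) auto
  show "a * b * c = a * (b * c)"
    by transfer (simp add: assoc dyck_cong.refl)
  have "word0_mult (Some []) x = x" and "word0_mult x (Some []) = x" for x :: "'b list option"
    by (cases x; simp)+
  note unit = this
  show "1 * a = a"
    by transfer (simp add: unit dyck_cong.refl)
  show "a * 1 = a"
    by transfer (simp add: unit dyck_cong.refl)
  show "0 * a = 0"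
    by transfer (simp add: dyck_cong.refl)
  show "a * 0 = 0"
    by transfer (simp add: dyck_cong.refl)
qed

end

lift_definition dyck_gen :: "'m dyck_symbol \<Rightarrow> 'm dyck_monoid" is "\<lambda>s. Some [s]" .

definition red :: "'m dyck_symbol list \<Rightarrow> 'm dyck_monoid" where
  "red w = prod_list (map dyck_gen w)"

definition dyck_plus :: "(nat \<Rightarrow> 'm dyck_symbol) set" where
  "dyck_plus = {\<omega>. \<forall>i j. i < j \<longrightarrow> red (map \<omega> [i..<Suc j]) \<noteq> 0}"

definition dyck :: "(int \<Rightarrow> 'm dyck_symbol) set" where
  "dyck = {\<omega>. \<forall>i j. i < j \<longrightarrow> red (map \<omega> [i..j]) \<noteq> 0}"

definition shift_plus :: "(nat \<Rightarrow> 'a) \<Rightarrow> nat \<Rightarrow> 'a" where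
  "shift_plus \<omega> = (\<lambda>n. \<omega> (n + 1))"

definition shift_two :: "(int \<Rightarrow> 'a) \<Rightarrow> int \<Rightarrow> 'a" where
  "shift_two \<omega> = (\<lambda>n. \<omega> (n + 1))"

definition proj_plus :: "(int \<Rightarrow> 'a) \<Rightarrow> nat \<Rightarrow> 'a" where
  "proj_plus \<omega> = (\<lambda>n. \<omega> (int n))"

definition dist_plus :: "(nat \<Rightarrow> 'a) \<Rightarrow> (nat \<Rightarrow> 'a) \<Rightarrow> real" where
  "dist_plus \<omega> \<omega>' =
     (if \<omega> = \<omega>' then 0 else exp (- real (LEAST i. \<omega> i \<noteq> \<omega>' i)))"

definition dist_two :: "(int \<Rightarrow> 'a) \<Rightarrow> (int \<Rightarrow> 'a) \<Rightarrow> real" where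
  "dist_two \<omega> \<omega>' =
     (if \<omega> = \<omega>' then 0
      else exp (- real (LEAST i. \<omega> (int i) \<noteq> \<omega>' (int i) \<or> \<omega> (- int i) \<noteq> \<omega>' (- int i))))"

lemma Metric_space_dist_plus: "Metric_space X dist_plus"
proof
  fix x y z :: "nat \<Rightarrow> 'a"
  show nn: "0 \<le> dist_plus x y" for x y :: "nat \<Rightarrow> 'a"
    by (auto simp: dist_plus_def)
  have "(\<lambda>i. x i \<noteq> y i) = (\<lambda>i. y i \<noteq> x i)"
    by auto
  then show "dist_plus x y = dist_plus y x"
    by (simp add: dist_plus_def)
  show "(dist_plus x y = 0) = (x = y)"
    by (simp add: dist_plus_def)
  have far: "exp (- real n) \<le> dist_plus u v" if "u n \<noteq> v n" for u v :: "nat \<Rightarrow> 'a" and n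
    using that Least_le[of "\<lambda>i. u i \<noteq> v i" n] by (auto simp: dist_plus_def)
  show "dist_plus x z \<le> dist_plus x y + dist_plus y z"
  proof (cases "x = z")
    case False
    define n where "n = (LEAST i. x i \<noteq> z i)"
    have "x n \<noteq> z n"
      unfolding n_def by (rule LeastI_ex) (use False in auto)
    then have "x n \<noteq> y n \<or> y n \<noteq> z n"
      by auto
    then have "exp (- real n) \<le> dist_plus x y + dist_plus y z"
      using far[of x n y] far[of y n z] nn[of x y] nn[of y z] by linarith
    then show ?thesis
      using False by (simp add: dist_plus_def n_def)
  next
    case True
    then have "dist_plus x z = 0"
      by (simp add: dist_plus_def)
    then show ?thesis
      using nn[of x y] nn[of y z] by linarith
  qed
qed

lemma Metric_space_dist_two: "Metric_space X dist_two"
proof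
  fix x y z :: "int \<Rightarrow> 'a"
  show nn: "0 \<le> dist_two x y" for x y :: "int \<Rightarrow> 'a"
    by (auto simp: dist_two_def)
  let ?P = "\<lambda>u v i. u (int i) \<noteq> v (int i) \<or> u (- int i) \<noteq> v (- int i)"
  have "?P x y = ?P y x"
    by auto
  then show "dist_two x y = dist_two y x"
    by (simp add: dist_two_def)
  show "(dist_two x y = 0) = (x = y)"
    by (simp add: dist_two_def)
  have far: "exp (- real n) \<le> dist_two u v" if "?P u v n" for u v :: "int \<Rightarrow> 'a" and n
    using that Least_le[of "?P u v" n] by (auto simp: dist_two_def)
  show "dist_two x z \<le> dist_two x y + dist_two y z"
  proof (cases "x = z")
    case False
    define n where "n = (LEAST i. ?P x z i)"
    from False obtain k where "x k \<noteq> z k"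
      by auto
    then have "?P x z (nat \<bar>k\<bar>)"
      by (cases "k \<ge> 0") auto
    then have "?P x z n"
      unfolding n_def by (rule LeastI)
    then have "?P x y n \<or> ?P y z n"
      by auto
    then have "exp (- real n) \<le> dist_two x y + dist_two y z"
      using far[of x n y] far[of y n z] nn[of x y] nn[of y z] by linarith
    then show ?thesis
      using False by (simp add: dist_two_def n_def)
  next
    case True
    then have "dist_two x z = 0"
      by (simp add: dist_two_def)
    then show ?thesis
      using nn[of x y] nn[of y z] by linarith
  qed
qed

section \<open>Invariant measures and entropy\<close>

definition metric_borel :: "'a set \<Rightarrow> ('a \<Rightarrow> 'a \<Rightarrow> real) \<Rightarrow> 'a measure" where
  "metric_borel X d = sigma X {U. openin (Metric_space.mtopology X d) U}"

definition invariant_measures ::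
    "'a set \<Rightarrow> ('a \<Rightarrow> 'a \<Rightarrow> real) \<Rightarrow> ('a \<Rightarrow> 'a) \<Rightarrow> 'a measure set" where
  "invariant_measures X d T =
     {\<nu>. sets \<nu> = sets (metric_borel X d) \<and> prob_space \<nu> \<and> T \<in> measurable \<nu> \<nu> \<and> distr \<nu> \<nu> T = \<nu>}"

definition ergodic :: "('a \<Rightarrow> 'a) \<Rightarrow> 'a measure \<Rightarrow> bool" where
  "ergodic T \<nu> \<longleftrightarrow>
     (\<forall>A \<in> sets \<nu>. T -` A \<inter> space \<nu> = A \<longrightarrow> measure \<nu> A = 0 \<or> measure \<nu> A = 1)"

definition finite_partitions :: "'a measure \<Rightarrow> 'a set set set" where
  "finite_partitions \<nu> = {P. finite P \<and> P \<subseteq> sets \<nu> \<and> partition_on (space \<nu>) P}"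

definition partition_join :: "'a set set \<Rightarrow> 'a set set \<Rightarrow> 'a set set" where
  "partition_join P Q = {A \<inter> B |A B. A \<in> P \<and> B \<in> Q} - {{}}"

text \<open>\<open>refinement T \<nu> P n\<close> is the join of the partitions \<open>T\<^sup>-\<^sup>i P\<close> over \<open>i < n\<close>.\<close>

fun refinement :: "('a \<Rightarrow> 'a) \<Rightarrow> 'a measure \<Rightarrow> 'a set set \<Rightarrow> nat \<Rightarrow> 'a set set" where
  "refinement T \<nu> P 0 = {space \<nu>}"
| "refinement T \<nu> P (Suc n) =
     partition_join (refinement T \<nu> P n) ((\<lambda>A. (T ^^ n) -` A \<inter> space \<nu>) ` P)"

text \<open>Since \<open>ln 0 = 0\<close>, null cells contribute \<open>0\<close>, as the convention \<open>0 ln 0 = 0\<close> demands.\<close>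

definition partition_entropy :: "'a measure \<Rightarrow> 'a set set \<Rightarrow> real" where
  "partition_entropy \<nu> P = - (\<Sum>A\<in>P. measure \<nu> A * ln (measure \<nu> A))"

definition entropy_wrt :: "('a \<Rightarrow> 'a) \<Rightarrow> 'a measure \<Rightarrow> 'a set set \<Rightarrow> real" where
  "entropy_wrt T \<nu> P = lim (\<lambda>n. partition_entropy \<nu> (refinement T \<nu> P n) / real n)"

definition measure_entropy :: "('a \<Rightarrow> 'a) \<Rightarrow> 'a measure \<Rightarrow> ereal" where
  "measure_entropy T \<nu> = (SUP P \<in> finite_partitions \<nu>. ereal (entropy_wrt T \<nu> P))"

definition max_entropy_measure ::
    "'a set \<Rightarrow> ('a \<Rightarrow> 'a \<Rightarrow> real) \<Rightarrow> ('a \<Rightarrow> 'a) \<Rightarrow> 'a measure \<Rightarrow> bool" where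
  "max_entropy_measure X d T \<nu> \<longleftrightarrow>
     \<nu> \<in> invariant_measures X d T \<and>
     measure_entropy T \<nu> = (SUP \<mu> \<in> invariant_measures X d T. measure_entropy T \<mu>)"

definition height :: "(int \<Rightarrow> 'm::finite dyck_symbol) \<Rightarrow> int \<Rightarrow> int" where
  "height \<omega> i =
     (if i \<ge> 1 then
        (\<Sum>j\<in>{0..i-1}. \<Sum>l\<in>UNIV. of_bool (DAlpha l = \<omega> j) - of_bool (DBeta l = \<omega> j))
      else if i \<le> -1 then
        (\<Sum>j\<in>{i..-1}. \<Sum>l\<in>UNIV. of_bool (DBeta l = \<omega> j) - of_bool (DAlpha l = \<omega> j))
      else 0)"

definition A_alpha :: "(int \<Rightarrow> 'm::finite dyck_symbol) set" where
  "A_alpha = {\<omega> \<in> dyck. filterlim (height \<omega>) at_top at_top \<and> filterlim (height \<omega>) at_bot at_bot}"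

definition A_beta :: "(int \<Rightarrow> 'm::finite dyck_symbol) set" where
  "A_beta = {\<omega> \<in> dyck. filterlim (height \<omega>) at_bot at_top \<and> filterlim (height \<omega>) at_top at_bot}"

text \<open>
  The defining properties of \<open>\<nu>\<^sub>\<alpha>\<close> and \<open>\<nu>\<^sub>\<beta>\<close>. By a theorem of Krieger each of the two predicates
  holds for exactly one measure when \<open>CARD('m) \<ge> 2\<close>.
\<close>

definition is_nu_alpha :: "(int \<Rightarrow> 'm::finite dyck_symbol) measure \<Rightarrow> bool" where
  "is_nu_alpha \<nu> \<longleftrightarrow>
     max_entropy_measure dyck dist_two shift_two \<nu> \<and> ergodic shift_two \<nu> \<and> measure \<nu> A_alpha = 1"

definition is_nu_beta :: "(int \<Rightarrow> 'm::finite dyck_symbol) measure \<Rightarrow> bool" where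
  "is_nu_beta \<nu> \<longleftrightarrow>
     max_entropy_measure dyck dist_two shift_two \<nu> \<and> ergodic shift_two \<nu> \<and> measure \<nu> A_beta = 1"

definition push_plus ::
    "(int \<Rightarrow> 'm dyck_symbol) measure \<Rightarrow> (nat \<Rightarrow> 'm dyck_symbol) measure" where
  "push_plus \<nu> = distr \<nu> (metric_borel dyck_plus dist_plus) proj_plus"

section \<open>Exponential mixing\<close>

definition Cor ::
    "nat \<Rightarrow> ('a \<Rightarrow> 'a) \<Rightarrow> ('a \<Rightarrow> real) \<Rightarrow> ('a \<Rightarrow> real) \<Rightarrow> 'a measure \<Rightarrow> real" where
  "Cor n T \<phi> \<psi> \<nu> =
     \<bar>(\<integral>x. \<phi> x * \<psi> ((T ^^ n) x) \<partial>\<nu>) - (\<integral>x. \<phi> x \<partial>\<nu>) * (\<integral>x. \<psi> x \<partial>\<nu>)\<bar>"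

text \<open>Functions on \<open>X\<close> are total functions of which only the values on \<open>X\<close> matter.\<close>

definition holder :: "real \<Rightarrow> 'a set \<Rightarrow> ('a \<Rightarrow> 'a \<Rightarrow> real) \<Rightarrow> ('a \<Rightarrow> real) set" where
  "holder \<eta> X d = {\<phi>. \<exists>K\<ge>0. \<forall>x\<in>X. \<forall>y\<in>X. \<bar>\<phi> x - \<phi> y\<bar> \<le> K * d x y powr \<eta>}"

text \<open>
  The standing assumption that \<open>\<nu>\<close> is a Borel probability measure preserved by \<open>T\<close> is made part of
  the definition. Both metrics above are bounded by \<open>1\<close>, so that Hoelder functions are bounded and all
  integrals in the correlations exist.
\<close>

definition exponentially_mixing ::
    "'a set \<Rightarrow> ('a \<Rightarrow> 'a \<Rightarrow> real) \<Rightarrow> ('a \<Rightarrow> 'a) \<Rightarrow> 'a measure \<Rightarrow> bool" where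
  "exponentially_mixing X d T \<nu> \<longleftrightarrow>
     \<nu> \<in> invariant_measures X d T \<and>
     (\<forall>\<eta>::real. 0 < \<eta> \<and> \<eta> \<le> 1 \<longrightarrow>
        (\<exists>\<theta>::real. 0 < \<theta> \<and> \<theta> < 1 \<and>
           (\<forall>\<phi> \<in> holder \<eta> X d. \<forall>\<psi> \<in> holder \<eta> X d.
              \<exists>C>0. \<forall>n\<ge>1. Cor n T \<phi> \<psi> \<nu> \<le> C * \<theta> ^ n)))"

end

theory Submission
  imports Defs "HOL-Real_Asymp.Real_Asymp"
begin

text \<open>
  On \<open>A\<^sub>\<alpha>\<close> every \<open>\<beta>\<^sub>j\<close> is matched by an earlier \<open>\<alpha>\<^sub>j\<close>, so a point is determined by the sequence
  over \<open>m + 1\<close> symbols that is left when the indices of the \<open>\<beta>\<^sub>j\<close> are forgotten. Decoding is defined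
  on the whole full shift (with arbitrary indices for unmatched brackets) and its image lies in the
  Dyck shift. Decoding the uniform Bernoulli measure therefore gives an invariant measure of entropy
  at least \<open>ln (m + 1)\<close>, whereas a measure carried by \<open>A\<^sub>\<alpha>\<close> has entropy at most \<open>ln (m + 1)\<close>, with
  equality only for the decoded Bernoulli measure; hence \<open>\<nu>\<^sub>\<alpha>\<close> is this measure. Since the steps of
  the Bernoulli walk have positive mean, a bracket finds its partner within distance \<open>L\<close> up to an
  event of exponentially small probability. A Hoelder function is thus approximated exponentially
  well by functions of finitely many independent coordinates, and correlations decay exponentially.
  The case of \<open>\<nu>\<^sub>\<beta>\<close> follows by time reversal, the one-sided shifts by projection.
\<close>

section \<open>Reduction of words\<close>

text \<open>Krieger's theorem is not assumed, so the measure must be identified from the conditions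
  in \<open>is_nu_alpha\<close>. Knowing that it is Bernoulli would give no rate of mixing in any
  case; an explicit coding with quantitative control is wanted. The obstacle is that decoding is not
  continuous: the index of a right bracket may depend on arbitrarily remote symbols, so a Hoelder
  function of the Dyck point need not be a Hoelder function of the coded point. Only the probability
  of a distant partner is small, and an exponential moment measures it. With base x, one step of the
  walk has moment (m x + 1/x)/(m + 1), which is below 1 exactly for 1/m < x < 1; the base 3/4 lies
  in this range for all m \<ge> 2 at once. Entropy is a supremum over arbitrary finite partitions,
  so the upper bound needs a generator theorem. It is proved for finite-valued functions in place of
  partitions, because the entropy inequalities for random variables then apply.\<close>

text \<open>
  The monoid acts from the right, by partial maps, on infinite stacks: \<open>\<alpha>\<^sub>i\<close> pushes \<open>i\<close> and \<open>\<beta>\<^sub>j\<close>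
  pops \<open>j\<close>. A word which acts on some stack is therefore nonzero.
\<close>

fun act :: "'m dyck_symbol \<Rightarrow> (nat \<Rightarrow> 'm) \<Rightarrow> (nat \<Rightarrow> 'm) option" where
  "act (DAlpha a) s = Some (case_nat a s)"
| "act (DBeta b) s = (if s 0 = b then Some (\<lambda>n. s (Suc n)) else None)"

fun act_word :: "'m dyck_symbol list \<Rightarrow> (nat \<Rightarrow> 'm) \<Rightarrow> (nat \<Rightarrow> 'm) option" where
  "act_word [] s = Some s"
| "act_word (x # w) s = Option.bind (act x s) (act_word w)"

fun act_word0 :: "'m dyck_symbol list option \<Rightarrow> (nat \<Rightarrow> 'm) \<Rightarrow> (nat \<Rightarrow> 'm) option" where
  "act_word0 None s = None"
| "act_word0 (Some w) s = act_word w s"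

lemma act_word_append: "act_word (u @ v) s = Option.bind (act_word u s) (act_word v)"
  by (induction u arbitrary: s) (auto split: Option.bind_split)

lemma act_word0_mult: "act_word0 (word0_mult x y) s = Option.bind (act_word0 x s) (act_word0 y)"
  by (cases x; cases y) (auto simp: act_word_append split: Option.bind_split)

text \<open>The monoid is known only as a quotient by a least congruence, so nonvanishing has to be
  detected by an invariant. The action is one: pushing \<open>i\<close> and then popping
  \<open>j\<close> is the identity for \<open>i = j\<close> and undefined otherwise.\<close>

lemma dyck_cong_act_word0: "dyck_cong x y \<Longrightarrow> act_word0 x = act_word0 y"
proof (induction rule: dyck_cong.induct)
  case (relation i j)
  show ?case by (rule ext) auto
next
  case (mult x x' y y')
  show ?case by (rule ext) (simp only: act_word0_mult mult)
qed auto

lemma red_eq_abs: "red w = abs_dyck_monoid (Some w)"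
proof (induction w)
  case Nil
  then show ?case by (simp add: red_def one_dyck_monoid_def)
next
  case (Cons a w)
  then show ?case
    by (simp add: red_def dyck_gen.abs_eq times_dyck_monoid.abs_eq)
qed

lemma red_eq_0_iff: "red w = 0 \<longleftrightarrow> dyck_cong (Some w) None"
  by (simp add: red_eq_abs zero_dyck_monoid_def dyck_monoid.abs_eq_iff)

lemma red_append: "red (u @ v) = red u * red v"
  by (simp add: red_def)

lemma red_Cons: "red (x # v) = dyck_gen x * red v"
  by (simp add: red_def)

lemma red_Nil [simp]: "red [] = 1"
  by (simp add: red_def)

lemma gen_alpha_beta: "dyck_gen (DAlpha i) * dyck_gen (DBeta j) = (if i = j then 1 else 0)"
proof -
  have "dyck_gen (DAlpha i) * dyck_gen (DBeta j) = abs_dyck_monoid (Some [DAlpha i, DBeta j])"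
    by (simp add: dyck_gen.abs_eq times_dyck_monoid.abs_eq)
  also have "\<dots> = abs_dyck_monoid (if i = j then Some [] else None)"
    by (simp only: dyck_monoid.abs_eq_iff dyck_cong.relation)
  finally show ?thesis
    by (simp add: one_dyck_monoid_def zero_dyck_monoid_def)
qed

lemma act_word_imp_red_nonzero:
  assumes "act_word w s \<noteq> None"
  shows "red w \<noteq> 0"
proof
  assume "red w = 0"
  then have "act_word0 (Some w) = act_word0 None"
    unfolding red_eq_0_iff by (rule dyck_cong_act_word0)
  then have "act_word0 (Some w) s = act_word0 None s"
    by (rule fun_cong)
  then show False using assms by simp
qed

section \<open>Time reversal\<close>

fun swap :: "'m dyck_symbol \<Rightarrow> 'm dyck_symbol" where
  "swap (DAlpha a) = DBeta a"
| "swap (DBeta a) = DAlpha a"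

lemma swap_swap [simp]: "swap (swap x) = x"
  by (cases x) auto

lemma word0_mult_reverse:
  "map_option (\<lambda>w. rev (map swap w)) (word0_mult u v) =
    word0_mult (map_option (\<lambda>w. rev (map swap w)) v) (map_option (\<lambda>w. rev (map swap w)) u)"
  by (cases u; cases v) auto

text \<open>Reversal combined with exchanging the two kinds of brackets respects the presentation:
  the product \<open>\<alpha>\<^sub>i \<beta>\<^sub>j\<close> turns into
  \<open>\<alpha>\<^sub>j \<beta>\<^sub>i\<close>, whose value is the same.\<close>

lemma dyck_cong_reverse:
  "dyck_cong x y \<Longrightarrow> dyck_cong (map_option (\<lambda>w. rev (map swap w)) x) (map_option (\<lambda>w. rev (map swap w)) y)"
proof (induction rule: dyck_cong.induct)
  case (relation i j)
  show ?case using dyck_cong.relation[of j i] by auto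
next
  case (mult x x' y y')
  then show ?case by (auto simp: word0_mult_reverse intro: dyck_cong.mult)
qed (auto intro: dyck_cong.intros)

lemma red_reverse_nonzero: "red w \<noteq> 0 \<Longrightarrow> red (rev (map swap w)) \<noteq> 0"
proof
  assume "red w \<noteq> 0" "red (rev (map swap w)) = 0"
  then have "dyck_cong (Some (rev (map swap w))) None" by (simp add: red_eq_0_iff)
  from dyck_cong_reverse[OF this] have "dyck_cong (Some w) None"
    by (simp add: rev_map comp_def)
  then show False using \<open>red w \<noteq> 0\<close> by (simp add: red_eq_0_iff)
qed

definition rflip :: "(int \<Rightarrow> 'm dyck_symbol) \<Rightarrow> int \<Rightarrow> 'm dyck_symbol" where
  "rflip \<omega> = (\<lambda>i. swap (\<omega> (- i)))"

lemma rflip_rflip [simp]: "rflip (rflip \<omega>) = \<omega>"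
  by (auto simp: rflip_def)

lemma map_upto_reverse: "map (\<lambda>i. f (- i)) [i..j] = rev (map f [- j..- i])" for i j :: int
proof -
  have "map uminus [i..j] = rev [- j..- i]"
  proof (rule nth_equalityI)
    fix n assume "n < length (map uminus [i..j])"
    then have "int n \<le> j - i" by simp
    then show "map uminus [i..j] ! n = rev [- j..- i] ! n"
      by (simp add: rev_nth nth_upto)
  qed simp
  then show ?thesis by (metis (no_types) list.map_comp comp_def rev_map map_map map_eq_conv)
qed

lemma rflip_in_dyck: "\<omega> \<in> dyck \<Longrightarrow> rflip \<omega> \<in> dyck"
  unfolding dyck_def
proof clarify
  fix i j :: int
  assume A: "\<forall>i j. i < j \<longrightarrow> red (map \<omega> [i..j]) \<noteq> 0" and "i < j" and Z: "red (map (rflip \<omega>) [i..j]) = 0"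
  have "map (rflip \<omega>) [i..j] = map (\<lambda>i. (swap \<circ> \<omega>) (- i)) [i..j]"
    by (simp add: rflip_def)
  also have "\<dots> = rev (map swap (map \<omega> [- j..- i]))"
    by (subst map_upto_reverse) simp
  finally show False
    using Z A \<open>i < j\<close> red_reverse_nonzero[of "map \<omega> [- j..- i]"] by auto
qed

section \<open>Reconstruction of a point from its unlabelled right brackets\<close>

text \<open>
  Forgetting the indices of the \<open>\<beta>\<^sub>j\<close> leads to sequences over \<open>m + 1\<close> symbols, encoded by
  \<open>'m option\<close> with \<open>None\<close> for the right bracket. The forgotten index is recovered from the
  stack: \<open>stack y t d\<close> is the letter at the last position \<open>k < t\<close> for which the steps over
  \<open>[k, t)\<close> add up to \<open>d + 1\<close>; it is a junk value if there is no such position.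
\<close>

fun forget :: "'m dyck_symbol \<Rightarrow> 'm option" where
  "forget (DAlpha a) = Some a"
| "forget (DBeta b) = None"

definition bstep :: "'m option \<Rightarrow> int" where
  "bstep x = (if x = None then -1 else 1)"

text \<open>The walk is summed backwards from \<open>t\<close>, so that the nearest partner to the
  left corresponds to the least \<open>n\<close>.\<close>

fun bsum :: "(int \<Rightarrow> 'm option) \<Rightarrow> int \<Rightarrow> nat \<Rightarrow> int" where
  "bsum y t 0 = 0"
| "bsum y t (Suc n) = bsum y t n + bstep (y (t - 1 - int n))"

definition stack :: "(int \<Rightarrow> 'm option) \<Rightarrow> int \<Rightarrow> nat \<Rightarrow> 'm" where
  "stack y t d = (if \<exists>n. bsum y t n \<ge> int d + 1
     then the (y (t - int (LEAST n. bsum y t n \<ge> int d + 1))) else undefined)"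

definition decode :: "(int \<Rightarrow> 'm option) \<Rightarrow> int \<Rightarrow> 'm dyck_symbol" where
  "decode y t = (case y t of Some a \<Rightarrow> DAlpha a | None \<Rightarrow> DBeta (stack y t 0))"

lemma forget_decode [simp]: "forget (decode y t) = y t"
  by (cases "y t") (auto simp: decode_def)

lemma bsum_step: "bsum y (t + 1) (Suc n) = bstep (y t) + bsum y t n"
  by (induction n) (auto simp: algebra_simps)

lemma bsum_add: "bsum y t (n + k) = bsum y t n + bsum y (t - int n) k"
  by (induction k) (auto simp: algebra_simps)

lemma bsum_eq_sum: "bsum y t n = (\<Sum>k\<in>{t - int n..<t}. bstep (y k))"
proof (induction n)
  case (Suc n)
  have "{t - int (Suc n)..<t} = insert (t - 1 - int n) {t - int n..<t}" by auto
  then show ?case using Suc by simp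
qed simp

lemma bsum_shift: "bsum (\<lambda>i. y (i + k)) t n = bsum y (t + k) n"
  by (induction n) (auto simp: algebra_simps)

lemma bsum_cong: "(\<And>i. t - int n \<le> i \<Longrightarrow> i < t \<Longrightarrow> y i = y' i) \<Longrightarrow> bsum y t n = bsum y' t n"
  by (simp add: bsum_eq_sum cong: sum.cong_simp)

lemma decode_shift: "decode (\<lambda>i. y (i + k)) t = decode y (t + k)"
  by (simp add: decode_def stack_def bsum_shift algebra_simps split: option.split)

text \<open>One step forward in time lengthens the backward window by one symbol. If the two search
  conditions agree after this shift, their least solutions differ by one and point to the same
  absolute position.\<close>

lemma stack_index_Suc:
  assumes eq: "\<And>n. (int d + 1 \<le> bsum y (t + 1) (Suc n)) = (int e + 1 \<le> bsum y t n)"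
  shows "stack y (t + 1) d = stack y t e"
proof (cases "\<exists>n. int e + 1 \<le> bsum y t n")
  case True
  then obtain n where n: "int d + 1 \<le> bsum y (t + 1) (Suc n)" using eq by auto
  then have "(LEAST n. int d + 1 \<le> bsum y (t + 1) n) = Suc (LEAST n. int d + 1 \<le> bsum y (t + 1) (Suc n))"
    by (rule Least_Suc) simp
  moreover have "\<exists>n. int d + 1 \<le> bsum y (t + 1) n" using n by blast
  ultimately show ?thesis using True by (simp add: stack_def eq del: bsum.simps)
next
  case False
  have "\<not> int d + 1 \<le> bsum y (t + 1) n" for n
    using False eq by (cases n) auto
  with False show ?thesis by (simp add: stack_def)
qed

lemma stack_push:
  assumes "y t = Some a"
  shows "stack y (t + 1) = case_nat a (stack y t)"
proof
  fix d
  show "stack y (t + 1) d = case_nat a (stack y t) d"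
  proof (cases d)
    case 0
    have 1: "1 \<le> bsum y (t + 1) (Suc 0)" using assms by (simp add: bstep_def)
    have "(LEAST n. bsum y (t + 1) n \<ge> 1) = Suc 0"
    proof (rule Least_equality)
      show "Suc 0 \<le> n" if "1 \<le> bsum y (t + 1) n" for n using that by (cases n) auto
    qed (rule 1)
    then show ?thesis using 0 assms 1 by (auto simp: stack_def simp del: bsum.simps)
  next
    case (Suc e)
    have eq: "(int d + 1 \<le> bsum y (t + 1) (Suc n)) = (int e + 1 \<le> bsum y t n)" for n
      using assms Suc unfolding bsum_step by (auto simp: bstep_def)
    show ?thesis using Suc stack_index_Suc[OF eq] by simp
  qed
qed

lemma stack_pop:
  assumes "y t = None"
  shows "stack y (t + 1) d = stack y t (Suc d)"
proof -
  have "(int d + 1 \<le> bsum y (t + 1) (Suc n)) = (int (Suc d) + 1 \<le> bsum y t n)" for n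
    using assms unfolding bsum_step by (auto simp: bstep_def)
  then show ?thesis by (rule stack_index_Suc)
qed

text \<open>This holds for every \<open>y\<close>, junk values included: a decoded right bracket
  carries the top of the stack by definition, so the pop never fails.\<close>

lemma act_decode: "act (decode y t) (stack y t) = Some (stack y (t + 1))"
proof (cases "y t")
  case None
  then show ?thesis by (auto simp: decode_def stack_pop)
next
  case (Some a)
  then show ?thesis by (simp add: decode_def stack_push)
qed

text \<open>Each factor of \<open>decode y\<close> acts on the stack present at its first symbol,
  hence is nonzero. Since stacks are infinite, unmatched right brackets cause no exception.\<close>

lemma decode_in_dyck: "decode y \<in> dyck"
proof -
  have act: "act_word (map (decode y) [i..i + int n - 1]) (stack y i) = Some (stack y (i + int n))" for i n
  proof (induction n arbitrary: i)
    case (Suc n)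
    have "[i..i + int (Suc n) - 1] = i # [i + 1..(i + 1) + int n - 1]"
      by (simp add: upto_rec1)
    then show ?case using Suc[of "i + 1"] by (simp add: act_decode algebra_simps)
  qed simp
  show ?thesis
    unfolding dyck_def
  proof clarify
    fix i j :: int assume "i < j" and "red (map (decode y) [i..j]) = 0"
    moreover have "red (map (decode y) [i..j]) \<noteq> 0"
      using act[of i "nat (j - i + 1)"] \<open>i < j\<close>
      by (intro act_word_imp_red_nonzero[where s="stack y i"]) auto
    ultimately show False by simp
  qed
qed

section \<open>Points all of whose right brackets are matched\<close>

abbreviation height_sum :: "'m dyck_symbol list \<Rightarrow> int" where
  "height_sum w \<equiv> sum_list (map (bstep \<circ> forget) w)"

text \<open>Reading from the left, a right bracket always meets a nonempty stack of left brackets;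
  it cancels the last one or makes the product zero. What survives consists of left brackets only,
  and the height counts them.\<close>

lemma red_of_nonneg_prefixes:
  assumes "\<And>k. k \<le> length w \<Longrightarrow> 0 \<le> height_sum (take k w)"
  shows "red w = 0 \<or> (\<exists>as. red w = red (map DAlpha as) \<and> int (length as) = height_sum w)"
  using assms
proof (induction w rule: rev_induct)
  case Nil
  then show ?case by (intro disjI2 exI[of _ "[]"]) simp
next
  case (snoc x w)
  have "0 \<le> height_sum (take k w)" if "k \<le> length w" for k
    using snoc.prems[of k] that by (simp add: comp_def)
  with snoc.IH consider "red w = 0" |
    as where "red w = red (map DAlpha as)" "int (length as) = height_sum w"
    by blast
  then show ?case
  proof cases
    case 1
    then show ?thesis by (simp add: red_append)
  next
    case (2 as)
    show ?thesis
    proof (cases x)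
      case (DAlpha a)
      have "red (w @ [x]) = red (map DAlpha (as @ [a]))"
        using 2 DAlpha by (simp add: red_append)
      then show ?thesis using 2 DAlpha
        by (intro disjI2 exI[of _ "as @ [a]"]) (simp add: bstep_def comp_def)
    next
      case (DBeta b)
      have "0 \<le> height_sum w - 1"
        using snoc.prems[of "Suc (length w)"] DBeta by (simp add: bstep_def comp_def)
      with 2 have "as \<noteq> []" by auto
      then obtain bs a where as: "as = bs @ [a]" by (metis rev_exhaust)
      have "red (w @ [x]) = red (map DAlpha bs) * (dyck_gen (DAlpha a) * dyck_gen (DBeta b))"
        using 2 DBeta as by (simp add: red_append red_Cons mult.assoc)
      then have "red (w @ [x]) = (if a = b then red (map DAlpha bs) else 0)"
        by (simp add: gen_alpha_beta)
      then show ?thesis using 2 DBeta as by (auto simp: bstep_def comp_def intro!: exI[of _ bs])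
    qed
  qed
qed

lemma bsum_eq_height_sum:
  "bsum (\<lambda>i. forget (\<omega> i)) t n = height_sum (map \<omega> [t - int n..t - 1])"
proof (induction n)
  case (Suc n)
  have "[t - int (Suc n)..t - 1] = (t - int (Suc n)) # [t - int n..t - 1]"
    by (subst upto_rec1) (auto simp: algebra_simps)
  then show ?case using Suc by (simp add: algebra_simps)
qed simp

text \<open>Let \<open>k\<close> be the last position for which the steps over [k, t) add up to 1.
  The word \<open>w\<close> strictly between \<open>k\<close> and \<open>t\<close> has height 0 and
  nonnegative prefixes, so it reduces to 0 or 1. As the factor from \<open>k\<close> to
  \<open>t\<close> is nonzero, the two brackets enclosing \<open>w\<close> must carry equal
  indices.\<close>

lemma decode_forget_at:
  assumes \<omega>: "\<omega> \<in> dyck"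
    and ex: "\<exists>n. 1 \<le> bsum (\<lambda>i. forget (\<omega> i)) t n"
  shows "decode (\<lambda>i. forget (\<omega> i)) t = \<omega> t"
proof (cases "\<omega> t")
  case (DAlpha a)
  then show ?thesis by (simp add: decode_def)
next
  case (DBeta b)
  let ?y = "\<lambda>i. forget (\<omega> i)"
  define N where "N = (LEAST n. 1 \<le> bsum ?y t n)"
  have N: "1 \<le> bsum ?y t N" unfolding N_def using ex by (rule LeastI_ex)
  have less: "bsum ?y t n \<le> 0" if "n < N" for n
    using not_less_Least[of n "\<lambda>n. 1 \<le> bsum ?y t n"] that by (simp add: N_def)
  from N obtain M where M: "N = Suc M" by (cases N) auto
  define k where "k = t - int N"
  have k: "t - 1 - int M = k" by (simp add: k_def M)
  have BM: "bsum ?y t M = 0" and top: "bstep (?y k) = 1"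
    using N less[of M] by (auto simp: M k bstep_def split: if_splits)
  from top obtain a where a: "\<omega> k = DAlpha a"
    by (cases "\<omega> k") (auto simp: bstep_def)
  define w where "w = map \<omega> [k + 1..t - 1]"
  have lw: "length w = M" by (simp add: w_def k_def M)
  \<comment> \<open>The total height of \<open>w\<close> is 0, and by minimality of \<open>N\<close>
    every proper suffix sum is at most 0, so the complementary prefix sum is at least 0.\<close>
  have pre: "0 \<le> height_sum (take j w)" if "j \<le> length w" for j
  proof -
    have "bsum ?y t M = bsum ?y t (M - j) + bsum ?y (t - int (M - j)) j"
      using bsum_add[of ?y t "M - j" j] that lw by simp
    moreover have "bsum ?y (t - int (M - j)) j = height_sum (map \<omega> [k + 1..k + int j])"
      using that lw by (simp add: bsum_eq_height_sum k_def M of_nat_diff algebra_simps)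
    moreover have "take j w = map \<omega> [k + 1..k + int j]"
    proof (cases "j = 0")
      case False
      then have "[k + 1..t - 1] = [k + 1..k + int j] @ [k + int j + 1..t - 1]"
        using that lw by (intro upto_split2) (auto simp: k_def M)
      then show ?thesis by (simp add: w_def)
    qed simp
    moreover have "bsum ?y t (M - j) \<le> 0" by (rule less) (simp add: M)
    ultimately show ?thesis using BM by simp
  qed
  have hw: "height_sum w = 0"
    using BM by (simp add: bsum_eq_height_sum w_def k_def M algebra_simps)
  have word: "map \<omega> [k..t] = DAlpha a # w @ [DBeta b]"
  proof -
    have "[k..t] = k # [k + 1..t]" by (rule upto_rec1) (simp add: k_def)
    moreover have "[k + 1..t] = [k + 1..t - 1] @ [t]" by (rule upto_rec2) (simp add: k_def M)
    ultimately show ?thesis by (simp add: a DBeta w_def)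
  qed
  have nz: "red (map \<omega> [k..t]) \<noteq> 0" using \<omega> by (auto simp: dyck_def k_def M)
  have "red w = 0 \<or> red w = 1"
    using red_of_nonneg_prefixes[OF pre] hw by auto
  then have "a = b"
    using nz unfolding word by (auto simp: red_append red_Cons gen_alpha_beta split: if_splits)
  then show ?thesis
    using DBeta ex a by (auto simp: decode_def stack_def N_def[symmetric] k_def)
qed

text \<open>The hypothesis at time 0 is carried to every time. For \<open>t < 0\<close>, a window
  ending at 0 whose sum exceeds those of all windows of length at most \<open>- t\<close> must start
  to the left of \<open>t\<close>, and its part before \<open>t\<close> has positive sum.\<close>

lemma bsum_unbounded:
  assumes "\<And>c. \<exists>n. c \<le> bsum y 0 n"
  shows "\<exists>n. 1 \<le> bsum y t n"
proof (cases "t \<ge> 0")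
  case True
  obtain n where "1 - bsum y t (nat t) \<le> bsum y 0 n" using assms by blast
  then have "1 \<le> bsum y t (nat t + n)" using True by (simp add: bsum_add)
  then show ?thesis ..
next
  case False
  define k where "k = nat (- t)"
  obtain n where n: "Max ((\<lambda>j. bsum y 0 j) ` {..k}) + 1 \<le> bsum y 0 n" using assms by blast
  have k: "bsum y 0 j \<le> Max ((\<lambda>j. bsum y 0 j) ` {..k})" if "j \<le> k" for j
    using that by (intro Max_ge) auto
  with n have "k < n" by (meson not_less add_le_cancel_left le_less_trans less_add_one not_le)
  then have "bsum y 0 n = bsum y 0 k + bsum y t (n - k)"
    using bsum_add[of y 0 k "n - k"] False by (simp add: k_def)
  with n k[of k] have "1 \<le> bsum y t (n - k)" by linarith
  then show ?thesis ..
qed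

section \<open>Heights and the sets \<open>A_alpha\<close>, \<open>A_beta\<close>\<close>

lemma sum_letters: "(\<Sum>l\<in>UNIV. of_bool (DAlpha l = x) - of_bool (DBeta l = x)) = bstep (forget x)"
  for x :: "'m::finite dyck_symbol"
  by (cases x) (auto simp: bstep_def sum_subtractf sum_negf of_bool_def)

lemma height_nonneg: "0 \<le> i \<Longrightarrow> height \<omega> i = (\<Sum>j\<in>{0..<i}. bstep (forget (\<omega> j)))"
  by (auto simp: height_def sum_letters intro!: sum.cong)

lemma height_neg: "height \<omega> (- int n) = - bsum (\<lambda>i. forget (\<omega> i)) 0 n"
proof -
  have "(\<Sum>l\<in>UNIV. of_bool (DBeta l = x) - of_bool (DAlpha l = x)) = - bstep (forget x)"
    for x :: "'a dyck_symbol"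
    unfolding sum_letters[symmetric] sum_negf[symmetric] by simp
  then show ?thesis
    by (auto simp: height_def bsum_eq_sum sum_negf intro!: sum.cong)
qed

lemma A_alpha_unbounded:
  assumes "\<omega> \<in> A_alpha"
  shows "\<exists>n. c \<le> bsum (\<lambda>i. forget (\<omega> i)) 0 n"
proof -
  have "eventually (\<lambda>i. height \<omega> i \<le> - c) at_bot"
    using assms by (auto simp: A_alpha_def filterlim_at_bot)
  then obtain i0 where "\<And>i. i \<le> i0 \<Longrightarrow> height \<omega> i \<le> - c"
    by (auto simp: eventually_at_bot_linorder)
  from this[of "- int (nat (- i0))"] show ?thesis
    unfolding height_neg by (intro exI[of _ "nat (- i0)"]) simp
qed

text \<open>Reversal fixes position 0, so the window of length \<open>n\<close> before 0 becomes the
  positions 1 to \<open>n\<close>. The height at \<open>n + 1\<close> also counts the symbol at 0;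
  the extra 1 in the bound below compensates for it.\<close>

lemma A_beta_unbounded:
  assumes "\<omega> \<in> A_beta"
  shows "\<exists>n. c \<le> bsum (\<lambda>i. forget (rflip \<omega> i)) 0 n"
proof -
  have bs: "bsum (\<lambda>i. forget (rflip \<omega> i)) 0 n = bstep (forget (\<omega> 0)) - height \<omega> (int n + 1)" for n
  proof -
    have "(\<Sum>k\<in>{- int n..<0}. bstep (forget (rflip \<omega> k))) = (\<Sum>k\<in>{1..<int n + 1}. - bstep (forget (\<omega> k)))"
    proof (rule sum.reindex_bij_witness[of _ uminus uminus])
      fix k
      show "- bstep (forget (\<omega> (- k))) = bstep (forget (rflip \<omega> k))"
        by (cases "\<omega> (- k)") (auto simp: rflip_def bstep_def)
    qed auto
    moreover have "{0..<int n + 1} = insert 0 {1..<int n + 1}" by auto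
    ultimately show ?thesis by (simp add: bsum_eq_sum height_nonneg sum_negf)
  qed
  have "eventually (\<lambda>i. height \<omega> i \<le> - c - 1) at_top"
    using assms by (simp only: A_beta_def mem_Collect_eq filterlim_at_bot)
  then obtain i0 where i0: "\<And>i. i0 \<le> i \<Longrightarrow> height \<omega> i \<le> - c - 1"
    by (auto simp: eventually_at_top_linorder)
  have "-1 \<le> bstep (forget (\<omega> 0))" by (simp add: bstep_def)
  moreover have "height \<omega> (int (nat i0) + 1) \<le> - c - 1" by (rule i0) simp
  ultimately show ?thesis
    unfolding bs by (intro exI[of _ "nat i0"]) linarith
qed

lemma decode_forget_A_alpha:
  assumes "\<omega> \<in> A_alpha"
  shows "decode (\<lambda>i. forget (\<omega> i)) = \<omega>"
proof
  fix t
  show "decode (\<lambda>i. forget (\<omega> i)) t = \<omega> t"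
    using assms A_alpha_unbounded[OF assms]
    by (intro decode_forget_at bsum_unbounded) (auto simp: A_alpha_def)
qed

text \<open>Here \<open>Some a\<close> stands for \<open>DBeta a\<close>, and \<open>None\<close>
  for a left bracket whose index is recovered from the future. The matching coding map is therefore
  \<open>forget\<close> after \<open>swap\<close>.\<close>

definition decode_rev :: "(int \<Rightarrow> 'm option) \<Rightarrow> int \<Rightarrow> 'm dyck_symbol" where
  "decode_rev y = rflip (decode (\<lambda>i. y (- i)))"

lemma decode_forget_A_beta:
  assumes "\<omega> \<in> A_beta"
  shows "decode_rev (\<lambda>i. forget (swap (\<omega> i))) = \<omega>"
proof -
  have "decode (\<lambda>i. forget (rflip \<omega> i)) = rflip \<omega>"
  proof
    fix t
    show "decode (\<lambda>i. forget (rflip \<omega> i)) t = rflip \<omega> t"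
      using assms A_beta_unbounded[OF assms]
      by (intro decode_forget_at bsum_unbounded rflip_in_dyck) (auto simp: A_beta_def)
  qed
  then have "rflip (decode (\<lambda>i. forget (rflip \<omega> i))) = \<omega>" by simp
  then show ?thesis by (simp add: decode_rev_def rflip_def)
qed

lemma decode_rev_shift: "decode_rev (\<lambda>i. y (i + k)) t = decode_rev y (t + k)"
proof -
  have "decode (\<lambda>i. y (- i + k)) s = decode (\<lambda>i. y (- i)) (s - k)" for s
    using decode_shift[of "\<lambda>i. y (- i)" "- k" s] by (simp add: algebra_simps)
  then show ?thesis by (simp add: decode_rev_def rflip_def)
qed

lemma forget_decode_rev: "forget (swap (decode_rev y t)) = y t"
  by (simp add: decode_rev_def rflip_def)

lemma decode_rev_in_dyck: "decode_rev y \<in> dyck"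
  unfolding decode_rev_def by (intro rflip_in_dyck decode_in_dyck)

text \<open>The condition involves only the \<open>L\<close> coordinates before 0, whatever the
  symbol at 0 is. It guarantees that the top of the stack at time 0 is found inside this
  window.\<close>

definition matched_within :: "nat \<Rightarrow> (int \<Rightarrow> 'm option) \<Rightarrow> bool" where
  "matched_within L y \<longleftrightarrow> (\<exists>n\<le>L. 1 \<le> bsum y 0 n)"

lemma decode_local:
  assumes "matched_within L y" and eq: "\<And>i. \<bar>i\<bar> \<le> int L \<Longrightarrow> y i = y' i"
  shows "decode y 0 = decode y' 0"
proof -
  have B: "bsum y 0 n = bsum y' 0 n" if "n \<le> L" for n
    using that by (intro bsum_cong eq) auto
  define N where "N = (LEAST n. 1 \<le> bsum y 0 n)"
  from assms obtain n where n: "n \<le> L" "1 \<le> bsum y 0 n" by (auto simp: matched_within_def)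
  have N: "1 \<le> bsum y 0 N" "N \<le> L"
    using LeastI[of "\<lambda>n. 1 \<le> bsum y 0 n", OF n(2)] Least_le[of "\<lambda>n. 1 \<le> bsum y 0 n", OF n(2)] n(1)
    by (simp_all add: N_def)
  have "(LEAST n. 1 \<le> bsum y' 0 n) = N"
  proof (rule Least_equality)
    show "1 \<le> bsum y' 0 N" using N B by simp
    show "N \<le> k" if "1 \<le> bsum y' 0 k" for k
    proof (rule ccontr)
      assume "\<not> N \<le> k"
      then have "1 \<le> bsum y 0 k" using that B[of k] N by simp
      then have "N \<le> k" unfolding N_def by (rule Least_le)
      with \<open>\<not> N \<le> k\<close> show False ..
    qed
  qed
  moreover have "\<exists>n. 1 \<le> bsum y' 0 n" using N B by auto
  ultimately have "stack y 0 0 = stack y' 0 0"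
    using N n eq[of "- int N"] by (auto simp: stack_def N_def[symmetric])
  with eq[of 0] show ?thesis by (simp add: decode_def split: option.split)
qed

lemma decode_rev_local:
  assumes "matched_within L (\<lambda>i. y (- i))" and "\<And>i. \<bar>i\<bar> \<le> int L \<Longrightarrow> y i = y' i"
  shows "decode_rev y 0 = decode_rev y' 0"
  using decode_local[OF assms(1), of "\<lambda>i. y' (- i)"] assms(2) by (simp add: decode_rev_def rflip_def)

section \<open>Sequence spaces\<close>

instance dyck_symbol :: (finite) finite
proof
  show "finite (UNIV :: 'a dyck_symbol set)"
  proof (rule finite_subset)
    show "UNIV \<subseteq> range DAlpha \<union> (range DBeta :: 'a dyck_symbol set)"
    proof
      show "x \<in> range DAlpha \<union> range DBeta" for x :: "'a dyck_symbol" by (cases x) auto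
    qed
  qed simp
qed

abbreviation seqs :: "('i \<Rightarrow> 'a) measure" where
  "seqs \<equiv> PiM UNIV (\<lambda>_. count_space UNIV)"

lemma space_seqs [simp]: "space seqs = UNIV"
  by (simp add: space_PiM)

lemma measurable_seqsI:
  assumes "\<And>i. (\<lambda>x. f x i) \<in> measurable M (count_space UNIV)"
  shows "f \<in> measurable M seqs"
  by (rule measurable_PiM_single') (use assms in \<open>auto simp: space_PiM\<close>)

lemma measurable_seq_component [measurable]: "(\<lambda>y. y i) \<in> measurable seqs (count_space UNIV)"
  by (rule measurable_component_singleton) simp

lemma space_metric_borel [simp]: "space (metric_borel X d) = X"
  by (simp add: metric_borel_def space_measure_of_conv)

text \<open>Invariant measures live on the Borel sets of a metric, independence on a product
  sigma-algebra. The hypothesis \<open>fine\<close> makes coordinate cylinders open, and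
  \<open>coarse\<close> puts a cylinder inside every ball.\<close>

lemma sets_metric_borel:
  fixes d :: "('i::countable \<Rightarrow> 'a::finite) \<Rightarrow> ('i \<Rightarrow> 'a) \<Rightarrow> real"
  assumes d: "Metric_space X d"
    and fine: "\<And>i. \<exists>e>0. \<forall>x\<in>X. \<forall>y\<in>X. d x y < e \<longrightarrow> x i = y i"
    and coarse: "\<And>e. e > 0 \<Longrightarrow> \<exists>I. finite I \<and> (\<forall>x y. (\<forall>i\<in>I. x i = y i) \<longrightarrow> d x y < e)"
  shows "sets (metric_borel X d) = sets (restrict_space seqs X)"
proof
  interpret Metric_space X d by (rule d)
  have sub: "U \<subseteq> X" if "openin mtopology U" for U
    using that by (simp add: openin_mtopology)
  have sets_eq: "sets (metric_borel X d) = sigma_sets X {U. openin mtopology U}"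
    unfolding metric_borel_def using sub by (intro sets_measure_of) auto
  have op: "openin mtopology {x\<in>X. x i = a}" for i a
    unfolding openin_mtopology
  proof (intro conjI allI impI)
    fix x assume x: "x \<in> {x\<in>X. x i = a}"
    obtain e where e: "e > 0" "\<forall>x\<in>X. \<forall>y\<in>X. d x y < e \<longrightarrow> x i = y i" using fine by blast
    have "y \<in> {x\<in>X. x i = a}" if "y \<in> mball x e" for y
    proof -
      from that have "y \<in> X" "x \<in> X" "d x y < e" by simp_all
      with e(2) have "x i = y i" by blast
      with x \<open>y \<in> X\<close> show ?thesis by simp
    qed
    then have "mball x e \<subseteq> {x\<in>X. x i = a}" ..
    with e show "\<exists>r>0. mball x r \<subseteq> {x\<in>X. x i = a}" by blast
  qed auto
  have "(\<lambda>x. x) \<in> measurable (metric_borel X d) seqs"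
  proof (rule measurable_seqsI)
    fix i
    have "(\<lambda>x. x i) -` {a} \<inter> space (metric_borel X d) = {x\<in>X. x i = a}" for a
      unfolding space_metric_borel by blast
    moreover have "{x\<in>X. x i = a} \<in> sets (metric_borel X d)" for a
      unfolding sets_eq by (rule sigma_sets.Basic) (simp add: op)
    ultimately show "(\<lambda>x. x i) \<in> measurable (metric_borel X d) (count_space UNIV)"
      unfolding measurable_count_space_eq2_countable by simp
  qed
  then have "A \<inter> X \<in> sets (metric_borel X d)" if "A \<in> sets seqs" for A :: "('i \<Rightarrow> 'a) set"
    using measurable_sets[OF _ that, of "\<lambda>x. x" "metric_borel X d"] by (simp add: vimage_ident)
  then show "sets (restrict_space seqs X) \<subseteq> sets (metric_borel X d)"
    by (auto simp: sets_restrict_space Int_commute)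
  define cyl where "cyl I w = {x. \<forall>i\<in>I. x i = w i}" for I and w :: "'i \<Rightarrow> 'a"
  \<comment> \<open>A countable index set has countably many finite subsets, each carrying finitely
    many words. Every open set is thus a countable union of cylinders, traced on
    \<open>X\<close>.\<close>
  define Cs where "Cs = (\<Union>I\<in>{I. finite I}. cyl I ` (PiE I (\<lambda>_. UNIV)))"
  have "countable Cs"
    unfolding Cs_def
    by (intro countable_UN countable_image countable_finite finite_PiE countable_Collect_finite) auto
  have cyl_sets: "C \<in> sets seqs" if "C \<in> Cs" for C
  proof -
    from that obtain I w where I: "finite I" and C: "C = cyl I w" by (auto simp: Cs_def)
    have "{x \<in> space seqs. \<forall>i\<in>I. x i = w i} \<in> sets seqs" using I by measurable
    then show ?thesis by (simp add: C cyl_def)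
  qed
  have "U \<in> sets (restrict_space seqs X)" if U: "openin mtopology U" for U
  proof -
    have "U = (\<Union>C\<in>{C\<in>Cs. C \<inter> X \<subseteq> U}. C) \<inter> X"
    proof (intro equalityI subsetI)
      fix x assume x: "x \<in> U"
      with U obtain r where r: "r > 0" "mball x r \<subseteq> U" by (auto simp: openin_mtopology)
      from coarse[OF r(1)] obtain I where I: "finite I" "\<And>x y. \<forall>i\<in>I. x i = y i \<Longrightarrow> d x y < r" by blast
      have "cyl I (restrict x I) \<in> Cs" using I by (auto simp: Cs_def)
      moreover have "cyl I (restrict x I) \<inter> X \<subseteq> U"
      proof
        fix y assume y: "y \<in> cyl I (restrict x I) \<inter> X"
        then have "y \<in> mball x r" using I(2)[of x y] sub[OF U] x by (auto simp: cyl_def)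
        then show "y \<in> U" using r by blast
      qed
      moreover have "x \<in> cyl I (restrict x I)" by (simp add: cyl_def)
      ultimately show "x \<in> (\<Union>C\<in>{C\<in>Cs. C \<inter> X \<subseteq> U}. C) \<inter> X" using x sub[OF U] by blast
    qed auto
    moreover have "(\<Union>C\<in>{C\<in>Cs. C \<inter> X \<subseteq> U}. C) \<in> sets seqs"
      using cyl_sets \<open>countable Cs\<close> by (intro sets.countable_UN'') (auto intro: countable_subset)
    ultimately show ?thesis by (auto simp: sets_restrict_space)
  qed
  then show "sets (metric_borel X d) \<subseteq> sets (restrict_space seqs X)"
    unfolding sets_eq
    by (intro sets.sigma_sets_subset') (auto simp: sets_restrict_space)
qed

lemma exp_minus_nat_less_ex: "0 < e \<Longrightarrow> \<exists>N::nat. exp (- real N) < e"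
proof -
  assume "0 < e"
  obtain N :: nat where "- ln e < real N" using reals_Archimedean2 by blast
  then have "- real N < ln e" by simp
  then have "exp (- real N) < e" using \<open>0 < e\<close> by (metis exp_less_mono exp_ln)
  then show ?thesis ..
qed

lemma dist_two_less_imp: "dist_two x y < exp (- real N) \<Longrightarrow> \<bar>i\<bar> \<le> int N \<Longrightarrow> x i = y i"
proof (rule ccontr)
  let ?P = "\<lambda>i. x (int i) \<noteq> y (int i) \<or> x (- int i) \<noteq> y (- int i)"
  assume A: "dist_two x y < exp (- real N)" "\<bar>i\<bar> \<le> int N" "x i \<noteq> y i"
  then have "?P (nat \<bar>i\<bar>)" by (cases "i \<ge> 0") auto
  then have "(LEAST i. ?P i) \<le> nat \<bar>i\<bar>" by (rule Least_le)
  with A show False by (auto simp: dist_two_def split: if_splits)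
qed

lemma dist_two_le:
  assumes "\<And>i. \<bar>i\<bar> \<le> int N \<Longrightarrow> x i = y i"
  shows "dist_two x y \<le> exp (- real (Suc N))"
proof (cases "x = y")
  case False
  let ?P = "\<lambda>i. x (int i) \<noteq> y (int i) \<or> x (- int i) \<noteq> y (- int i)"
  from False obtain k where "x k \<noteq> y k" by auto
  then have "?P (nat \<bar>k\<bar>)" by (cases "k \<ge> 0") auto
  then have "?P (LEAST i. ?P i)" by (rule LeastI)
  then have "\<not> (LEAST i. ?P i) \<le> N" using assms by auto
  with False show ?thesis by (simp add: dist_two_def)
qed (simp add: dist_two_def)

lemma dist_plus_less_imp: "dist_plus x y < exp (- real N) \<Longrightarrow> i \<le> N \<Longrightarrow> x i = y i"
  using Least_le[of "\<lambda>i. x i \<noteq> y i" i] by (auto simp: dist_plus_def split: if_splits)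

lemma dist_plus_le:
  assumes "\<And>i. i \<le> N \<Longrightarrow> x i = y i"
  shows "dist_plus x y \<le> exp (- real (Suc N))"
proof (cases "x = y")
  case False
  then have "x (LEAST i. x i \<noteq> y i) \<noteq> y (LEAST i. x i \<noteq> y i)"
    by (intro LeastI_ex[of "\<lambda>i. x i \<noteq> y i"]) auto
  then have "\<not> (LEAST i. x i \<noteq> y i) \<le> N" using assms by auto
  with False show ?thesis by (simp add: dist_plus_def)
qed (simp add: dist_plus_def)

lemma sets_metric_borel_two:
  "sets (metric_borel X (dist_two :: (int \<Rightarrow> 'a::finite) \<Rightarrow> _)) = sets (restrict_space seqs X)"
proof (rule sets_metric_borel[OF Metric_space_dist_two])
  show "\<exists>e>0. \<forall>x\<in>X. \<forall>y\<in>X. dist_two x y < e \<longrightarrow> x i = y i" for i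
    using dist_two_less_imp[of _ _ "nat \<bar>i\<bar>" i] by (intro exI[of _ "exp (- real (nat \<bar>i\<bar>))"]) auto
  show "\<exists>I. finite I \<and> (\<forall>x y :: int \<Rightarrow> 'a. (\<forall>i\<in>I. x i = y i) \<longrightarrow> dist_two x y < e)" if "e > 0" for e
  proof -
    from exp_minus_nat_less_ex[OF that] obtain N where N: "exp (- real N) < e" ..
    have "dist_two x y < e" if "\<forall>i\<in>{- int N..int N}. x i = y i" for x y :: "int \<Rightarrow> 'a"
    proof -
      have "dist_two x y \<le> exp (- real (Suc N))" by (intro dist_two_le that[rule_format]) auto
      also have "\<dots> \<le> exp (- real N)" by simp
      also note N
      finally show ?thesis .
    qed
    then show ?thesis by (intro exI[of _ "{- int N..int N}"] conjI allI impI) auto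
  qed
qed

lemma sets_metric_borel_plus:
  "sets (metric_borel X (dist_plus :: (nat \<Rightarrow> 'a::finite) \<Rightarrow> _)) = sets (restrict_space seqs X)"
proof (rule sets_metric_borel[OF Metric_space_dist_plus])
  show "\<exists>e>0. \<forall>x\<in>X. \<forall>y\<in>X. dist_plus x y < e \<longrightarrow> x i = y i" for i
    using dist_plus_less_imp[of _ _ i i] by (intro exI[of _ "exp (- real i)"]) auto
  show "\<exists>I. finite I \<and> (\<forall>x y :: nat \<Rightarrow> 'a. (\<forall>i\<in>I. x i = y i) \<longrightarrow> dist_plus x y < e)" if "e > 0" for e
  proof -
    from exp_minus_nat_less_ex[OF that] obtain N where N: "exp (- real N) < e" ..
    have "dist_plus x y < e" if "\<forall>i\<in>{..N}. x i = y i" for x y :: "nat \<Rightarrow> 'a"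
    proof -
      have "dist_plus x y \<le> exp (- real (Suc N))" by (intro dist_plus_le that[rule_format]) auto
      also have "\<dots> \<le> exp (- real N)" by simp
      also note N
      finally show ?thesis .
    qed
    then show ?thesis by (intro exI[of _ "{..N}"] conjI allI impI) auto
  qed
qed

section \<open>Measurability of decoding\<close>

lemma measurable_count_space_pair:
  fixes f :: "'x \<Rightarrow> 'a::countable" and g :: "'x \<Rightarrow> 'b::countable"
  assumes f: "f \<in> measurable M (count_space UNIV)" and g: "g \<in> measurable M (count_space UNIV)"
  shows "(\<lambda>x. h (f x) (g x)) \<in> measurable M (count_space UNIV)"
  by (rule measurable_compose_countable[OF measurable_compose_countable[OF _ g] f]) simp

lemma measurable_bsum [measurable]: "(\<lambda>y. bsum y t n) \<in> measurable seqs (count_space UNIV)"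
  for t :: int
proof (induction n)
  case (Suc n)
  have "(\<lambda>y. bstep (y (t - 1 - int n))) \<in> measurable seqs (count_space UNIV)"
    by (rule measurable_compose[OF measurable_seq_component]) simp
  with Suc show ?case
    unfolding bsum.simps by (rule measurable_count_space_pair)
qed simp

lemma measurable_stack [measurable]:
  "(\<lambda>y :: int \<Rightarrow> 'm::finite option. stack y t d) \<in> measurable seqs (count_space UNIV)"
proof -
  have pred: "Measurable.pred seqs (\<lambda>y :: int \<Rightarrow> 'm option. int d + 1 \<le> bsum y t n)" for n
    by (rule measurable_compose[OF measurable_bsum]) simp
  have "(\<lambda>y :: int \<Rightarrow> 'm option. LEAST n. int d + 1 \<le> bsum y t n) \<in> measurable seqs (count_space UNIV)"
    by (rule measurable_Least) (use pred in \<open>auto simp: measurable_def pred_def\<close>)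
  \<comment> \<open>The coordinate is read at a random position; countably many positions are
    possible, so measurability is checked for each fixed one.\<close>
  then have "(\<lambda>y :: int \<Rightarrow> 'm option. the (y (t - int (LEAST n. int d + 1 \<le> bsum y t n))))
      \<in> measurable seqs (count_space UNIV)"
    by (rule measurable_compose_countable[rotated])
      (rule measurable_compose[OF measurable_seq_component], simp)
  moreover have "Measurable.pred seqs (\<lambda>y :: int \<Rightarrow> 'm option. \<exists>n. int d + 1 \<le> bsum y t n)"
    using pred by measurable
  ultimately show ?thesis
    unfolding stack_def by (intro measurable_If) (auto simp: pred_def)
qed

lemma measurable_decode: "decode \<in> measurable seqs (seqs :: (int \<Rightarrow> 'm::finite dyck_symbol) measure)"
proof (rule measurable_seqsI)
  fix t
  show "(\<lambda>y :: int \<Rightarrow> 'm option. decode y t) \<in> measurable seqs (count_space UNIV)"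
    unfolding decode_def
    by (rule measurable_count_space_pair[where h = "\<lambda>a b. case a of Some a \<Rightarrow> DAlpha a | None \<Rightarrow> DBeta b"]) measurable
qed

lemma measurable_reindex: "(\<lambda>y i. y (f i)) \<in> measurable seqs seqs"
  by (rule measurable_seqsI) simp

lemma measurable_decode_rev: "decode_rev \<in> measurable seqs (seqs :: (int \<Rightarrow> 'm::finite dyck_symbol) measure)"
proof -
  have "(\<lambda>y. decode_rev y t) \<in> measurable seqs (count_space UNIV :: 'm dyck_symbol measure)" for t
    using measurable_compose[OF measurable_compose[OF measurable_reindex[of uminus] measurable_decode]
        measurable_compose[OF measurable_seq_component[of "- t"], of swap "count_space UNIV"]]
    by (simp add: decode_rev_def rflip_def)
  then show ?thesis by (rule measurable_seqsI)
qed

lemma measurable_matched_within: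
  "Measurable.pred seqs (matched_within L :: (int \<Rightarrow> 'm::finite option) \<Rightarrow> bool)"
proof -
  have pred: "Measurable.pred seqs (\<lambda>y :: int \<Rightarrow> 'm option. 1 \<le> bsum y 0 n)" for n
    by (rule measurable_compose[OF measurable_bsum]) simp
  have "Measurable.pred seqs (\<lambda>y :: int \<Rightarrow> 'm option. \<exists>n\<in>{..L}. 1 \<le> bsum y 0 n)"
    using pred by measurable
  then show ?thesis by (simp add: matched_within_def[abs_def] Bex_def)
qed

section \<open>The uniform Bernoulli measure\<close>

definition bern :: "(int \<Rightarrow> 'a::finite) measure" where
  "bern = PiM UNIV (\<lambda>_. measure_pmf (pmf_of_set UNIV))"

lemma sets_bern [measurable_cong, simp]: "sets bern = sets seqs"
  unfolding bern_def by (intro sets_PiM_cong) auto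

lemma space_bern [simp]: "space bern = UNIV"
  using sets_eq_imp_space_eq[OF sets_bern] by simp

lemma prob_space_bern: "prob_space bern"
  unfolding bern_def by (intro prob_space_PiM measure_pmf.prob_space_axioms)

lemma distr_bern_reindex:
  assumes "inj f"
  shows "distr bern bern (\<lambda>y i. y (f i)) = (bern :: (int \<Rightarrow> 'a::finite) measure)"
  using distr_PiM_reindex[of UNIV "\<lambda>_. measure_pmf (pmf_of_set (UNIV::'a set))" f UNIV] assms
  by (simp add: bern_def measure_pmf.prob_space_axioms restrict_def)

lemma distr_bern_component:
  "distr bern (count_space UNIV) (\<lambda>y. y i) = measure_pmf (pmf_of_set (UNIV :: 'a::finite set))"
proof -
  have "distr bern (count_space UNIV) (\<lambda>y. y i) =
      distr (bern :: (int \<Rightarrow> 'a) measure) (measure_pmf (pmf_of_set UNIV)) (\<lambda>y. y i)"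
    by (rule distr_cong) simp_all
  then show ?thesis
    using distr_PiM_component[of UNIV "\<lambda>_::int. measure_pmf (pmf_of_set (UNIV::'a set))" i]
    by (simp add: bern_def measure_pmf.prob_space_axioms)
qed

lemma indep_vars_bern:
  "prob_space.indep_vars (bern :: (int \<Rightarrow> 'a::finite) measure) (\<lambda>_. count_space UNIV) (\<lambda>i y. y i) UNIV"
proof -
  interpret prob_space "bern :: (int \<Rightarrow> 'a) measure" by (rule prob_space_bern)
  have "distr bern seqs (\<lambda>y. y) = (bern :: (int \<Rightarrow> 'a) measure)"
    by (rule distr_id2) simp
  then show ?thesis
    using distr_bern_component[where 'a = 'a]
    by (subst indep_vars_iff_distr_eq_PiM) (auto simp: bern_def restrict_def)
qed

lemma bern_window:
  assumes "finite J"
  shows "measure bern {y :: int \<Rightarrow> 'a::finite. \<forall>i\<in>J. y i = w i} = (1 / CARD('a)) ^ card J"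
proof -
  have "emeasure bern (prod_emb UNIV (\<lambda>_. measure_pmf (pmf_of_set (UNIV::'a set))) J (PiE J (\<lambda>i. {w i})))
      = (\<Prod>i\<in>J. emeasure (measure_pmf (pmf_of_set (UNIV::'a set))) {w i})"
    unfolding bern_def using assms by (intro emeasure_PiM_emb measure_pmf.prob_space_axioms) auto
  also have "\<dots> = (\<Prod>i\<in>J. ennreal (1 / CARD('a)))"
    by (rule prod.cong[OF HOL.refl], subst emeasure_pmf_single, simp)
  also have "\<dots> = ennreal ((1 / CARD('a)) ^ card J)"
    by (simp add: ennreal_power)
  also have "prod_emb UNIV (\<lambda>_. measure_pmf (pmf_of_set (UNIV::'a set))) J (PiE J (\<lambda>i. {w i}))
      = {y. \<forall>i\<in>J. y i = w i}"
    by (auto simp: prod_emb_def PiE_iff extensional_def)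
  finally show ?thesis by (simp add: measure_def)
qed

lemma sets_window: "{y. \<forall>i\<in>{- int N..int N}. y i = w i} \<in> sets (seqs :: (int \<Rightarrow> 'a::finite) measure)"
proof -
  have "{y \<in> space (seqs :: (int \<Rightarrow> 'a) measure). \<forall>i\<in>{- int N..int N}. y i = w i} \<in> sets seqs"
    by measurable
  then show ?thesis by simp
qed

text \<open>A cylinder over a finite set of coordinates is a finite disjoint union of full symmetric
  windows, namely one for each word on the window that satisfies the constraints.\<close>

lemma measure_eqI_windows:
  fixes M M' :: "(int \<Rightarrow> 'a::finite) measure"
  assumes sets: "sets M = sets seqs" "sets M' = sets seqs" and fin: "finite_measure M" "finite_measure M'"
    and eq: "\<And>N w. measure M {y. \<forall>i\<in>{- int N..int N}. y i = w i} = measure M' {y. \<forall>i\<in>{- int N..int N}. y i = w i}"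
  shows "M = M'"
proof (rule measure_eqI_PiM_infinite)
  fix A :: "int \<Rightarrow> 'a set" and J :: "int set" assume J: "finite J"
  let ?D = "prod_emb UNIV (\<lambda>_. count_space UNIV) J (PiE J A)"
  obtain N where N: "J \<subseteq> {- int N..int N}"
  proof
    show "J \<subseteq> {- int (nat (Max (abs ` insert 0 J)))..int (nat (Max (abs ` insert 0 J)))}"
    proof
      fix i assume "i \<in> J"
      then have "\<bar>i\<bar> \<le> Max (abs ` insert 0 J)" using J by (intro Max_ge) auto
      then show "i \<in> {- int (nat (Max (abs ` insert 0 J)))..int (nat (Max (abs ` insert 0 J)))}" by auto
    qed
  qed
  let ?I = "{- int N..int N}"
  let ?W = "{w \<in> PiE ?I (\<lambda>_. UNIV). \<forall>i\<in>J. w i \<in> A i}"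
  let ?c = "\<lambda>w. {y. \<forall>i\<in>?I. y i = w i}"
  have D: "?D = (\<Union>w\<in>?W. ?c w)"
  proof (intro equalityI subsetI)
    fix y assume "y \<in> ?D"
    then have "restrict y ?I \<in> ?W" using N by (auto simp: prod_emb_def PiE_iff)
    moreover have "y \<in> ?c (restrict y ?I)" by simp
    ultimately show "y \<in> (\<Union>w\<in>?W. ?c w)" by blast
  next
    fix y assume "y \<in> (\<Union>w\<in>?W. ?c w)"
    then obtain w where w: "w \<in> ?W" "y \<in> ?c w" by blast
    have "y i \<in> A i" if "i \<in> J" for i
    proof -
      have "y i = w i" using w(2) that N by blast
      with w(1) that show ?thesis by simp
    qed
    then show "y \<in> ?D" by (simp add: prod_emb_def PiE_iff)
  qed
  have fW: "finite ?W" by (rule finite_subset[OF _ finite_PiE[of ?I "\<lambda>_. UNIV"]]) auto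
  have disj: "disjoint_family_on ?c ?W"
    unfolding disjoint_family_on_def
  proof (intro ballI impI)
    fix u w assume uw: "u \<in> ?W" "w \<in> ?W" "u \<noteq> w"
    show "?c u \<inter> ?c w = {}"
    proof (rule ccontr)
      assume "?c u \<inter> ?c w \<noteq> {}"
      then obtain y where y: "y \<in> ?c u" "y \<in> ?c w" by blast
      have "u = w"
      proof (rule PiE_ext)
        show "u \<in> PiE ?I (\<lambda>_. UNIV)" "w \<in> PiE ?I (\<lambda>_. UNIV)" using uw by simp_all
        fix i assume "i \<in> ?I"
        then have "y i = u i" "y i = w i" using y by blast+
        then show "u i = w i" by simp
      qed
      with uw(3) show False by simp
    qed
  qed
  have "measure K ?D = (\<Sum>w\<in>?W. measure K (?c w))" if K: "sets K = sets seqs" "finite_measure K" for K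
    unfolding D using fW disj sets_window[of N] K
    by (intro finite_measure.finite_measure_finite_Union) auto
  from this[OF sets(1) fin(1)] this[OF sets(2) fin(2)]
  have "measure M ?D = measure M' ?D" by (simp add: eq)
  then show "emeasure M ?D = emeasure M' ?D"
    using fin by (simp add: finite_measure.emeasure_eq_measure)
qed (use sets fin in auto)

lemma bern_integral_mult:
  fixes F G :: "(int \<Rightarrow> 'a::finite) \<Rightarrow> real"
  assumes AB: "A \<inter> B = {}"
    and F: "F \<in> borel_measurable seqs" "\<And>y y'. (\<And>i. i \<in> A \<Longrightarrow> y i = y' i) \<Longrightarrow> F y = F y'" "integrable bern F"
    and G: "G \<in> borel_measurable seqs" "\<And>y y'. (\<And>i. i \<in> B \<Longrightarrow> y i = y' i) \<Longrightarrow> G y = G y'" "integrable bern G"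
  shows "(\<integral>y. F y * G y \<partial>bern) = (\<integral>y. F y \<partial>bern) * (\<integral>y. G y \<partial>bern)"
proof -
  interpret prob_space "bern :: (int \<Rightarrow> 'a) measure" by (rule prob_space_bern)
  \<comment> \<open>Elements of the product over \<open>C\<close> take the value
    \<open>undefined\<close> outside \<open>C\<close>. These coordinates are constant, so regarding
    such an element as a full sequence is measurable.\<close>
  have id: "(\<lambda>z. z) \<in> measurable (PiM C (\<lambda>_. count_space UNIV)) (seqs :: (int \<Rightarrow> 'a) measure)" for C
  proof (rule measurable_seqsI)
    fix i :: int
    show "(\<lambda>z. z i) \<in> measurable (PiM C (\<lambda>_. count_space UNIV)) (count_space (UNIV :: 'a set))"
    proof (cases "i \<in> C")
      case False
      then have "z i = undefined" if "z \<in> space (PiM C (\<lambda>_. count_space (UNIV :: 'a set)))" for z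
        using that by (auto simp: space_PiM PiE_iff extensional_def)
      then show ?thesis by (subst measurable_cong[where g = "\<lambda>_. undefined"]) auto
    qed (rule measurable_component_singleton)
  qed
  have "indep_var (PiM A (\<lambda>_. count_space UNIV)) (\<lambda>y. restrict (\<lambda>i. y i) A)
      (PiM B (\<lambda>_. count_space UNIV)) (\<lambda>y. restrict (\<lambda>i. y i) B)"
    by (rule indep_var_restrict[OF indep_vars_bern AB]) auto
  from indep_var_compose[OF this measurable_compose[OF id F(1)] measurable_compose[OF id G(1)]]
  have "indep_var borel (F \<circ> (\<lambda>y. restrict y A)) borel (G \<circ> (\<lambda>y. restrict y B))" by simp
  moreover have "F \<circ> (\<lambda>y. restrict y A) = F"
    unfolding comp_def by (rule ext, rule F(2)) simp
  moreover have "G \<circ> (\<lambda>y. restrict y B) = G"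
    unfolding comp_def by (rule ext, rule G(2)) simp
  ultimately have "indep_var borel F borel G" by simp
  then show ?thesis using F(3) G(3) by (rule indep_var_lebesgue_integral)
qed

text \<open>
  The exponential moment \<open>E ((3/4)\<^sup>S)\<close> of one step \<open>S\<close> of the walk is below \<open>1\<close> exactly because
  \<open>m \<ge> 2\<close>.
\<close>

definition unmatched_rate :: "'m::finite itself \<Rightarrow> real" where
  "unmatched_rate _ = (3 / 4 * CARD('m) + 4 / 3) / (CARD('m) + 1)"

lemma unmatched_rate_less_1: "CARD('m::finite) \<ge> 2 \<Longrightarrow> unmatched_rate TYPE('m) < 1"
  by (simp add: unmatched_rate_def divide_simps)

lemma unmatched_rate_pos: "0 < unmatched_rate TYPE('m::finite)"
  by (simp add: unmatched_rate_def divide_simps add_pos_pos)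

text \<open>A Chernoff bound: without a match the sum over all \<open>L\<close> steps is at most 0,
  so 3/4 raised to it is at least 1. The expectation of this power factorises by
  independence.\<close>

lemma bern_not_matched_within:
  "measure bern {y :: int \<Rightarrow> 'm::finite option. \<not> matched_within L y} \<le> unmatched_rate TYPE('m) ^ L"
proof -
  interpret prob_space "bern :: (int \<Rightarrow> 'm option) measure" by (rule prob_space_bern)
  define f :: "'m option \<Rightarrow> real" where "f b = (3 / 4) powr of_int (bstep b)" for b
  let ?I = "{- int L..<0}"
  let ?F = "\<lambda>y :: int \<Rightarrow> 'm option. \<Prod>k\<in>?I. f (y k)"
  have f_eq: "f b = (if b = None then 4 / 3 else 3 / 4)" for b
    by (simp add: f_def bstep_def powr_minus)
  have meas: "(\<lambda>y :: int \<Rightarrow> 'm option. f (y k)) \<in> borel_measurable seqs" for k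
    by (rule measurable_compose[OF measurable_seq_component]) simp
  have int: "integrable bern (\<lambda>y :: int \<Rightarrow> 'm option. f (y k))" for k
    by (rule integrable_const_bound[where B = 2]) (use meas in \<open>auto simp: f_eq cong: measurable_cong_sets\<close>)
  have indep: "indep_vars (\<lambda>_. borel) (\<lambda>k (y :: int \<Rightarrow> 'm option). f (y k)) ?I"
    by (rule indep_vars_compose2[OF indep_vars_subset[OF indep_vars_bern]]) auto
  have expf: "(\<integral>y. f (y k) \<partial>bern) = unmatched_rate TYPE('m)" for k
  proof -
    have "(\<integral>y. f (y k) \<partial>bern) = (\<integral>b. f b \<partial>distr bern (count_space UNIV) (\<lambda>y. y k))"
      by (rule integral_distr[symmetric]) (simp_all cong: measurable_cong_sets)
    also have "\<dots> = (\<Sum>b\<in>UNIV. f b) / real (CARD('m option))"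
      by (simp add: distr_bern_component integral_pmf_of_set)
    also have "(\<Sum>b\<in>UNIV. f b) = 3 / 4 * CARD('m) + 4 / 3"
      by (simp add: UNIV_option_conv sum.reindex f_eq)
    finally show ?thesis by (simp add: unmatched_rate_def)
  qed
  have F_int: "integrable bern ?F"
    by (rule indep_vars_integrable[OF _ indep int]) simp
  have "prob {y. \<not> matched_within L y} =
      (\<integral>y. indicator {y :: int \<Rightarrow> 'm option. \<not> matched_within L y} y \<partial>bern)"
    by simp
  also have "\<dots> \<le> (\<integral>y. ?F y \<partial>bern)"
  proof (rule integral_mono)
    fix y :: "int \<Rightarrow> 'm option"
    have "?F y = (3 / 4) powr of_int (bsum y 0 L)"
      by (simp add: f_def powr_sum bsum_eq_sum)
    moreover have "1 \<le> (3 / 4 :: real) powr of_int (bsum y 0 L)" if "bsum y 0 L \<le> 0"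
    proof -
      have "(3 / 4 :: real) powr 0 \<le> (3 / 4) powr of_int (bsum y 0 L)"
        using that by (intro powr_mono') auto
      then show ?thesis by simp
    qed
    moreover have "bsum y 0 L \<le> 0" if "\<not> matched_within L y"
      using that by (force simp: matched_within_def)
    ultimately show "indicator {y. \<not> matched_within L y} y \<le> ?F y"
      by (auto simp: indicator_def)
  next
    have "{y \<in> space seqs. \<not> matched_within L (y :: int \<Rightarrow> 'm option)} \<in> sets seqs"
      using measurable_matched_within[of L] by measurable
    then show "integrable bern (\<lambda>y. indicat_real {y :: int \<Rightarrow> 'm option. \<not> matched_within L y} y)"
      by (intro integrable_real_indicator) (auto simp: emeasure_eq_measure)
  qed (rule F_int)
  also have "\<dots> = (\<Prod>k\<in>?I. \<integral>y. f (y k) \<partial>bern)"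
    by (rule indep_vars_lebesgue_integral[OF _ indep int]) simp
  also have "\<dots> = unmatched_rate TYPE('m) ^ L"
    by (simp add: expf)
  finally show ?thesis .
qed

section \<open>Entropy of a simple function\<close>

text \<open>The entropy, in natural logarithm, of the partition into fibres of \<open>X\<close>. For
  simple functions it is the information-theoretic entropy to base \<open>exp 1\<close>, which gives
  access to data processing and the chain rule.\<close>

definition ent :: "'a measure \<Rightarrow> ('a \<Rightarrow> 'b) \<Rightarrow> real" where
  "ent M X = - (\<Sum>x\<in>X ` space M. measure M (X -` {x} \<inter> space M) * ln (measure M (X -` {x} \<inter> space M)))"

lemma ent_superset:
  assumes "finite S" "X ` space M \<subseteq> S"
  shows "ent M X = - (\<Sum>x\<in>S. measure M (X -` {x} \<inter> space M) * ln (measure M (X -` {x} \<inter> space M)))"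
proof -
  have "X -` {x} \<inter> space M = {}" if "x \<notin> X ` space M" for x using that by auto
  then show ?thesis
    unfolding ent_def using assms by (subst sum.mono_neutral_left[of S]) auto
qed

lemma ent_cong: "(\<And>\<omega>. \<omega> \<in> space M \<Longrightarrow> X \<omega> = Y \<omega>) \<Longrightarrow> ent M X = ent M Y"
  unfolding ent_def by (intro arg_cong[where f = uminus] sum.cong) (auto intro!: arg_cong2[where f = "(*)"] arg_cong[where f = "measure M"] arg_cong[where f = ln])

context prob_space
begin

lemma information_space_exp1: "information_space M (exp 1)"
  by unfold_locales (simp add: exp_gt_one)

lemma ent_eq_entropy:
  assumes "simple_function M X"
  shows "ent M X = entropy (exp 1) (count_space (X ` space M)) X"
proof -
  interpret information_space M "exp 1" by (rule information_space_exp1)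
  show ?thesis
    unfolding ent_def
    by (subst entropy_simple_distributed[OF simple_distributedI[OF assms measure_nonneg HOL.refl]])
      (simp add: log_def)
qed

lemma ent_compose_le:
  assumes "simple_function M X"
  shows "ent M (\<lambda>\<omega>. f (X \<omega>)) \<le> ent M X"
proof -
  interpret information_space M "exp 1" by (rule information_space_exp1)
  show ?thesis
    using entropy_data_processing[OF assms, of f] assms simple_function_compose[OF assms, of f]
    by (simp add: ent_eq_entropy comp_def)
qed

lemma ent_function_le:
  assumes "simple_function M X" "\<And>\<omega>. \<omega> \<in> space M \<Longrightarrow> Y \<omega> = f (X \<omega>)"
  shows "ent M Y \<le> ent M X"
  using ent_compose_le[OF assms(1), of f] ent_cong[of M Y "\<lambda>\<omega>. f (X \<omega>)"] assms(2) by simp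

lemma ent_Pair_le:
  assumes "simple_function M X" "simple_function M Y"
  shows "ent M (\<lambda>\<omega>. (X \<omega>, Y \<omega>)) \<le> ent M X + ent M Y"
proof -
  interpret information_space M "exp 1" by (rule information_space_exp1)
  show ?thesis
    using conditional_entropy_less_eq_entropy[OF assms(2,1)] entropy_chain_rule[OF assms] assms
      simple_function_Pair[OF assms]
    by (simp add: ent_eq_entropy)
qed

lemma ent_nonneg: "0 \<le> ent M X"
proof -
  have "measure M A * ln (measure M A) \<le> 0" for A
    by (cases "measure M A = 0") (auto simp: mult_le_0_iff zero_less_measure_iff)
  then show ?thesis by (simp add: ent_def sum_nonpos)
qed

text \<open>A family of events is bundled into one set-valued function, and each event adds at most
  its own entropy. This serves to record the approximation errors for all cells of a partition
  simultaneously.\<close>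

lemma ent_subset_finite_union:
  assumes "finite V" "\<And>v. v \<in> V \<Longrightarrow> simple_function M (E v)"
  shows "simple_function M (\<lambda>\<omega>. {v\<in>V. E v \<omega>}) \<and> ent M (\<lambda>\<omega>. {v\<in>V. E v \<omega>}) \<le> (\<Sum>v\<in>V. ent M (E v))"
  using assms
proof (induction V rule: finite_induct)
  case empty
  then show ?case by (simp add: ent_def not_empty prob_space image_constant_conv)
next
  case (insert a V)
  have eq: "{v \<in> insert a V. E v \<omega>} = (case ({v\<in>V. E v \<omega>}, E a \<omega>) of (A, b) \<Rightarrow> if b then insert a A else A)" for \<omega>
    by auto
  have sf: "simple_function M (\<lambda>\<omega>. ({v\<in>V. E v \<omega>}, E a \<omega>))"
    using insert by (intro simple_function_Pair) auto
  have "simple_function M (\<lambda>\<omega>. {v\<in>insert a V. E v \<omega>})"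
    unfolding eq by (rule simple_function_compose1[OF sf])
  moreover have "ent M (\<lambda>\<omega>. {v\<in>insert a V. E v \<omega>}) \<le> ent M (\<lambda>\<omega>. ({v\<in>V. E v \<omega>}, E a \<omega>))"
    unfolding eq by (rule ent_compose_le[OF sf])
  moreover have "ent M (\<lambda>\<omega>. ({v\<in>V. E v \<omega>}, E a \<omega>)) \<le> ent M (\<lambda>\<omega>. {v\<in>V. E v \<omega>}) + ent M (E a)"
    using insert by (intro ent_Pair_le) auto
  ultimately show ?case using insert by (simp add: add.commute)
qed

text \<open>The binary entropy tends to 0 as the probability tends to 0 from the right; probability
  0 itself is treated apart.\<close>

lemma ent_event_small:
  assumes "0 < \<epsilon>"
  shows "\<exists>\<delta>>0. \<forall>A\<in>events. prob A < \<delta> \<longrightarrow> ent M (\<lambda>\<omega>. \<omega> \<in> A) < \<epsilon>"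
proof -
  have "((\<lambda>p :: real. - (p * ln p + (1 - p) * ln (1 - p))) \<longlongrightarrow> 0) (at_right 0)"
    by real_asymp
  then have "eventually (\<lambda>p :: real. - (p * ln p + (1 - p) * ln (1 - p)) < \<epsilon>) (at_right 0)"
    using assms by (rule order_tendstoD)
  then obtain \<delta> where \<delta>: "\<delta> > 0" "\<And>p :: real. 0 < p \<Longrightarrow> p < \<delta> \<Longrightarrow> - (p * ln p + (1 - p) * ln (1 - p)) < \<epsilon>"
    by (auto simp: eventually_at_right_field)
  have "ent M (\<lambda>\<omega>. \<omega> \<in> A) < \<epsilon>" if A: "A \<in> events" "prob A < \<delta>" for A
  proof -
    have "(\<lambda>\<omega>. \<omega> \<in> A) -` {True} \<inter> space M = A" "(\<lambda>\<omega>. \<omega> \<in> A) -` {False} \<inter> space M = space M - A"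
      using sets.sets_into_space[OF A(1)] by auto
    then have "ent M (\<lambda>\<omega>. \<omega> \<in> A) = - (prob A * ln (prob A) + (1 - prob A) * ln (1 - prob A))"
      by (subst ent_superset[of UNIV]) (auto simp: UNIV_bool prob_compl A)
    then show ?thesis
      using \<delta>(2)[of "prob A"] A assms by (cases "prob A = 0") (auto simp: zero_less_measure_iff)
  qed
  with \<delta>(1) show ?thesis by blast
qed

text \<open>The nonnegative terms \<open>g x\<close> add up to the difference between
  \<open>ln (card S)\<close> and the entropy, because the terms \<open>1 / N - ?p x\<close> cancel
  in the sum. Nonnegativity is \<open>ln z \<le> z - 1\<close>, and equality there forces
  \<open>z = 1\<close>.\<close>

lemma ent_gibbs:
  assumes X: "simple_function M X" and S: "finite S" "S \<noteq> {}" "X ` space M \<subseteq> S"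
  shows "ent M X \<le> ln (card S)"
    and "ent M X = ln (card S) \<Longrightarrow> x \<in> S \<Longrightarrow> prob (X -` {x} \<inter> space M) = 1 / card S"
proof -
  let ?p = "\<lambda>x. prob (X -` {x} \<inter> space M)"
  define N where "N = real (card S)"
  have N: "N > 0" using S by (auto simp: N_def card_gt_0_iff)
  define g where "g x = 1 / N - ?p x + ?p x * (ln (?p x) + ln N)" for x
  have g: "0 \<le> g x \<and> (g x = 0 \<longrightarrow> ?p x = 1 / N)" for x
  proof (cases "?p x = 0")
    case True
    then show ?thesis using N by (simp add: g_def)
  next
    case False
    then have p: "?p x > 0" by (simp add: zero_less_measure_iff)
    define z where "z = 1 / (?p x * N)"
    have z: "z > 0" using p N by (simp add: z_def)
    have "ln (?p x) + ln N = - ln z" using p N by (simp add: z_def ln_div ln_mult)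
    moreover have "1 / N = ?p x * z" using p N by (simp add: z_def)
    ultimately have eq: "g x = ?p x * (z - 1 - ln z)"
      by (simp only: g_def) (simp add: algebra_simps)
    have "ln z \<le> z - 1" using z by (rule ln_le_minus_one)
    then have "0 \<le> g x" using p by (simp add: eq)
    moreover have "?p x = 1 / N" if "g x = 0"
    proof -
      have "z = 1" using that eq p z ln_eq_minus_one[of z] by auto
      then show ?thesis using p N by (simp add: z_def field_simps)
    qed
    ultimately show ?thesis by blast
  qed
  have sum1: "(\<Sum>x\<in>S. ?p x) = 1"
  proof -
    have "(\<Sum>x\<in>S. ?p x) = prob (\<Union>x\<in>S. X -` {x} \<inter> space M)"
      using S X by (intro finite_measure_finite_Union[symmetric])
        (auto simp: disjoint_family_on_def intro: simple_functionD)
    also have "(\<Union>x\<in>S. X -` {x} \<inter> space M) = space M" using S by auto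
    finally show ?thesis by (simp add: prob_space)
  qed
  have "(\<Sum>x\<in>S. g x) = (\<Sum>x\<in>S. 1 / N) - (\<Sum>x\<in>S. ?p x) + (\<Sum>x\<in>S. ?p x * ln (?p x)) + (\<Sum>x\<in>S. ?p x) * ln N"
    by (simp add: g_def sum.distrib sum_subtractf distrib_left sum_distrib_right)
  also have "\<dots> = ln N - ent M X"
    using N by (simp add: sum1 ent_superset[OF S(1,3)] N_def)
  finally have sg: "(\<Sum>x\<in>S. g x) = ln N - ent M X" .
  then show "ent M X \<le> ln (card S)"
    using g sum_nonneg[of S g] by (simp add: N_def)
  show "?p x = 1 / card S" if "ent M X = ln (card S)" "x \<in> S"
    using sg that g S sum_nonneg_eq_0_iff[of S g] by (simp add: N_def)
qed

end

lemma ent_uniform: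
  assumes "finite (X ` space M)" "\<And>x. x \<in> X ` space M \<Longrightarrow> measure M (X -` {x} \<inter> space M) = 1 / c"
    and "card (X ` space M) = c"
  shows "ent M X = ln c"
  using assms by (cases "c = 0") (simp_all add: ent_def ln_div)

section \<open>Subadditive sequences\<close>

lemma subadditive_mult_le:
  fixes a :: "nat \<Rightarrow> real"
  assumes sub: "\<And>m n. a (m + n) \<le> a m + a n" and zero: "a 0 = 0"
  shows "a (j * k) \<le> j * a k"
proof (induction j)
  case (Suc j)
  have "a (k + j * k) \<le> a k + a (j * k)" by (rule sub)
  with Suc show ?case by (simp add: algebra_simps)
qed (simp add: zero)

text \<open>Fekete's lemma: a \<open>k\<close> nearly attaining the infimum controls all large
  \<open>n\<close> by division with remainder, the remainders contributing at most \<open>B\<close>.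
  Convergence matters since \<open>entropy_wrt\<close> is a \<open>lim\<close>, which means
  something only if the limit exists.\<close>

lemma subadditive_convergent:
  fixes a :: "nat \<Rightarrow> real"
  assumes sub: "\<And>m n. a (m + n) \<le> a m + a n" and zero: "a 0 = 0" and nonneg: "\<And>n. 0 \<le> a n"
  shows "convergent (\<lambda>n. a n / real n)"
proof -
  define L where "L = (INF n\<in>{1..}. a n / real n)"
  have bdd: "bdd_below ((\<lambda>n. a n / real n) ` {1..})"
    by (rule bdd_belowI2[of _ 0]) (simp add: nonneg)
  have "(\<lambda>n. a n / real n) \<longlonglongrightarrow> L"
  proof (rule LIMSEQ_I)
    fix r :: real assume r: "0 < r"
    have "\<exists>k\<in>{1..}. a k / real k < L + r / 2"
      using r cInf_lessD[of "(\<lambda>n. a n / real n) ` {1..}" "L + r / 2"] by (auto simp: L_def)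
    then obtain k where k: "k \<ge> 1" "a k / real k < L + r / 2" by auto
    define B where "B = Max (a ` {..k})"
    obtain N :: nat where N: "2 * B / r < real N" using reals_Archimedean2 by blast
    have B: "a b \<le> B" if "b < k" for b unfolding B_def using that by (intro Max_ge) auto
    have "norm (a n / real n - L) < r" if n: "n \<ge> max 1 N" for n
    proof -
      have "L \<le> a n / real n" unfolding L_def using n by (intro cINF_lower bdd) auto
      moreover have "a n / real n < L + r"
      proof -
        have "a n \<le> a (n div k * k) + a (n mod k)"
          using sub[of "n div k * k" "n mod k"] by simp
        also have "\<dots> \<le> real (n div k) * a k + B"
          using subadditive_mult_le[OF sub zero, of "n div k" k] B[of "n mod k"] k by (intro add_mono) auto
        also have "real (n div k) * a k \<le> real n * (a k / real k)"
        proof -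
          have "real (n div k) \<le> real n / real k" by (rule of_nat_div_le_of_nat)
          then show ?thesis using mult_right_mono[OF _ nonneg[of k]] by fastforce
        qed
        finally have "a n / real n \<le> a k / real k + B / real n"
          using n by (simp add: divide_simps mult.commute)
        moreover have "B / real n < r / 2"
        proof -
          have "2 * B / r < real n" using N n by (meson le_less_trans max.boundedE not_le of_nat_le_iff order_less_le_trans)
          then show ?thesis using r n by (simp add: field_simps)
        qed
        ultimately show ?thesis using k by linarith
      qed
      ultimately show ?thesis by simp
    qed
    then show "\<exists>no. \<forall>n\<ge>no. norm (a n / real n - L) < r" by blast
  qed
  then show ?thesis by (rule convergentI)
qed

section \<open>Entropy of a measure-preserving map\<close>

definition fibers :: "'a measure \<Rightarrow> ('a \<Rightarrow> 'b) \<Rightarrow> 'a set set" where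
  "fibers M X = (\<lambda>x. X -` {x} \<inter> space M) ` X ` space M"

definition itinerary :: "('a \<Rightarrow> 'a) \<Rightarrow> ('a \<Rightarrow> 'b) \<Rightarrow> nat \<Rightarrow> 'a \<Rightarrow> 'b list" where
  "itinerary T X n \<omega> = map (\<lambda>i. X ((T ^^ i) \<omega>)) [0..<n]"

lemma length_itinerary [simp]: "length (itinerary T X n \<omega>) = n"
  by (simp add: itinerary_def)

lemma nth_itinerary [simp]: "i < n \<Longrightarrow> itinerary T X n \<omega> ! i = X ((T ^^ i) \<omega>)"
  by (simp add: itinerary_def)

lemma itinerary_add: "itinerary T X (n + k) \<omega> = itinerary T X n \<omega> @ itinerary T X k ((T ^^ n) \<omega>)"
proof (rule nth_equalityI)
  fix i assume "i < length (itinerary T X (n + k) \<omega>)"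
  then show "itinerary T X (n + k) \<omega> ! i = (itinerary T X n \<omega> @ itinerary T X k ((T ^^ n) \<omega>)) ! i"
    by (cases "i < n") (auto simp: nth_append funpow_add[symmetric, unfolded comp_def, THEN fun_cong]
      simp flip: comp_apply[of "T ^^ (i - n)" "T ^^ n"] funpow_add)
qed simp

lemma take_drop_itinerary:
  assumes "i + k \<le> n"
  shows "take k (drop i (itinerary T X n \<omega>)) = itinerary T X k ((T ^^ i) \<omega>)"
proof -
  obtain j where "n = i + (k + j)" using assms by (metis le_Suc_ex add.assoc)
  then show ?thesis by (simp add: itinerary_add)
qed

lemma partition_entropy_fibers: "partition_entropy M (fibers M X) = ent M X"
proof -
  have "inj_on (\<lambda>x. X -` {x} \<inter> space M) (X ` space M)" by (auto simp: inj_on_def)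
  then show ?thesis by (simp add: partition_entropy_def fibers_def ent_def sum.reindex)
qed

text \<open>The function sends a point to its own cell. Arbitrary finite partitions in the
  definition of entropy thus become finite-valued functions.\<close>

lemma fibers_of_partition:
  assumes "partition_on (space M) P"
  shows "P = fibers M (\<lambda>\<omega>. THE A. A \<in> P \<and> \<omega> \<in> A)"
proof -
  let ?X = "\<lambda>\<omega>. THE A. A \<in> P \<and> \<omega> \<in> A"
  have X: "?X \<omega> = A" if "A \<in> P" "\<omega> \<in> A" for A \<omega>
    using that partition_onD2[OF assms] by (intro the_equality) (auto simp: disjoint_def)
  have ex: "\<exists>A\<in>P. \<omega> \<in> A" if "\<omega> \<in> space M" for \<omega>
    using that partition_onD1[OF assms] by auto
  have sub: "A \<subseteq> space M" if "A \<in> P" for A using that partition_onD1[OF assms] by auto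
  have pre: "?X -` {A} \<inter> space M = A" if A: "A \<in> P" for A
  proof (intro equalityI subsetI)
    fix \<omega> assume "\<omega> \<in> ?X -` {A} \<inter> space M"
    then obtain B where "B \<in> P" "\<omega> \<in> B" "?X \<omega> = A" using ex by blast
    then show "\<omega> \<in> A" using X by simp
  next
    fix \<omega> assume "\<omega> \<in> A"
    then show "\<omega> \<in> ?X -` {A} \<inter> space M" using X[OF A] sub[OF A] by auto
  qed
  have "?X ` space M = P"
  proof (intro equalityI subsetI)
    fix A assume "A \<in> ?X ` space M"
    then show "A \<in> P" using ex X by force
  next
    fix A assume A: "A \<in> P"
    then obtain \<omega> where "\<omega> \<in> A" using partition_onD3[OF assms] by (metis all_not_in_conv)
    then show "A \<in> ?X ` space M" using X[OF A] sub[OF A] by blast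
  qed
  then show ?thesis using pre by (simp add: fibers_def)
qed

text \<open>\<open>partition_join\<close> discards empty intersections, so every remaining cell
  contains a point, and the itinerary of this point names the cell. For \<open>n = 0\<close> the
  only cell is the whole space, which is a fibre because the space is nonempty.\<close>

lemma refinement_fibers:
  assumes T: "\<And>\<omega>. \<omega> \<in> space M \<Longrightarrow> T \<omega> \<in> space M" and ne: "space M \<noteq> {}"
  shows "refinement T M (fibers M X) n = fibers M (itinerary T X n)"
proof (induction n)
  case 0
  then show ?case using ne by (auto simp: fibers_def itinerary_def)
next
  case (Suc n)
  have Tn: "(T ^^ n) \<omega> \<in> space M" if "\<omega> \<in> space M" for \<omega> n
    using that by (induction n) (auto intro: T)
  have it: "itinerary T X (Suc n) \<omega> = itinerary T X n \<omega> @ [X ((T ^^ n) \<omega>)]" for \<omega>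
    by (simp add: itinerary_def)
  have split: "itinerary T X (Suc n) -` {w @ [x]} \<inter> space M =
      (itinerary T X n -` {w} \<inter> space M) \<inter> ((T ^^ n) -` (X -` {x} \<inter> space M) \<inter> space M)" for w x
    using Tn by (auto simp: it)
  show ?case (is "?L = ?R")
  proof (intro equalityI subsetI)
    fix C assume "C \<in> ?L"
    then obtain A B where "A \<in> fibers M (itinerary T X n)" "B \<in> fibers M X"
      and C: "C = A \<inter> ((T ^^ n) -` B \<inter> space M)" and ne: "C \<noteq> {}"
      unfolding refinement.simps Suc partition_join_def by blast
    then obtain \<omega> \<omega>' where C: "C = (itinerary T X n -` {itinerary T X n \<omega>} \<inter> space M)
        \<inter> ((T ^^ n) -` (X -` {X \<omega>'} \<inter> space M) \<inter> space M)"
      unfolding fibers_def by blast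
    from ne have "\<exists>\<xi>. \<xi> \<in> C" by blast
    then obtain \<xi> where \<xi>: "\<xi> \<in> space M" "itinerary T X n \<xi> = itinerary T X n \<omega>" "X ((T ^^ n) \<xi>) = X \<omega>'"
      unfolding C by blast
    have "C = itinerary T X (Suc n) -` {itinerary T X (Suc n) \<xi>} \<inter> space M"
      unfolding C it[of \<xi>] split \<xi> ..
    then show "C \<in> ?R" using \<xi>(1) by (auto simp: fibers_def)
  next
    fix C assume "C \<in> ?R"
    then obtain \<xi> where \<xi>: "\<xi> \<in> space M" and C: "C = itinerary T X (Suc n) -` {itinerary T X (Suc n) \<xi>} \<inter> space M"
      by (auto simp: fibers_def)
    have "\<xi> \<in> C" using \<xi> C by simp
    have "itinerary T X n -` {itinerary T X n \<xi>} \<inter> space M \<in> refinement T M (fibers M X) n"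
      unfolding Suc using \<xi> by (auto simp: fibers_def)
    moreover have "(T ^^ n) -` (X -` {X ((T ^^ n) \<xi>)} \<inter> space M) \<inter> space M
        \<in> (\<lambda>A. (T ^^ n) -` A \<inter> space M) ` fibers M X"
      using Tn[OF \<xi>] unfolding fibers_def by blast
    moreover have "C = (itinerary T X n -` {itinerary T X n \<xi>} \<inter> space M)
        \<inter> ((T ^^ n) -` (X -` {X ((T ^^ n) \<xi>)} \<inter> space M) \<inter> space M)"
      unfolding C it[of \<xi>] split ..
    ultimately show "C \<in> ?L" using \<open>\<xi> \<in> C\<close> by (auto simp: partition_join_def)
  qed
qed

locale measure_preserving = prob_space +
  fixes T :: "'a \<Rightarrow> 'a"
  assumes T_measurable [measurable]: "T \<in> measurable M M"
    and T_distr: "distr M M T = M"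
begin

lemma T_space: "\<omega> \<in> space M \<Longrightarrow> T \<omega> \<in> space M"
  using T_measurable by (auto simp: measurable_def)

lemma funpow_measurable [measurable]: "T ^^ n \<in> measurable M M"
  by (induction n) (auto intro: measurable_comp)

lemma funpow_space: "\<omega> \<in> space M \<Longrightarrow> (T ^^ n) \<omega> \<in> space M"
  using funpow_measurable[of n] by (auto simp: measurable_def)

lemma funpow_distr: "distr M M (T ^^ n) = M"
proof (induction n)
  case 0
  show ?case by (simp add: distr_id2 id_def)
next
  case (Suc n)
  have "distr M M (T ^^ Suc n) = distr (distr M M (T ^^ n)) M T"
    by (subst distr_distr) auto
  then show ?case by (simp only: Suc T_distr)
qed

lemma prob_funpow: "A \<in> events \<Longrightarrow> prob ((T ^^ n) -` A \<inter> space M) = prob A"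
  using measure_distr[of "T ^^ n" M M A] by (simp add: funpow_distr)

lemma simple_function_funpow:
  assumes "simple_function M X"
  shows "simple_function M (\<lambda>\<omega>. X ((T ^^ n) \<omega>))"
  unfolding simple_function_def
proof (intro conjI ballI)
  show "finite ((\<lambda>\<omega>. X ((T ^^ n) \<omega>)) ` space M)"
    by (rule finite_subset[OF _ simple_functionD(1)[OF assms]]) (auto intro: funpow_space)
  fix x
  have "(\<lambda>\<omega>. X ((T ^^ n) \<omega>)) -` {x} \<inter> space M = (T ^^ n) -` (X -` {x} \<inter> space M) \<inter> space M"
    by (auto intro: funpow_space)
  then show "(\<lambda>\<omega>. X ((T ^^ n) \<omega>)) -` {x} \<inter> space M \<in> events"
    using measurable_sets[OF funpow_measurable simple_functionD(2)[OF assms]] by simp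
qed

lemma ent_funpow:
  assumes "simple_function M X"
  shows "ent M (\<lambda>\<omega>. X ((T ^^ n) \<omega>)) = ent M X"
proof -
  have "(\<lambda>\<omega>. X ((T ^^ n) \<omega>)) -` {x} \<inter> space M = (T ^^ n) -` (X -` {x} \<inter> space M) \<inter> space M" for x
    by (auto intro: funpow_space)
  then have "prob ((\<lambda>\<omega>. X ((T ^^ n) \<omega>)) -` {x} \<inter> space M) = prob (X -` {x} \<inter> space M)" for x
    using prob_funpow[OF simple_functionD(2)[OF assms]] by simp
  moreover have "(\<lambda>\<omega>. X ((T ^^ n) \<omega>)) ` space M \<subseteq> X ` space M" by (auto intro: funpow_space)
  ultimately show ?thesis
    using simple_functionD(1)[OF assms] by (subst ent_superset[of "X ` space M"]) (auto simp: ent_def)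
qed

lemma simple_function_itinerary:
  assumes "simple_function M X"
  shows "simple_function M (itinerary T X n)"
proof (induction n)
  case 0
  then show ?case by (simp add: itinerary_def)
next
  case (Suc n)
  have "simple_function M (\<lambda>\<omega>. (\<lambda>(w, x). w @ [x]) (itinerary T X n \<omega>, X ((T ^^ n) \<omega>)))"
    by (intro simple_function_compose1[where g = "\<lambda>(w, x). w @ [x]"] simple_function_Pair Suc[unfolded eta_contract_eq] simple_function_funpow assms)
  then show ?case by (simp add: itinerary_def[abs_def])
qed

lemma ent_itinerary_0: "ent M (itinerary T X 0) = 0"
  by (simp add: ent_def itinerary_def[abs_def] image_constant_conv not_empty prob_space)

lemma ent_itinerary_add:
  assumes "simple_function M X"
  shows "ent M (itinerary T X (n + k)) \<le> ent M (itinerary T X n) + ent M (itinerary T X k)"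
proof -
  note sf = simple_function_itinerary[OF assms]
  have "ent M (itinerary T X (n + k)) \<le> ent M (\<lambda>\<omega>. (itinerary T X n \<omega>, itinerary T X k ((T ^^ n) \<omega>)))"
    by (rule ent_function_le[where f = "\<lambda>(u, v). u @ v"])
      (simp_all add: simple_function_Pair sf simple_function_funpow itinerary_add)
  also have "\<dots> \<le> ent M (itinerary T X n) + ent M (\<lambda>\<omega>. itinerary T X k ((T ^^ n) \<omega>))"
    by (rule ent_Pair_le[OF sf simple_function_funpow[OF sf]])
  finally show ?thesis by (simp add: ent_funpow[OF sf])
qed

lemma ent_itinerary_mult: "simple_function M X \<Longrightarrow> ent M (itinerary T X (j * k)) \<le> j * ent M (itinerary T X k)"
  by (rule subadditive_mult_le[where a = "\<lambda>n. ent M (itinerary T X n)"]) (auto simp: ent_itinerary_add ent_itinerary_0)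

lemma ent_itinerary_mono:
  assumes "simple_function M X" "n \<le> k"
  shows "ent M (itinerary T X n) \<le> ent M (itinerary T X k)"
  by (rule ent_function_le[where f = "take n"])
    (use assms take_drop_itinerary[of 0 n k T X] in \<open>auto intro: simple_function_itinerary\<close>)

lemma ent_itinerary_LIMSEQ:
  assumes "simple_function M X"
  shows "(\<lambda>n. ent M (itinerary T X n) / n) \<longlonglongrightarrow> entropy_wrt T M (fibers M X)"
proof -
  have "convergent (\<lambda>n. ent M (itinerary T X n) / n)"
    using subadditive_convergent[of "\<lambda>n. ent M (itinerary T X n)"]
    by (simp add: ent_itinerary_add[OF assms] ent_itinerary_0 ent_nonneg)
  then show ?thesis
    by (simp add: convergent_LIMSEQ_iff entropy_wrt_def refinement_fibers[OF T_space not_empty] partition_entropy_fibers)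
qed

text \<open>
  The Kolmogorov-Sinai theorem in the form needed here. Instead of conditional entropies one uses
  that the itinerary of \<open>X\<close> is a function of that of the generator \<open>Q\<close> together with the itinerary
  of the error set of the approximation, and the latter has small entropy.
\<close>

lemma entropy_wrt_generator_le:
  assumes Q: "simple_function M Q" and X: "simple_function M X" and k: "k \<ge> 1"
    and gen: "\<And>A \<delta>. A \<in> events \<Longrightarrow> 0 < \<delta> \<Longrightarrow> eventually (\<lambda>l. \<exists>S.
        prob {\<omega>\<in>space M. ((T ^^ l) \<omega> \<in> A) \<noteq> (itinerary T Q (2 * l + 1) \<omega> \<in> S)} < \<delta>) sequentially"
  shows "entropy_wrt T M (fibers M X) \<le> ent M (itinerary T Q k) / k"
proof (rule field_le_epsilon)
  fix \<epsilon> :: real assume "0 < \<epsilon>"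
  define V where "V = X ` space M"
  have V: "finite V" using simple_functionD(1)[OF X] by (simp add: V_def)
  \<comment> \<open>The budget per cell: the error events of all cells of \<open>X\<close> together
    have entropy at most \<open>\<epsilon>\<close>.\<close>
  define \<epsilon>' where "\<epsilon>' = \<epsilon> / (card V + 1)"
  have "0 < \<epsilon>'" using \<open>0 < \<epsilon>\<close> by (simp add: \<epsilon>'_def)
  from ent_event_small[OF this] obtain \<delta> where \<delta>: "\<delta> > 0"
    "\<And>A. A \<in> events \<Longrightarrow> prob A < \<delta> \<Longrightarrow> ent M (\<lambda>\<omega>. \<omega> \<in> A) < \<epsilon>'" by blast
  have "eventually (\<lambda>l. \<forall>v\<in>V. \<exists>S. prob {\<omega>\<in>space M. ((T ^^ l) \<omega> \<in> X -` {v} \<inter> space M) \<noteq>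
      (itinerary T Q (2 * l + 1) \<omega> \<in> S)} < \<delta>) sequentially"
    using V by (intro eventually_ball_finite ballI gen simple_functionD(2)[OF X] \<delta>)
  then obtain l where l: "\<forall>v\<in>V. \<exists>S. prob {\<omega>\<in>space M. ((T ^^ l) \<omega> \<in> X -` {v} \<inter> space M) \<noteq>
      (itinerary T Q (2 * l + 1) \<omega> \<in> S)} < \<delta>"
    using eventually_happens'[OF sequentially_bot] by blast
  obtain S where S: "\<forall>v\<in>V. prob {\<omega>\<in>space M. ((T ^^ l) \<omega> \<in> X -` {v} \<inter> space M) \<noteq>
      (itinerary T Q (2 * l + 1) \<omega> \<in> S v)} < \<delta>"
    using bchoice[OF l] by (rule exE)
  define A where "A v = {\<omega>\<in>space M. (X ((T ^^ l) \<omega>) = v) \<noteq> (itinerary T Q (2 * l + 1) \<omega> \<in> S v)}" for v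
  have A_sets: "A v \<in> events" for v
  proof -
    have "simple_function M (\<lambda>\<omega>. (X ((T ^^ l) \<omega>) = v) \<noteq> (itinerary T Q (2 * l + 1) \<omega> \<in> S v))"
      using simple_function_compose1[OF simple_function_Pair[OF simple_function_funpow[OF X, of l]
          simple_function_itinerary[OF Q, of "2 * l + 1"]], of "\<lambda>(x, w). (x = v) \<noteq> (w \<in> S v)"] by simp
    from simple_functionD(2)[OF this, of "{True}"] show ?thesis by (simp add: A_def vimage_def Int_def conj_commute)
  qed
  have A_ent: "ent M (\<lambda>\<omega>. \<omega> \<in> A v) < \<epsilon>'" if "v \<in> V" for v
  proof (rule \<delta>(2)[OF A_sets])
    have "A v = {\<omega>\<in>space M. ((T ^^ l) \<omega> \<in> X -` {v} \<inter> space M) \<noteq> (itinerary T Q (2 * l + 1) \<omega> \<in> S v)}"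
      using funpow_space by (auto simp: A_def)
    then show "prob (A v) < \<delta>" using bspec[OF S that] by simp
  qed
  define E where "E \<omega> = {v\<in>V. \<omega> \<in> A v}" for \<omega>
  have A_sf: "simple_function M (\<lambda>\<omega>. \<omega> \<in> A v)" for v
  proof -
    have "(\<lambda>\<omega>. \<omega> \<in> A v) -` {b} \<inter> space M \<in> events" for b
      using A_sets[of v] sets.sets_into_space[OF A_sets[of v]]
      by (cases b) (auto simp: vimage_def Int_def[symmetric] Int_absorb2 Collect_neg_eq Compl_eq_Diff_UNIV Diff_Int_distrib2)
    then show ?thesis by (simp add: simple_function_def)
  qed
  have E_sf: "simple_function M E"
    using ent_subset_finite_union[OF V, of "\<lambda>v \<omega>. \<omega> \<in> A v"] A_sf by (simp add: E_def[abs_def])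
  have "ent M E \<le> (\<Sum>v\<in>V. ent M (\<lambda>\<omega>. \<omega> \<in> A v))"
    using ent_subset_finite_union[OF V, of "\<lambda>v \<omega>. \<omega> \<in> A v"] A_sf by (simp add: E_def[abs_def])
  also have "\<dots> \<le> (\<Sum>v\<in>V. \<epsilon>')" using A_ent by (intro sum_mono) (auto intro: less_imp_le)
  also have "\<dots> \<le> \<epsilon>" using \<open>0 < \<epsilon>\<close> by (simp add: \<epsilon>'_def field_simps)
  finally have E_ent: "ent M E \<le> \<epsilon>" .
  let ?H = "ent M (itinerary T Q k)"
  have bound: "ent M (itinerary T X n) \<le> ((real n + 2 * real l) / k + 1) * ?H + n * \<epsilon>" for n
  proof -
    let ?W = "\<lambda>\<omega>. (itinerary T Q (n + 2 * l) \<omega>, itinerary T E n \<omega>)"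
    have W: "simple_function M ?W"
      by (intro simple_function_Pair simple_function_itinerary Q E_sf)
    \<comment> \<open>By definition of \<open>A v\<close>, the value is \<open>v\<close> exactly if
      one, but not both, of membership in the error set and acceptance of the
      \<open>Q\<close>-window by \<open>S v\<close> holds. The value is therefore the unique such
      \<open>v\<close>.\<close>
    define dec where "dec = (\<lambda>(w, es). map (\<lambda>i. THE v. v \<in> V \<and> ((v \<in> es ! i) \<noteq> (take (2 * l + 1) (drop i w) \<in> S v))) [0..<n])"
    have "itinerary T X n ((T ^^ l) \<omega>) = dec (?W \<omega>)" if \<omega>: "\<omega> \<in> space M" for \<omega>
    proof (rule nth_equalityI)
      fix i assume "i < length (itinerary T X n ((T ^^ l) \<omega>))"
      then have i: "i < n" by simp
      let ?\<xi> = "(T ^^ i) \<omega>"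
      have \<xi>: "?\<xi> \<in> space M" using \<omega> by (rule funpow_space)
      have tk: "take (2 * l + 1) (drop i (itinerary T Q (n + 2 * l) \<omega>)) = itinerary T Q (2 * l + 1) ?\<xi>"
        using i by (intro take_drop_itinerary) simp
      have Xe: "X ((T ^^ i) ((T ^^ l) \<omega>)) = X ((T ^^ l) ?\<xi>)"
        by (metis add.commute comp_apply funpow_add)
      have "X ((T ^^ l) ?\<xi>) \<in> V" using funpow_space[OF \<xi>] by (simp add: V_def)
      then have "(THE v. v \<in> V \<and> ((v \<in> E ?\<xi>) \<noteq> (itinerary T Q (2 * l + 1) ?\<xi> \<in> S v))) = X ((T ^^ l) ?\<xi>)"
        using \<xi> by (intro the_equality) (auto simp: E_def A_def)
      then show "itinerary T X n ((T ^^ l) \<omega>) ! i = dec (?W \<omega>) ! i"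
        using i by (simp add: dec_def tk[simplified] Xe)
    qed (simp add: dec_def)
    then have "ent M (\<lambda>\<omega>. itinerary T X n ((T ^^ l) \<omega>)) \<le> ent M ?W"
      by (rule ent_function_le[OF W])
    also have "\<dots> \<le> ent M (itinerary T Q (n + 2 * l)) + ent M (itinerary T E n)"
      by (rule ent_Pair_le[OF simple_function_itinerary[OF Q] simple_function_itinerary[OF E_sf]])
    also have "ent M (itinerary T E n) \<le> n * ent M (itinerary T E 1)"
      using ent_itinerary_mult[OF E_sf, of n 1] by simp
    also have "ent M (itinerary T E 1) \<le> ent M E"
      by (rule ent_function_le[OF E_sf, of _ "\<lambda>x. [x]"]) (simp add: itinerary_def)
    also note E_ent
    \<comment> \<open>The length is rounded up to a multiple of \<open>k\<close> so that
      subadditivity applies. The surplus is bounded in \<open>n\<close> and vanishes after division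
      by \<open>n\<close>.\<close>
    also have "ent M (itinerary T Q (n + 2 * l)) \<le> ent M (itinerary T Q (((n + 2 * l) div k + 1) * k))"
      using k by (intro ent_itinerary_mono Q) (simp add: dividend_less_div_times less_imp_le)
    also have "\<dots> \<le> ((n + 2 * l) div k + 1) * ?H"
      using ent_itinerary_mult[OF Q] by blast
    also have "\<dots> \<le> ((real n + 2 * real l) / k + 1) * ?H"
      using of_nat_div_le_of_nat[of "n + 2 * l" k, where 'a = real]
      by (intro mult_right_mono ent_nonneg) simp
    finally show ?thesis by (simp add: ent_funpow[OF simple_function_itinerary[OF X]] mult_left_mono)
  qed
  have "(\<lambda>n. (((real n + 2 * L) / K + 1) * H + n * \<epsilon>) / n) \<longlonglongrightarrow> inverse K * H + \<epsilon>" if "K > 0" for L K H :: real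
    using that by real_asymp
  from this[of "real k" "real l" ?H]
  have "(\<lambda>n. (((real n + 2 * real l) / k + 1) * ?H + n * \<epsilon>) / n) \<longlonglongrightarrow> ?H / k + \<epsilon>"
    using k by (simp add: divide_inverse mult.commute)
  with ent_itinerary_LIMSEQ[OF X] show "entropy_wrt T M (fibers M X) \<le> ?H / k + \<epsilon>"
    by (rule LIMSEQ_le) (auto intro!: divide_right_mono bound)
qed

end

section \<open>The shift spaces as measurable spaces\<close>

abbreviation dyck_borel :: "(int \<Rightarrow> 'm::finite dyck_symbol) measure" where
  "dyck_borel \<equiv> metric_borel dyck dist_two"

abbreviation dyck_plus_borel :: "(nat \<Rightarrow> 'm::finite dyck_symbol) measure" where
  "dyck_plus_borel \<equiv> metric_borel dyck_plus dist_plus"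

lemma measurable_into_dyck_borel:
  assumes "f \<in> measurable M seqs" "\<And>x. x \<in> space M \<Longrightarrow> f x \<in> dyck"
  shows "f \<in> measurable M dyck_borel"
  unfolding measurable_cong_sets[OF HOL.refl sets_metric_borel_two]
  using assms by (intro measurable_restrict_space2) auto

lemma measurable_into_dyck_plus_borel:
  assumes "f \<in> measurable M seqs" "\<And>x. x \<in> space M \<Longrightarrow> f x \<in> dyck_plus"
  shows "f \<in> measurable M dyck_plus_borel"
  unfolding measurable_cong_sets[OF HOL.refl sets_metric_borel_plus]
  using assms by (intro measurable_restrict_space2) auto

lemma measurable_dyck_component: "(\<lambda>\<omega>. \<omega> i) \<in> measurable dyck_borel (count_space UNIV)"
  unfolding measurable_cong_sets[OF sets_metric_borel_two HOL.refl]
  by (rule measurable_restrict_space1) (rule measurable_seq_component)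

lemma measurable_dyck_plus_component: "(\<lambda>\<omega>. \<omega> i) \<in> measurable dyck_plus_borel (count_space UNIV)"
  unfolding measurable_cong_sets[OF sets_metric_borel_plus HOL.refl]
  by (rule measurable_restrict_space1) (rule measurable_seq_component)

lemma shift_two_funpow: "(shift_two ^^ n) \<omega> = (\<lambda>i. \<omega> (i + int n))"
  by (induction n) (auto simp: shift_two_def algebra_simps)

lemma shift_plus_funpow: "(shift_plus ^^ n) \<omega> = (\<lambda>i. \<omega> (i + n))"
  by (induction n) (auto simp: shift_plus_def algebra_simps)

lemma map_shift_upto: "map (\<lambda>i. f (i + k)) [i..j] = map f [i + k..j + k]" for k :: int
  by (rule nth_equalityI) (auto simp: nth_upto algebra_simps)

lemma shift_two_in_dyck: "\<omega> \<in> dyck \<Longrightarrow> shift_two \<omega> \<in> dyck"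
  by (auto simp: dyck_def shift_two_def map_shift_upto)

lemma shift_plus_in_dyck_plus: "\<omega> \<in> dyck_plus \<Longrightarrow> shift_plus \<omega> \<in> dyck_plus"
proof -
  have "map (shift_plus \<omega>) [i..<Suc j] = map \<omega> [Suc i..<Suc (Suc j)]" for i j
    by (simp add: shift_plus_def map_Suc_upt[symmetric] comp_def del: upt_Suc)
  then show "\<omega> \<in> dyck_plus \<Longrightarrow> shift_plus \<omega> \<in> dyck_plus"
    by (simp add: dyck_plus_def del: upt_Suc)
qed

lemma proj_plus_in_dyck_plus: "\<omega> \<in> dyck \<Longrightarrow> proj_plus \<omega> \<in> dyck_plus"
proof -
  have "map (proj_plus \<omega>) [i..<Suc j] = map \<omega> [int i..int j]" for i j
    by (rule nth_equalityI) (auto simp: proj_plus_def nth_upto simp del: upt_Suc)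
  then show "\<omega> \<in> dyck \<Longrightarrow> proj_plus \<omega> \<in> dyck_plus"
    by (simp add: dyck_def dyck_plus_def del: upt_Suc)
qed

lemma shift_two_measurable: "shift_two \<in> measurable dyck_borel (dyck_borel :: (int \<Rightarrow> 'm::finite dyck_symbol) measure)"
  by (intro measurable_into_dyck_borel measurable_seqsI)
    (simp_all add: shift_two_def[abs_def] measurable_dyck_component shift_two_in_dyck[unfolded shift_two_def])

lemma shift_plus_measurable:
  "shift_plus \<in> measurable dyck_plus_borel (dyck_plus_borel :: (nat \<Rightarrow> 'm::finite dyck_symbol) measure)"
proof (rule measurable_into_dyck_plus_borel)
  show "shift_plus \<in> measurable dyck_plus_borel (seqs :: (nat \<Rightarrow> 'm dyck_symbol) measure)"
    by (rule measurable_seqsI) (simp add: shift_plus_def measurable_dyck_plus_component)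
qed (simp add: shift_plus_in_dyck_plus)

lemma proj_plus_measurable:
  "proj_plus \<in> measurable dyck_borel (dyck_plus_borel :: (nat \<Rightarrow> 'm::finite dyck_symbol) measure)"
  by (intro measurable_into_dyck_plus_borel measurable_seqsI)
    (simp_all add: proj_plus_def[abs_def] measurable_dyck_component proj_plus_in_dyck_plus[unfolded proj_plus_def])

lemma funpow_measurable_self: "f \<in> measurable M M \<Longrightarrow> f ^^ n \<in> measurable M M"
  by (induction n) (auto intro: measurable_comp)

lemma holder_measurable:
  assumes d: "Metric_space X d" and \<eta>: "0 < \<eta>" and \<phi>: "\<phi> \<in> holder \<eta> X d"
  shows "\<phi> \<in> borel_measurable (metric_borel X d)"
  unfolding borel_measurable_iff_greater
proof
  interpret Metric_space X d by (rule d)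
  fix a :: real
  from \<phi> obtain K where K: "K \<ge> 0" "\<And>x y. x \<in> X \<Longrightarrow> y \<in> X \<Longrightarrow> \<bar>\<phi> x - \<phi> y\<bar> \<le> K * d x y powr \<eta>"
    by (auto simp: holder_def)
  have "openin mtopology {x\<in>X. a < \<phi> x}"
    unfolding openin_mtopology
  proof (intro conjI allI impI)
    fix x assume x: "x \<in> {x\<in>X. a < \<phi> x}"
    \<comment> \<open>The denominator \<open>K + 1\<close> covers \<open>K = 0\<close> and leaves
      the slack \<open>K / (K + 1) < 1\<close> for the strict inequality.\<close>
    define c where "c = (\<phi> x - a) / (K + 1)"
    define r where "r = c powr (1 / \<eta>)"
    have pos: "c > 0" using x K by (simp add: c_def)
    then have r: "r > 0" unfolding r_def by (intro powr_gt_zero[THEN iffD2]) linarith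
    have rp: "r powr \<eta> = c" using pos \<eta> by (simp add: r_def powr_powr)
    have "a < \<phi> y" if y: "y \<in> X" "d x y < r" for y
    proof -
      have "\<bar>\<phi> x - \<phi> y\<bar> \<le> K * d x y powr \<eta>" using x y K by simp
      also have "\<dots> \<le> K * r powr \<eta>"
        using y K \<eta> by (intro mult_left_mono powr_mono2) auto
      also have "\<dots> = (\<phi> x - a) * (K / (K + 1))" unfolding rp c_def by simp
      also have "\<dots> < (\<phi> x - a) * 1" using x K by (intro mult_strict_left_mono) auto
      finally show ?thesis by simp
    qed
    with r show "\<exists>r>0. mball x r \<subseteq> {x\<in>X. a < \<phi> x}" by (intro exI[of _ r]) auto
  qed auto
  moreover have "sets (metric_borel X d) = sigma_sets X {U. openin mtopology U}"
    unfolding metric_borel_def by (intro sets_measure_of) (auto simp: openin_mtopology)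
  ultimately show "{w \<in> space (metric_borel X d). a < \<phi> w} \<in> sets (metric_borel X d)"
    by (simp add: sigma_sets.Basic)
qed

lemma dist_two_nonneg: "0 \<le> dist_two x y"
  by (auto simp: dist_two_def)

lemma dist_plus_nonneg: "0 \<le> dist_plus x y"
  by (auto simp: dist_plus_def)

lemma dist_two_le_1: "dist_two x y \<le> 1"
  by (auto simp: dist_two_def)

lemma dist_plus_proj_le: "dist_plus (proj_plus x) (proj_plus y) \<le> dist_two x y"
proof (cases "proj_plus x = proj_plus y")
  case True
  then show ?thesis by (simp add: dist_plus_def dist_two_nonneg)
next
  case False
  define n where "n = (LEAST i. proj_plus x i \<noteq> proj_plus y i)"
  have "proj_plus x n \<noteq> proj_plus y n"
    unfolding n_def by (rule LeastI_ex) (use False in auto)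
  then have n: "x (int n) \<noteq> y (int n) \<or> x (- int n) \<noteq> y (- int n)" by (simp add: proj_plus_def)
  then have "(LEAST i. x (int i) \<noteq> y (int i) \<or> x (- int i) \<noteq> y (- int i)) \<le> n" by (rule Least_le)
  moreover have "x \<noteq> y" using n by auto
  ultimately show ?thesis using False by (simp add: dist_plus_def dist_two_def n_def)
qed

text \<open>The projection commutes with the shifts and does not increase distances. Hoelder
  functions pull back with the same exponent and constant, and the correlations are equal.\<close>

lemma exponentially_mixing_push_plus:
  fixes \<nu> :: "(int \<Rightarrow> 'm::finite dyck_symbol) measure"
  assumes mix: "exponentially_mixing dyck dist_two shift_two \<nu>"
  shows "exponentially_mixing dyck_plus dist_plus shift_plus (push_plus \<nu>)"
proof -
  have \<nu>: "sets \<nu> = sets dyck_borel" "prob_space \<nu>" "distr \<nu> \<nu> shift_two = \<nu>"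
    using mix by (simp_all add: exponentially_mixing_def invariant_measures_def)
  have sp: "space \<nu> = dyck" using sets_eq_imp_space_eq[OF \<nu>(1)] by simp
  have proj: "proj_plus \<in> measurable \<nu> dyck_plus_borel"
    using proj_plus_measurable by (simp cong: measurable_cong_sets add: \<nu>(1))
  have shift: "shift_two \<in> measurable \<nu> \<nu>"
    using shift_two_measurable by (simp cong: measurable_cong_sets add: \<nu>(1))
  have sp_push: "sets (push_plus \<nu>) = sets dyck_plus_borel" by (simp add: push_plus_def)
  have comm: "shift_plus \<circ> proj_plus = proj_plus \<circ> shift_two"
    by (auto simp: fun_eq_iff shift_plus_def proj_plus_def shift_two_def algebra_simps)
  have "distr (push_plus \<nu>) (push_plus \<nu>) shift_plus = distr (push_plus \<nu>) dyck_plus_borel shift_plus"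
    by (rule distr_cong) (simp_all add: sp_push)
  also have "\<dots> = distr \<nu> dyck_plus_borel (shift_plus \<circ> proj_plus)"
    unfolding push_plus_def by (rule distr_distr[OF shift_plus_measurable proj])
  also have "\<dots> = distr (distr \<nu> \<nu> shift_two) dyck_plus_borel proj_plus"
    unfolding comm by (rule distr_distr[symmetric, OF proj shift])
  finally have "distr (push_plus \<nu>) (push_plus \<nu>) shift_plus = push_plus \<nu>"
    by (simp add: \<nu> push_plus_def)
  moreover have "prob_space (push_plus \<nu>)"
    unfolding push_plus_def using \<nu>(2) proj by (rule prob_space.prob_space_distr)
  ultimately have inv: "push_plus \<nu> \<in> invariant_measures dyck_plus dist_plus shift_plus"
    using shift_plus_measurable
    by (simp add: invariant_measures_def sp_push cong: measurable_cong_sets)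
  have Cor_eq: "Cor n shift_plus \<phi> \<psi> (push_plus \<nu>) = Cor n shift_two (\<phi> \<circ> proj_plus) (\<psi> \<circ> proj_plus) \<nu>"
    if "\<phi> \<in> borel_measurable dyck_plus_borel" "\<psi> \<in> borel_measurable dyck_plus_borel" for \<phi> \<psi> n
  proof -
    note m = measurable_compose[OF funpow_measurable_self[OF shift_plus_measurable, of n] that(2)]
    have "(shift_plus ^^ n) (proj_plus \<omega>) = proj_plus ((shift_two ^^ n) \<omega>)" for \<omega> :: "int \<Rightarrow> 'm dyck_symbol"
      by (simp add: shift_plus_funpow shift_two_funpow proj_plus_def)
    then show ?thesis
      using that m unfolding Cor_def push_plus_def
      by (simp add: integral_distr[OF proj] comp_def)
  qed
  have holder_proj: "\<phi> \<circ> proj_plus \<in> holder \<eta> dyck dist_two"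
    if \<phi>: "\<phi> \<in> holder \<eta> dyck_plus dist_plus" and \<eta>: "0 < \<eta>" for \<phi> :: "(nat \<Rightarrow> 'm dyck_symbol) \<Rightarrow> real" and \<eta>
  proof -
    from \<phi> obtain K where K: "K \<ge> 0"
      "\<And>x y. x \<in> dyck_plus \<Longrightarrow> y \<in> dyck_plus \<Longrightarrow> \<bar>\<phi> x - \<phi> y\<bar> \<le> K * dist_plus x y powr \<eta>"
      by (auto simp: holder_def)
    have "\<bar>\<phi> (proj_plus x) - \<phi> (proj_plus y)\<bar> \<le> K * dist_two x y powr \<eta>" if "x \<in> dyck" "y \<in> dyck" for x y
    proof -
      have "\<bar>\<phi> (proj_plus x) - \<phi> (proj_plus y)\<bar> \<le> K * dist_plus (proj_plus x) (proj_plus y) powr \<eta>"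
        using that by (intro K proj_plus_in_dyck_plus)
      also have "\<dots> \<le> K * dist_two x y powr \<eta>"
        using K \<eta> dist_plus_proj_le by (intro mult_left_mono powr_mono2) (auto simp: dist_plus_nonneg)
      finally show ?thesis .
    qed
    then show ?thesis using K by (auto simp: holder_def)
  qed
  show ?thesis
    unfolding exponentially_mixing_def
  proof (intro conjI inv allI impI)
    fix \<eta> :: real assume \<eta>: "0 < \<eta> \<and> \<eta> \<le> 1"
    with mix obtain \<theta> where \<theta>: "0 < \<theta>" "\<theta> < 1" and
      C: "\<forall>\<phi> \<in> holder \<eta> dyck dist_two. \<forall>\<psi> \<in> holder \<eta> dyck dist_two. \<exists>C>0. \<forall>n\<ge>1. Cor n shift_two \<phi> \<psi> \<nu> \<le> C * \<theta> ^ n"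
      unfolding exponentially_mixing_def by blast
    have "\<exists>C>0. \<forall>n\<ge>1. Cor n shift_plus \<phi> \<psi> (push_plus \<nu>) \<le> C * \<theta> ^ n"
      if h: "\<phi> \<in> holder \<eta> dyck_plus dist_plus" "\<psi> \<in> holder \<eta> dyck_plus dist_plus" for \<phi> \<psi>
    proof -
      have "\<phi> \<in> borel_measurable dyck_plus_borel" "\<psi> \<in> borel_measurable dyck_plus_borel"
        using h \<eta> by (auto intro: holder_measurable[OF Metric_space_dist_plus])
      note eq = Cor_eq[OF this]
      have "\<exists>C>0. \<forall>n\<ge>1. Cor n shift_two (\<phi> \<circ> proj_plus) (\<psi> \<circ> proj_plus) \<nu> \<le> C * \<theta> ^ n"
        using C holder_proj h \<eta> by blast
      then show ?thesis by (simp add: eq)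
    qed
    with \<theta> show "\<exists>\<theta>>0. \<theta> < 1 \<and> (\<forall>\<phi>\<in>holder \<eta> dyck_plus dist_plus. \<forall>\<psi>\<in>holder \<eta> dyck_plus dist_plus.
        \<exists>C>0. \<forall>n\<ge>1. Cor n shift_plus \<phi> \<psi> (push_plus \<nu>) \<le> C * \<theta> ^ n)"
      by blast
  qed
qed

section \<open>Approximation by windows\<close>

abbreviation window :: "nat \<Rightarrow> (int \<Rightarrow> 'a) \<Rightarrow> 'a list" where
  "window l y \<equiv> map y [- int l..int l]"

lemma measurable_map_seq:
  fixes js :: "int list"
  shows "(\<lambda>y :: int \<Rightarrow> 'a::finite. map y js) \<in> measurable seqs (count_space UNIV)"
proof (induction js)
  case (Cons j js)
  show ?case
    using measurable_count_space_pair[where h = "(#)", OF measurable_seq_component[of j] Cons.IH] by simp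
qed simp

lemma sets_approx_diff:
  fixes B :: "(int \<Rightarrow> 'a::finite) set"
  assumes "B \<in> sets seqs"
  shows "{y. (y \<in> B) \<noteq> (window l y \<in> S)} \<in> sets seqs"
proof -
  have "{y \<in> space seqs. window l (y :: int \<Rightarrow> 'a) \<in> S} \<in> sets seqs"
    using measurable_sets[OF measurable_map_seq[of "[- int l..int l]"], of S]
    by (simp add: vimage_def)
  then have "{y :: int \<Rightarrow> 'a. window l y \<in> S} \<in> sets seqs" by simp
  then have "(B - {y. window l y \<in> S}) \<union> ({y. window l y \<in> S} - B) \<in> sets seqs"
    using assms by (intro sets.Un sets.Diff)
  moreover have "{y. (y \<in> B) \<noteq> (window l y \<in> S)} = (B - {y. window l y \<in> S}) \<union> ({y. window l y \<in> S} - B)"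
    by blast
  ultimately show ?thesis by simp
qed

text \<open>The approximable sets form a sigma-algebra containing the one-coordinate cylinders.
  Approximation is required for all large \<open>l\<close>, not just for some \<open>l\<close>, so
  that finitely many sets can share one window length in the union step.\<close>

lemma approx_by_windows:
  fixes N :: "(int \<Rightarrow> 'a::finite) measure"
  assumes N: "finite_measure N" "sets N = sets seqs" and B: "B \<in> sets seqs" and "0 < \<delta>"
  shows "eventually (\<lambda>l. \<exists>S. measure N {y. (y \<in> B) \<noteq> (window l y \<in> S)} < \<delta>) sequentially"
proof -
  interpret finite_measure N by (rule N(1))
  have sp: "space N = UNIV" using sets_eq_imp_space_eq[OF N(2)] by simp
  let ?G = "{{f\<in>\<Pi>\<^sub>E i\<in>UNIV. space (count_space UNIV). f i \<in> A} |i A. (i :: int) \<in> UNIV \<and> A \<in> sets (count_space (UNIV :: 'a set))}"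
  have seqs_eq: "sets (seqs :: (int \<Rightarrow> 'a) measure) = sigma_sets UNIV ?G"
    by (simp add: sets_PiM_single)
  from B have "B \<in> sigma_sets UNIV ?G" by (simp only: seqs_eq)
  then show ?thesis using \<open>0 < \<delta>\<close>
  proof (induction arbitrary: \<delta>)
    case (Basic a)
    then obtain i A where a: "a = {f. f i \<in> A}" by auto
    have "\<exists>S. measure N {y. (y \<in> a) \<noteq> (window l y \<in> S)} < \<delta>" if "l \<ge> nat \<bar>i\<bar>" for l
    proof -
      have "window l y ! nat (i + int l) = y i" for y :: "int \<Rightarrow> 'a"
      proof -
        have "[- int l..int l] ! nat (i + int l) = i" using that by (subst nth_upto) auto
        then show ?thesis using that by (subst nth_map) auto
      qed
      then have eq: "{y. (y \<in> a) \<noteq> (window l y \<in> {w. w ! nat (i + int l) \<in> A})} = {}" by (simp add: a)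
      show ?thesis
        by (rule exI[of _ "{w. w ! nat (i + int l) \<in> A}"]) (simp only: eq measure_empty Basic.prems)
    qed
    then show ?case by (auto simp: eventually_sequentially)
  next
    case Empty
    have "{y. (y \<in> {}) \<noteq> (window l y \<in> ({} :: 'a list set))} = {}" for l by simp
    then show ?case using Empty by (intro always_eventually allI exI[of _ "{}"]) simp
  next
    case (Compl a)
    have "\<exists>S. measure N {y. (y \<in> UNIV - a) \<noteq> (window l y \<in> S)} < \<delta>"
      if "\<exists>S. measure N {y. (y \<in> a) \<noteq> (window l y \<in> S)} < \<delta>" for l
    proof -
      from that obtain S where "measure N {y. (y \<in> a) \<noteq> (window l y \<in> S)} < \<delta>" ..
      moreover have "{y. (y \<in> UNIV - a) \<noteq> (window l y \<in> - S)} = {y. (y \<in> a) \<noteq> (window l y \<in> S)}" by auto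
      ultimately show ?thesis by (intro exI[of _ "- S"]) (simp only:)
    qed
    with Compl.IH[OF Compl.prems] show ?case by (rule eventually_mono)
  next
    case (Union a)
    have a: "a i \<in> sets N" for i using Union.hyps by (simp add: N(2) seqs_eq)
    have "(\<lambda>n. measure N (\<Union>i<n. a i)) \<longlonglongrightarrow> measure N (\<Union>n. \<Union>i<n. a i)"
      using a by (intro finite_Lim_measure_incseq) (auto simp: incseq_def intro: less_le_trans)
    moreover have "(\<Union>n. \<Union>i<n. a i) = (\<Union>i. a i)" by blast
    ultimately have "(\<lambda>n. measure N (\<Union>i<n. a i)) \<longlonglongrightarrow> measure N (\<Union>i. a i)" by simp
    then have "eventually (\<lambda>n. measure N (\<Union>i. a i) - \<delta> / 2 < measure N (\<Union>i<n. a i)) sequentially"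
      using Union.prems by (intro order_tendstoD) auto
    then obtain n where n: "measure N (\<Union>i. a i) - \<delta> / 2 < measure N (\<Union>i<n. a i)"
      using eventually_happens'[OF sequentially_bot] by blast
    have rest: "measure N ((\<Union>i. a i) - (\<Union>i<n. a i)) < \<delta> / 2"
      using n a by (subst finite_measure_Diff) auto
    \<comment> \<open>Half of \<open>\<delta>\<close> goes to the tail of the union, the other half
      to the \<open>n\<close> sets that are kept.\<close>
    define \<delta>' where "\<delta>' = \<delta> / (2 * (real n + 1))"
    have "\<delta>' > 0" using Union.prems by (simp add: \<delta>'_def)
    have "eventually (\<lambda>l. \<forall>i\<in>{..<n}. \<exists>S. measure N {y. (y \<in> a i) \<noteq> (window l y \<in> S)} < \<delta>') sequentially"
      using Union.IH \<open>\<delta>' > 0\<close> by (intro eventually_ball_finite) auto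
    then show ?case
    proof (rule eventually_mono)
      fix l assume "\<forall>i\<in>{..<n}. \<exists>S. measure N {y. (y \<in> a i) \<noteq> (window l y \<in> S)} < \<delta>'"
      from bchoice[OF this] obtain S where
        S: "\<forall>i\<in>{..<n}. measure N {y. (y \<in> a i) \<noteq> (window l y \<in> S i)} < \<delta>'" by (rule exE)
      let ?D = "\<lambda>i. {y. (y \<in> a i) \<noteq> (window l y \<in> S i)}"
      have D: "?D i \<in> sets N" for i
        using sets_approx_diff[of "a i" l "S i"] a[of i] by (simp add: N(2))
      have "measure N {y. (y \<in> (\<Union>i. a i)) \<noteq> (window l y \<in> (\<Union>i<n. S i))}
          \<le> measure N (((\<Union>i. a i) - (\<Union>i<n. a i)) \<union> (\<Union>i<n. ?D i))"
        using a D by (intro finite_measure_mono) (blast, intro sets.Un sets.Diff sets.finite_UN sets.countable_UN, auto)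
      also have "\<dots> \<le> measure N ((\<Union>i. a i) - (\<Union>i<n. a i)) + measure N (\<Union>i<n. ?D i)"
        using a D by (intro measure_Un_le sets.Diff sets.finite_UN sets.countable_UN) auto
      also have "measure N (\<Union>i<n. ?D i) \<le> (\<Sum>i<n. measure N (?D i))"
        using D by (intro finite_measure_subadditive_finite) auto
      also have "\<dots> \<le> (\<Sum>i<n. \<delta>')" using S by (intro sum_mono) (auto intro: less_imp_le)
      also have "\<dots> \<le> \<delta> / 2" using Union.prems by (simp add: \<delta>'_def field_simps)
      finally have "measure N {y. (y \<in> (\<Union>i. a i)) \<noteq> (window l y \<in> (\<Union>i<n. S i))} < \<delta>"
        using rest by simp
      then show "\<exists>S. measure N {y. (y \<in> (\<Union>i. a i)) \<noteq> (window l y \<in> S)} < \<delta>" ..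
    qed
  qed
qed

section \<open>Codings by the full shift\<close>

text \<open>The common ground of \<open>decode\<close> and its time reversal. On the event
  \<open>good L\<close> the decoded symbol at 0 depends only on the coordinates up to distance
  \<open>L\<close>, and the event fails with exponentially small probability. That
  \<open>dec\<close> recovers a Dyck point from its code is left out, since it is available only
  almost surely and for the given measure.\<close>

locale coding =
  fixes q :: "'m::finite dyck_symbol \<Rightarrow> 'm option"
    and dec :: "(int \<Rightarrow> 'm option) \<Rightarrow> int \<Rightarrow> 'm dyck_symbol"
    and good :: "nat \<Rightarrow> (int \<Rightarrow> 'm option) \<Rightarrow> bool"
    and \<rho> :: real
  assumes q_dec: "q (dec y t) = y t"
    and dec_in_dyck: "dec y \<in> dyck"
    and dec_shift: "dec (\<lambda>i. y (i + k)) t = dec y (t + k)"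
    and dec_seqs: "dec \<in> measurable seqs seqs"
    and good_pred: "Measurable.pred seqs (good L)"
    and dec_local: "good L y \<Longrightarrow> (\<And>i. \<bar>i\<bar> \<le> int L \<Longrightarrow> y i = y' i) \<Longrightarrow> dec y 0 = dec y' 0"
    and bad: "measure bern {y. \<not> good L y} \<le> \<rho> ^ L"
    and \<rho>: "0 < \<rho>" "\<rho> < 1"
begin

definition \<mu> :: "(int \<Rightarrow> 'm dyck_symbol) measure" where
  "\<mu> = distr bern dyck_borel dec"

lemma dec_measurable: "dec \<in> measurable seqs dyck_borel"
  by (rule measurable_into_dyck_borel[OF dec_seqs]) (simp add: dec_in_dyck)

lemma dec_measurable_bern: "dec \<in> measurable bern dyck_borel"
  using dec_measurable by (simp cong: measurable_cong_sets)

lemma sets_\<mu> [simp]: "sets \<mu> = sets dyck_borel"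
  by (simp add: \<mu>_def)

lemma space_\<mu> [simp]: "space \<mu> = dyck"
  by (simp add: \<mu>_def)

lemma shift_dec: "(shift_two ^^ n) (dec y) = dec (\<lambda>i. y (i + int n))"
  by (simp add: shift_two_funpow fun_eq_iff dec_shift)

lemma shift_measurable_bern: "(\<lambda>y i. y (i + k)) \<in> measurable bern (bern :: (int \<Rightarrow> 'm option) measure)"
  using measurable_reindex by (simp cong: measurable_cong_sets)

lemma \<mu>_invariant: "\<mu> \<in> invariant_measures dyck dist_two shift_two"
proof -
  have "distr \<mu> \<mu> shift_two = distr \<mu> dyck_borel shift_two"
    by (rule distr_cong) simp_all
  also have "\<dots> = distr bern dyck_borel (shift_two \<circ> dec)"
    unfolding \<mu>_def by (rule distr_distr[OF shift_two_measurable dec_measurable_bern])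
  also have "shift_two \<circ> dec = dec \<circ> (\<lambda>y i. y (i + 1))"
    using shift_dec[of 1] by (simp add: fun_eq_iff)
  also have "distr bern dyck_borel (dec \<circ> (\<lambda>y i. y (i + 1))) = distr (distr bern bern (\<lambda>y i. y (i + 1))) dyck_borel dec"
    by (rule distr_distr[symmetric, OF dec_measurable_bern shift_measurable_bern])
  also have "\<dots> = \<mu>" by (subst distr_bern_reindex) (auto simp: \<mu>_def inj_def)
  finally have "distr \<mu> \<mu> shift_two = \<mu>" .
  moreover have "prob_space \<mu>"
    unfolding \<mu>_def using prob_space_bern dec_measurable_bern by (rule prob_space.prob_space_distr)
  ultimately show ?thesis
    using shift_two_measurable by (simp add: invariant_measures_def cong: measurable_cong_sets)
qed

abbreviation Q :: "(int \<Rightarrow> 'm dyck_symbol) \<Rightarrow> 'm option" where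
  "Q \<omega> \<equiv> q (\<omega> 0)"

lemma itinerary_Q: "itinerary shift_two Q n \<omega> = map (\<lambda>i. q (\<omega> (int i))) [0..<n]"
  by (simp add: itinerary_def shift_two_funpow)

lemma Q_simple:
  assumes "sets \<nu> = sets dyck_borel"
  shows "simple_function \<nu> Q"
proof -
  have "Q \<in> measurable dyck_borel (count_space UNIV)"
    by (rule measurable_compose[OF measurable_dyck_component]) simp
  then have "Q \<in> measurable \<nu> (count_space UNIV)"
    using assms by (simp cong: measurable_cong_sets)
  then show ?thesis
    unfolding simple_function_def by (auto intro: measurable_sets finite_subset[OF subset_UNIV])
qed

lemma measure_preserving_invariant:
  assumes "\<nu> \<in> invariant_measures X d T"
  shows "measure_preserving \<nu> T"
  using assms by (simp add: invariant_measures_def measure_preserving_def measure_preserving_axioms_def)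

lemma card_lists: "card {w :: 'm option list. length w = n} = (CARD('m) + 1) ^ n"
  using card_lists_length_eq[of "UNIV :: 'm option set" n] by simp

lemma finite_lists: "finite {w :: 'm option list. length w = n}"
  using finite_lists_length_eq[of "UNIV :: 'm option set" n] by simp

lemma bern_lists:
  fixes w :: "'m option list"
  assumes w: "length w = n"
  shows "measure bern {y. map (\<lambda>i. y (int i)) [0..<n] = w} = (1 / (CARD('m) + 1)) ^ n"
proof -
  have "{y. map (\<lambda>i. y (int i)) [0..<n] = w} = {y. \<forall>j\<in>int ` {..<n}. y j = w ! nat j}"
    using w by (auto simp: list_eq_iff_nth_eq)
  moreover have "card (int ` {..<n}) = n" by (simp add: card_image)
  ultimately show ?thesis using bern_window[of "int ` {..<n}" "\<lambda>j. w ! nat j"] by simp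
qed

text \<open>As \<open>q\<close> undoes \<open>dec\<close>, the itinerary under \<open>\<mu>\<close>
  is a block of independent uniform symbols, so all words of length \<open>n\<close> are equally
  likely.\<close>

lemma ent_itinerary_Q: "ent \<mu> (itinerary shift_two Q n) = n * ln (CARD('m) + 1)"
proof -
  interpret measure_preserving \<mu> shift_two by (rule measure_preserving_invariant[OF \<mu>_invariant])
  have it: "itinerary shift_two Q n (dec y) = map (\<lambda>i. y (int i)) [0..<n]" for y
    by (simp add: itinerary_Q q_dec)
  have sf: "simple_function \<mu> (itinerary shift_two Q n)"
    by (rule simple_function_itinerary[OF Q_simple]) simp
  have img: "itinerary shift_two Q n ` space \<mu> = {w. length w = n}"
  proof (intro equalityI subsetI)
    fix w :: "'m option list" assume "w \<in> {w. length w = n}"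
    then have "w = itinerary shift_two Q n (dec (\<lambda>i. w ! nat i))"
      unfolding it by (auto intro: nth_equalityI)
    then show "w \<in> itinerary shift_two Q n ` space \<mu>" using dec_in_dyck by auto
  qed auto
  have "measure \<mu> (itinerary shift_two Q n -` {w} \<inter> space \<mu>) = 1 / real ((CARD('m) + 1) ^ n)"
    if "length w = n" for w
  proof -
    have "itinerary shift_two Q n -` {w} \<inter> space \<mu> \<in> sets dyck_borel"
      using simple_functionD(2)[OF sf, of "{w}"] by simp
    then have "measure \<mu> (itinerary shift_two Q n -` {w} \<inter> space \<mu>) =
        measure bern (dec -` (itinerary shift_two Q n -` {w} \<inter> space \<mu>) \<inter> space bern)"
      unfolding \<mu>_def by (intro measure_distr dec_measurable_bern) simp
    also have "dec -` (itinerary shift_two Q n -` {w} \<inter> space \<mu>) \<inter> space bern = {y. map (\<lambda>i. y (int i)) [0..<n] = w}"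
      by (auto simp: it dec_in_dyck)
    finally show ?thesis using bern_lists[OF that] by (simp add: power_one_over)
  qed
  then have "ent \<mu> (itinerary shift_two Q n) = ln (real ((CARD('m) + 1) ^ n))"
    by (intro ent_uniform; unfold img) (simp_all add: card_lists finite_lists del: space_\<mu>)
  also have "\<dots> = n * ln (CARD('m) + 1)"
    by (simp add: ln_realpow add_pos_pos)
  finally show ?thesis .
qed

lemma simple_function_fibers:
  assumes "simple_function M X"
  shows "fibers M X \<in> finite_partitions M"
  using simple_functionD[OF assms]
  by (auto simp: finite_partitions_def fibers_def partition_on_def disjoint_def)

text \<open>The single partition by the values of \<open>Q\<close> yields this lower bound, which
  any measure of maximal entropy must then reach.\<close>

lemma measure_entropy_\<mu>: "ln (CARD('m) + 1) \<le> measure_entropy shift_two \<mu>"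
proof -
  interpret measure_preserving \<mu> shift_two by (rule measure_preserving_invariant[OF \<mu>_invariant])
  have sf: "simple_function \<mu> Q" by (rule Q_simple) simp
  have "(\<lambda>n. ent \<mu> (itinerary shift_two Q n) / n) \<longlonglongrightarrow> ln (CARD('m) + 1)"
    by (rule Lim_transform_eventually[OF tendsto_const])
      (auto simp: ent_itinerary_Q eventually_sequentially intro!: exI[of _ 1])
  with ent_itinerary_LIMSEQ[OF sf] have "entropy_wrt shift_two \<mu> (fibers \<mu> Q) = ln (CARD('m) + 1)"
    by (rule LIMSEQ_unique)
  then show ?thesis
    unfolding measure_entropy_def
    by (intro SUP_upper2[OF simple_function_fibers[OF sf]]) simp
qed

text \<open>
  The symbols of the coding generate, so the entropy is at most \<open>1/k\<close> times that of a block of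
  length \<open>k\<close>, for every \<open>k\<close>; the case of equality in Gibbs' inequality makes all blocks equally likely.
\<close>

lemma eq_\<mu>_if_entropy_ge:
  assumes inv: "\<nu> \<in> invariant_measures dyck dist_two shift_two"
    and ent: "ln (CARD('m) + 1) \<le> measure_entropy shift_two \<nu>"
    and AE: "AE \<omega> in \<nu>. dec (\<lambda>i. q (\<omega> i)) = \<omega>"
  shows "\<nu> = \<mu>"
proof -
  interpret measure_preserving \<nu> shift_two by (rule measure_preserving_invariant[OF inv])
  have sets\<nu>: "sets \<nu> = sets dyck_borel" using inv by (simp add: invariant_measures_def)
  have space\<nu>: "space \<nu> = dyck" using sets_eq_imp_space_eq[OF sets\<nu>] by simp
  have sfQ: "simple_function \<nu> Q" by (rule Q_simple[OF sets\<nu>])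
  note sf = simple_function_itinerary[OF sfQ]
  define \<Phi> where "\<Phi> \<omega> = (\<lambda>i. q (\<omega> i))" for \<omega> :: "int \<Rightarrow> 'm dyck_symbol"
  have \<Phi>: "\<Phi> \<in> measurable \<nu> seqs"
    unfolding measurable_cong_sets[OF sets\<nu> HOL.refl] \<Phi>_def[abs_def]
    by (intro measurable_seqsI measurable_compose[OF measurable_dyck_component]) simp
  \<comment> \<open>\<open>N\<close> is the law of the coded sequence. Once it equals
    \<open>bern\<close>, the measure \<open>\<nu>\<close> is the image of \<open>bern\<close> under
    \<open>dec\<close>, since decoding recovers almost every point.\<close>
  define N where "N = distr \<nu> seqs \<Phi>"
  have N: "sets N = sets seqs" "finite_measure N"
    using prob_space.prob_space_distr[OF prob_space_axioms \<Phi>]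
    by (simp_all add: N_def prob_space.finite_measure)
  have N_meas: "measure N C = prob (\<Phi> -` C \<inter> space \<nu>)" if "C \<in> sets seqs" for C
    unfolding N_def using \<Phi> that by (rule measure_distr)
  \<comment> \<open>Itineraries look only forward; after \<open>l\<close> shifts the block of length
    \<open>2 * l + 1\<close> is the symmetric window. This is why the generator condition speaks of
    the shifted point.\<close>
  have it: "itinerary shift_two Q (2 * l + 1) \<omega> = window l (\<Phi> ((shift_two ^^ l) \<omega>))" for l \<omega>
    by (rule nth_equalityI) (auto simp: itinerary_Q \<Phi>_def shift_two_funpow nth_upto simp del: upt_Suc)
  have gen: "eventually (\<lambda>l. \<exists>S.
      prob {\<omega>\<in>space \<nu>. ((shift_two ^^ l) \<omega> \<in> A) \<noteq> (itinerary shift_two Q (2 * l + 1) \<omega> \<in> S)} < \<delta>) sequentially"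
    if A: "A \<in> events" and \<delta>: "0 < \<delta>" for A \<delta>
  proof -
    \<comment> \<open>Almost surely \<open>\<omega> \<in> A\<close> holds exactly if the code of
      \<open>\<omega>\<close> lies in \<open>B\<close>, so approximating \<open>A\<close> reduces to
      approximating \<open>B\<close> by windows in the full shift.\<close>
    define B where "B = dec -` A"
    have B: "B \<in> sets seqs"
      using measurable_sets[OF dec_measurable, of A] A by (simp add: B_def sets\<nu>)
    have eq: "prob {\<omega>\<in>space \<nu>. ((shift_two ^^ l) \<omega> \<in> A) \<noteq> (itinerary shift_two Q (2 * l + 1) \<omega> \<in> S)}
        = measure N {y. (y \<in> B) \<noteq> (window l y \<in> S)}" for l S
    proof -
      define C where "C = {y. (y \<in> B) \<noteq> (window l y \<in> S)}"
      have C: "C \<in> sets seqs" unfolding C_def by (rule sets_approx_diff[OF B])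
      have W: "{y. window l y \<in> S} \<in> sets (seqs :: (int \<Rightarrow> 'm option) measure)"
        using measurable_sets[OF measurable_map_seq[of "[- int l..int l]"], of S] by (simp add: vimage_def)
      define D where "D = {\<omega>\<in>space \<nu>. (\<omega> \<in> A) \<noteq> (window l (\<Phi> \<omega>) \<in> S)}"
      have "D = (A - (\<Phi> -` {y. window l y \<in> S} \<inter> space \<nu>)) \<union> ((\<Phi> -` {y. window l y \<in> S} \<inter> space \<nu>) - A)"
        using sets.sets_into_space[OF A] by (auto simp: D_def)
      then have D: "D \<in> events" using A measurable_sets[OF \<Phi> W] by auto
      have "{\<omega>\<in>space \<nu>. ((shift_two ^^ l) \<omega> \<in> A) \<noteq> (itinerary shift_two Q (2 * l + 1) \<omega> \<in> S)}
          = (shift_two ^^ l) -` D \<inter> space \<nu>"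
        unfolding it D_def using funpow_space by auto
      then have "prob {\<omega>\<in>space \<nu>. ((shift_two ^^ l) \<omega> \<in> A) \<noteq> (itinerary shift_two Q (2 * l + 1) \<omega> \<in> S)} = prob D"
        using prob_funpow[OF D] by simp
      also have "\<dots> = prob (\<Phi> -` C \<inter> space \<nu>)"
      proof (rule finite_measure_eq_AE)
        show "AE \<omega> in \<nu>. (\<omega> \<in> D) = (\<omega> \<in> \<Phi> -` C \<inter> space \<nu>)"
          using AE AE_space by eventually_elim (simp add: D_def C_def B_def \<Phi>_def)
      qed (use D measurable_sets[OF \<Phi> C] in auto)
      finally show ?thesis using N_meas[OF C] by (simp add: C_def)
    qed
    show ?thesis unfolding eq using approx_by_windows[OF N(2,1) B \<delta>] .
  qed
  have ent_le: "measure_entropy shift_two \<nu> \<le> ent \<nu> (itinerary shift_two Q k) / k" if k: "k \<ge> 1" for k :: nat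
    unfolding measure_entropy_def
  proof (rule SUP_least)
    fix P assume P: "P \<in> finite_partitions \<nu>"
    define X where "X \<omega> = (THE A. A \<in> P \<and> \<omega> \<in> A)" for \<omega>
    have PX: "P = fibers \<nu> X"
      using P fibers_of_partition[of \<nu> P] by (simp add: finite_partitions_def X_def[abs_def])
    have "X -` {x} \<inter> space \<nu> \<in> P" if "x \<in> X ` space \<nu>" for x
      using that by (subst PX) (auto simp: fibers_def)
    moreover have "finite (X ` space \<nu>)"
    proof (rule finite_imageD)
      show "finite ((\<lambda>x. X -` {x} \<inter> space \<nu>) ` X ` space \<nu>)"
        using P PX by (simp add: finite_partitions_def fibers_def)
    qed (auto simp: inj_on_def)
    ultimately have "simple_function \<nu> X"
      using P by (auto simp: simple_function_def finite_partitions_def)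
    from entropy_wrt_generator_le[OF sfQ this k gen]
    show "ereal (entropy_wrt shift_two \<nu> P) \<le> ent \<nu> (itinerary shift_two Q k) / k" by (simp add: PX)
  qed
  have uniform: "prob (itinerary shift_two Q k -` {w} \<inter> space \<nu>) = (1 / (CARD('m) + 1)) ^ k"
    if k: "k \<ge> 1" and w: "length w = k" for k w
  proof -
    have "ereal (ln (CARD('m) + 1)) \<le> ent \<nu> (itinerary shift_two Q k) / k"
      using ent ent_le[OF k] by (rule order_trans)
    then have "k * ln (CARD('m) + 1) \<le> ent \<nu> (itinerary shift_two Q k)"
      using k by (simp add: field_simps)
    moreover have l: "ln (card {w :: 'm option list. length w = k}) = k * ln (CARD('m) + 1)"
      unfolding card_lists by (simp add: ln_realpow add_pos_pos)
    moreover have ne: "{w :: 'm option list. length w = k} \<noteq> {}" using w by auto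
    moreover have sub: "itinerary shift_two Q k ` space \<nu> \<subseteq> {w. length w = k}" by auto
    moreover note ent_gibbs(1)[OF sf finite_lists ne sub]
    ultimately have "ent \<nu> (itinerary shift_two Q k) = ln (card {w :: 'm option list. length w = k})"
      by simp
    then have "prob (itinerary shift_two Q k -` {w} \<inter> space \<nu>) = 1 / card {w :: 'm option list. length w = k}"
      using w by (intro ent_gibbs(2)[OF sf finite_lists ne sub]) simp_all
    then show ?thesis unfolding card_lists by (simp add: power_one_over)
  qed
  have "N = bern"
  proof (rule measure_eqI_windows)
    fix n and w :: "int \<Rightarrow> 'm option"
    let ?C = "{y. \<forall>i\<in>{- int n..int n}. y i = w i}"
    have C: "?C = {y. window n y = window n w}" by auto
    have "measure N ?C = prob (\<Phi> -` ?C \<inter> space \<nu>)"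
      by (rule N_meas[OF sets_window])
    \<comment> \<open>Invariance moves the window from -n to n onto the positions 0 to 2n, where it
      is an itinerary.\<close>
    also have "\<dots> = prob ((shift_two ^^ n) -` (\<Phi> -` ?C \<inter> space \<nu>) \<inter> space \<nu>)"
      by (rule prob_funpow[symmetric]) (rule measurable_sets[OF \<Phi> sets_window])
    also have "(shift_two ^^ n) -` (\<Phi> -` ?C \<inter> space \<nu>) \<inter> space \<nu> =
        itinerary shift_two Q (2 * n + 1) -` {window n w} \<inter> space \<nu>"
      unfolding C it[abs_def] using funpow_space by auto
    also have "prob \<dots> = (1 / (CARD('m) + 1)) ^ (2 * n + 1)"
      by (rule uniform) auto
    also have "\<dots> = measure bern ?C"
      by (subst bern_window) (auto simp: nat_add_distrib nat_mult_distrib)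
    finally show "measure N ?C = measure bern ?C" .
  qed (use N prob_space_bern in \<open>auto intro: prob_space.finite_measure\<close>)
  have "\<nu> = distr \<nu> dyck_borel (\<lambda>\<omega>. \<omega>)"
    by (rule distr_id2[symmetric]) (simp add: sets\<nu>)
  also have "\<dots> = distr \<nu> dyck_borel (\<lambda>\<omega>. dec (\<Phi> \<omega>))"
  proof (rule distr_cong_AE)
    show "AE \<omega> in \<nu>. \<omega> = dec (\<Phi> \<omega>)" using AE by eventually_elim (simp add: \<Phi>_def)
    show "(\<lambda>\<omega>. \<omega>) \<in> measurable \<nu> dyck_borel" by (simp add: sets\<nu> cong: measurable_cong_sets)
    show "(\<lambda>\<omega>. dec (\<Phi> \<omega>)) \<in> measurable \<nu> dyck_borel" by (rule measurable_compose[OF \<Phi> dec_measurable])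
  qed simp_all
  also have "\<dots> = distr N dyck_borel dec"
    unfolding N_def by (subst distr_distr[OF dec_measurable \<Phi>]) (simp add: comp_def)
  finally show ?thesis unfolding \<open>N = bern\<close> \<mu>_def .
qed

end

section \<open>Decay of correlations\<close>

text \<open>Replacing \<open>f\<close> and \<open>g\<close> by the local functions \<open>f'\<close>
  and \<open>g'\<close> costs at most \<open>B * e\<close> for each of the two replacements, in the
  joint integral and in the product of means alike. After that the windows of radius
  \<open>R\<close> around 0 and \<open>n\<close> are disjoint, so the local functions are
  independent.\<close>

lemma bern_correlation_bound:
  fixes f g f' g' :: "(int \<Rightarrow> 'a::finite) \<Rightarrow> real"
  assumes meas: "f \<in> borel_measurable seqs" "g \<in> borel_measurable seqs" "f' \<in> borel_measurable seqs" "g' \<in> borel_measurable seqs"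
    and bound: "\<And>y. \<bar>f y\<bar> \<le> B" "\<And>y. \<bar>g y\<bar> \<le> B" "\<And>y. \<bar>f' y\<bar> \<le> B" "\<And>y. \<bar>g' y\<bar> \<le> B"
    and local: "\<And>y y'. (\<And>i. \<bar>i\<bar> \<le> int R \<Longrightarrow> y i = y' i) \<Longrightarrow> f' y = f' y'"
      "\<And>y y'. (\<And>i. \<bar>i\<bar> \<le> int R \<Longrightarrow> y i = y' i) \<Longrightarrow> g' y = g' y'"
    and approx: "(\<integral>y. \<bar>f y - f' y\<bar> \<partial>bern) \<le> e" "(\<integral>y. \<bar>g y - g' y\<bar> \<partial>bern) \<le> e"
    and n: "2 * R < n"
  shows "\<bar>(\<integral>y. f y * g (\<lambda>i. y (i + int n)) \<partial>bern) - (\<integral>y. f y \<partial>bern) * (\<integral>y. g y \<partial>bern)\<bar> \<le> 4 * B * e"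
proof -
  interpret prob_space "bern :: (int \<Rightarrow> 'a) measure" by (rule prob_space_bern)
  have B: "0 \<le> B" using bound(1)[of undefined] by linarith
  let ?s = "\<lambda>(y :: int \<Rightarrow> 'a) i. y (i + int n)"
  have s: "?s \<in> measurable bern bern" using measurable_reindex by (simp cong: measurable_cong_sets)
  have s': "?s \<in> measurable seqs seqs" by (rule measurable_reindex)
  have sd: "distr bern bern ?s = (bern :: (int \<Rightarrow> 'a) measure)"
    by (rule distr_bern_reindex) (simp add: inj_def)
  have shift_int: "(\<integral>y. h (?s y) \<partial>bern) = (\<integral>y. h y \<partial>bern)" if "h \<in> borel_measurable seqs" for h :: "(int \<Rightarrow> 'a) \<Rightarrow> real"
    using integral_distr[OF s, of h] that by (simp add: sd cong: measurable_cong_sets)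
  have int: "integrable bern h" if "h \<in> borel_measurable seqs" "\<And>y. \<bar>h y\<bar> \<le> C" for h :: "(int \<Rightarrow> 'a) \<Rightarrow> real" and C
    by (rule integrable_const_bound[where B = C]) (use that in \<open>auto cong: measurable_cong_sets\<close>)
  have pm: "\<bar>u * v\<bar> \<le> C * D" if "\<bar>u\<bar> \<le> C" "\<bar>v\<bar> \<le> D" for u v C D :: real
    using that by (simp add: abs_mult mult_mono')
  have le: "\<bar>\<integral>y. u y * v y \<partial>bern\<bar> \<le> B * e'"
    if u: "u \<in> borel_measurable seqs" "(\<integral>y. \<bar>u y\<bar> \<partial>bern) \<le> e'" "\<And>y. \<bar>u y\<bar> \<le> 2 * B"
      and v: "v \<in> borel_measurable seqs" "\<And>y. \<bar>v y\<bar> \<le> B" for u v :: "(int \<Rightarrow> 'a) \<Rightarrow> real" and e'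
  proof -
    have "\<bar>\<integral>y. u y * v y \<partial>bern\<bar> \<le> (\<integral>y. \<bar>u y * v y\<bar> \<partial>bern)" by (rule integral_abs_bound)
    also have "\<dots> \<le> (\<integral>y. \<bar>u y\<bar> * B \<partial>bern)"
    proof (rule integral_mono)
      show "integrable bern (\<lambda>y. \<bar>u y * v y\<bar>)"
        by (rule int[of _ "2 * B * B"]) (use u v in \<open>auto intro!: pm\<close>)
      show "integrable bern (\<lambda>y. \<bar>u y\<bar> * B)"
        by (rule int[of _ "2 * B * B"]) (use u B in \<open>auto simp: abs_mult intro!: mult_right_mono\<close>)
      show "\<bar>u y * v y\<bar> \<le> \<bar>u y\<bar> * B" for y using v(2)[of y] by (simp add: abs_mult mult_left_mono)
    qed
    also have "\<dots> = (\<integral>y. \<bar>u y\<bar> \<partial>bern) * B" by simp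
    also have "\<dots> \<le> e' * B" using u(2) B by (intro mult_right_mono)
    finally show ?thesis by (simp add: mult.commute)
  qed
  have gs: "(\<lambda>y. g (?s y)) \<in> borel_measurable seqs" "(\<lambda>y. g' (?s y)) \<in> borel_measurable seqs"
    using measurable_compose[OF s'] meas by auto
  have d: "\<bar>f y - f' y\<bar> \<le> 2 * B" "\<bar>g y - g' y\<bar> \<le> 2 * B" for y
    using bound(1-4)[of y] by linarith+
  note ints = int[OF meas(1) bound(1)] int[OF meas(2) bound(2)] int[OF meas(3) bound(3)] int[OF meas(4) bound(4)]
  have intp: "integrable bern (\<lambda>y. u y * v y)"
    if "u \<in> borel_measurable seqs" "\<And>y. \<bar>u y\<bar> \<le> B" "v \<in> borel_measurable seqs" "\<And>y. \<bar>v y\<bar> \<le> B" for u v :: "(int \<Rightarrow> 'a) \<Rightarrow> real"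
    by (rule int[of _ "B * B"]) (use that in \<open>auto intro!: pm\<close>)
  have 1: "\<bar>\<integral>y. (f y - f' y) * g (?s y) \<partial>bern\<bar> \<le> B * e"
    by (rule le) (use meas gs d bound approx in auto)
  have 2: "\<bar>\<integral>y. (g (?s y) - g' (?s y)) * f' y \<partial>bern\<bar> \<le> B * e"
    using shift_int[of "\<lambda>y. \<bar>g y - g' y\<bar>"] by (intro le) (use meas gs d bound approx in auto)
  have 3: "\<bar>\<integral>y. (f y - f' y) * 1 \<partial>bern\<bar> \<le> e"
    using order_trans[OF integral_abs_bound approx(1)] by simp
  have 4: "\<bar>\<integral>y. (g y - g' y) * 1 \<partial>bern\<bar> \<le> e"
    using order_trans[OF integral_abs_bound approx(2)] by simp
  have mean: "\<bar>\<integral>y. h y \<partial>bern\<bar> \<le> B" if "h \<in> borel_measurable seqs" "\<And>y. \<bar>h y\<bar> \<le> B" for h :: "(int \<Rightarrow> 'a) \<Rightarrow> real"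
  proof -
    have "\<bar>\<integral>y. h y \<partial>bern\<bar> \<le> (\<integral>y. \<bar>h y\<bar> \<partial>bern)" by (rule integral_abs_bound)
    also have "\<dots> \<le> integral\<^sup>L bern (\<lambda>y :: int \<Rightarrow> 'a. B)"
    proof (rule integral_mono)
      show "integrable bern (\<lambda>y. \<bar>h y\<bar>)" by (rule int[of _ B]) (use that in auto)
    qed (use that in auto)
    finally show ?thesis using prob_space by simp
  qed
  have ind: "(\<integral>y. f' y * g' (?s y) \<partial>bern) = (\<integral>y. f' y \<partial>bern) * (\<integral>y. g' y \<partial>bern)"
  proof -
    have "(\<integral>y. f' y * g' (?s y) \<partial>bern) = (\<integral>y. f' y \<partial>bern) * (\<integral>y. g' (?s y) \<partial>bern)"
    proof (rule bern_integral_mult)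
      show "{- int R..int R} \<inter> {int n - int R..int n + int R} = {}" using n by auto
      show "f' y = f' y'" if "\<And>i. i \<in> {- int R..int R} \<Longrightarrow> y i = y' i" for y y'
        by (rule local(1)) (rule that, auto)
      show "g' (?s y) = g' (?s y')" if "\<And>i. i \<in> {int n - int R..int n + int R} \<Longrightarrow> y i = y' i" for y y'
        by (rule local(2)) (rule that, auto)
      show "integrable bern (\<lambda>y. g' (?s y))" by (rule int[OF gs(2) bound(4)])
    qed (use meas gs ints in auto)
    then show ?thesis using shift_int[OF meas(4)] by simp
  qed
  have e1: "(\<integral>y. f y * g (?s y) \<partial>bern) - (\<integral>y. f' y * g' (?s y) \<partial>bern)
      = (\<integral>y. (f y - f' y) * g (?s y) \<partial>bern) + (\<integral>y. (g (?s y) - g' (?s y)) * f' y \<partial>bern)"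
    using intp[OF meas(1) bound(1) gs(1) bound(2)] intp[OF meas(3) bound(3) gs(1) bound(2)]
      intp[OF meas(3) bound(3) gs(2) bound(4)]
    by (simp add: algebra_simps)
  have e2: "(\<integral>y. f y \<partial>bern) * (\<integral>y. g y \<partial>bern) - (\<integral>y. f' y \<partial>bern) * (\<integral>y. g' y \<partial>bern)
      = (\<integral>y. (f y - f' y) * 1 \<partial>bern) * (\<integral>y. g y \<partial>bern) + (\<integral>y. f' y \<partial>bern) * (\<integral>y. (g y - g' y) * 1 \<partial>bern)"
    using ints by (simp add: algebra_simps)
  have 5: "\<bar>(\<integral>y. (f y - f' y) * 1 \<partial>bern) * (\<integral>y. g y \<partial>bern)\<bar> \<le> e * B"
    by (rule pm[OF 3 mean[OF meas(2) bound(2)]])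
  have 6: "\<bar>(\<integral>y. f' y \<partial>bern) * (\<integral>y. (g y - g' y) * 1 \<partial>bern)\<bar> \<le> B * e"
    by (rule pm[OF mean[OF meas(3) bound(3)] 4])
  show ?thesis
    using 1 2 5 6 e1 e2 ind by (simp add: algebra_simps)
qed

text \<open>Absorbs the number \<open>2 * r + 1\<close> of positions in a union bound into a
  slightly larger base.\<close>

lemma linear_times_power_bounded:
  fixes z :: real
  assumes "0 < z" "z < 1"
  shows "\<exists>C. \<forall>r::nat. (2 * real r + 1) * z ^ r \<le> C"
proof -
  have "(\<lambda>r. real r * z ^ r) \<longlonglongrightarrow> 0"
    using assms by (intro powser_times_n_limit_0) auto
  then have "Bseq (\<lambda>r. real r * z ^ r)" by (intro convergent_imp_Bseq convergentI)
  then obtain C where C: "\<And>r. norm (real r * z ^ r) \<le> C" by (auto simp: Bseq_def)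
  have "(2 * real r + 1) * z ^ r \<le> 2 * C + 1" for r
  proof -
    have "z ^ r \<le> 1" using assms by (intro power_le_one) auto
    moreover have "real r * z ^ r \<le> C" using C[of r] by simp
    ultimately show ?thesis by (simp add: algebra_simps)
  qed
  then show ?thesis by blast
qed

context coding
begin

text \<open>The filling \<open>None\<close> is arbitrary. Since \<open>dec\<close> maps every
  sequence into the Dyck shift, a function on the Dyck shift composed with \<open>dec\<close> and
  \<open>trunc R\<close> makes sense and depends on finitely many coordinates.\<close>

definition trunc :: "nat \<Rightarrow> (int \<Rightarrow> 'm option) \<Rightarrow> int \<Rightarrow> 'm option" where
  "trunc R y i = (if \<bar>i\<bar> \<le> int R then y i else None)"

lemma trunc_measurable: "trunc R \<in> measurable seqs seqs"
  by (rule measurable_seqsI) (simp add: trunc_def measurable_seq_component)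

text \<open>Each of the positions up to distance \<open>r\<close> may look a further
  \<open>r\<close> coordinates away, hence the truncation radius \<open>2 * r\<close>.\<close>

lemma dist_dec_trunc:
  assumes "\<And>j. j \<in> {- int r..int r} \<Longrightarrow> good r (\<lambda>i. y (i + j))"
  shows "dist_two (dec y) (dec (trunc (2 * r) y)) \<le> exp (- real (Suc r))"
proof (rule dist_two_le)
  fix j :: int assume j: "\<bar>j\<bar> \<le> int r"
  have "dec (\<lambda>i. y (i + j)) 0 = dec (\<lambda>i. trunc (2 * r) y (i + j)) 0"
    by (rule dec_local[OF assms]) (use j in \<open>auto simp: trunc_def\<close>)
  then show "dec y j = dec (trunc (2 * r) y) j"
    using dec_shift[of y j 0] dec_shift[of "trunc (2 * r) y" j 0] by simp
qed

definition bad_set :: "nat \<Rightarrow> (int \<Rightarrow> 'm option) set" where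
  "bad_set r = (\<Union>j\<in>{- int r..int r}. {y. \<not> good r (\<lambda>i. y (i + j))})"

lemma bad_set_measure: "bad_set r \<in> sets seqs \<and> measure bern (bad_set r) \<le> (2 * real r + 1) * \<rho> ^ r"
proof -
  interpret prob_space "bern :: (int \<Rightarrow> 'm option) measure" by (rule prob_space_bern)
  have "{y \<in> space seqs. \<not> good r y} \<in> sets seqs"
    using good_pred[of r] by measurable
  then have G: "{y. \<not> good r y} \<in> sets seqs" by simp
  have sets: "{y. \<not> good r (\<lambda>i. y (i + j))} \<in> sets seqs" for j
    using measurable_sets[OF measurable_reindex[of "\<lambda>i. i + j"] G] by (simp add: vimage_def)
  have "measure bern {y. \<not> good r (\<lambda>i. y (i + j))} = measure (distr bern bern (\<lambda>y i. y (i + j))) {y. \<not> good r y}" for j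
    using measure_distr[OF shift_measurable_bern[of j], of "{y. \<not> good r y}"] G by (simp add: vimage_def)
  then have meas: "measure bern {y. \<not> good r (\<lambda>i. y (i + j))} \<le> \<rho> ^ r" for j
    using bad[of r] by (simp add: distr_bern_reindex inj_def)
  have "measure bern (bad_set r) \<le> (\<Sum>j\<in>{- int r..int r}. measure bern {y. \<not> good r (\<lambda>i. y (i + j))})"
    unfolding bad_set_def using sets by (intro finite_measure_subadditive_finite) auto
  also have "\<dots> \<le> (\<Sum>j\<in>{- int r..int r}. \<rho> ^ r)" by (intro sum_mono meas)
  also have "\<dots> = (2 * real r + 1) * \<rho> ^ r" by simp
  finally show ?thesis using sets unfolding bad_set_def by auto
qed

text \<open>Outside \<open>bad_set r\<close> the two decoded points agree up to distance
  \<open>r\<close>, and the Hoelder bound decays like \<open>exp (- \<eta>) ^ r\<close>. On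
  \<open>bad_set r\<close> the difference is at most \<open>K\<close>, as distances are at most 1,
  and the measure of the set is small.\<close>

lemma holder_trunc_error:
  assumes \<phi>: "\<phi> \<in> borel_measurable dyck_borel" and K: "K \<ge> 0" and \<eta>: "0 < \<eta>"
    and H: "\<And>x y. x \<in> dyck \<Longrightarrow> y \<in> dyck \<Longrightarrow> \<bar>\<phi> x - \<phi> y\<bar> \<le> K * dist_two x y powr \<eta>"
  shows "(\<integral>y. \<bar>\<phi> (dec y) - \<phi> (dec (trunc (2 * r) y))\<bar> \<partial>bern) \<le> K * (exp (- \<eta>) ^ r + (2 * real r + 1) * \<rho> ^ r)"
proof -
  interpret prob_space "bern :: (int \<Rightarrow> 'm option) measure" by (rule prob_space_bern)
  note bs = bad_set_measure[of r]
  have m1: "(\<lambda>y. \<phi> (dec y)) \<in> borel_measurable seqs" by (rule measurable_compose[OF dec_measurable \<phi>])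
  have m2: "(\<lambda>y. \<phi> (dec (trunc (2 * r) y))) \<in> borel_measurable seqs"
    by (rule measurable_compose[OF trunc_measurable m1])
  have HK: "\<bar>\<phi> (dec y) - \<phi> (dec y')\<bar> \<le> K" for y y'
  proof -
    have "dist_two (dec y) (dec y') powr \<eta> \<le> 1" using \<eta> by (intro powr_le1) (auto simp: dist_two_nonneg dist_two_le_1)
    then have "K * dist_two (dec y) (dec y') powr \<eta> \<le> K" using K by (rule mult_left_le)
    then show ?thesis using H[OF dec_in_dyck dec_in_dyck, of y y'] by linarith
  qed
  have ib: "integrable bern (indicat_real (bad_set r))"
    using bs by (intro integrable_real_indicator) (auto simp: emeasure_eq_measure)
  have "(\<integral>y. \<bar>\<phi> (dec y) - \<phi> (dec (trunc (2 * r) y))\<bar> \<partial>bern)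
      \<le> (\<integral>y. K * exp (- \<eta>) ^ r + K * indicat_real (bad_set r) y \<partial>bern)"
  proof (rule integral_mono)
    show "integrable bern (\<lambda>y. \<bar>\<phi> (dec y) - \<phi> (dec (trunc (2 * r) y))\<bar>)"
      by (rule integrable_const_bound[where B = K]) (use HK m1 m2 in \<open>auto cong: measurable_cong_sets\<close>)
    show "integrable bern (\<lambda>y. K * exp (- \<eta>) ^ r + K * indicat_real (bad_set r) y)"
      using ib by simp
    fix y
    show "\<bar>\<phi> (dec y) - \<phi> (dec (trunc (2 * r) y))\<bar> \<le> K * exp (- \<eta>) ^ r + K * indicat_real (bad_set r) y"
    proof (cases "y \<in> bad_set r")
      case True
      have "\<bar>\<phi> (dec y) - \<phi> (dec (trunc (2 * r) y))\<bar> \<le> 0 + K * 1" using HK[of y "trunc (2 * r) y"] by simp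
      also have "\<dots> \<le> K * exp (- \<eta>) ^ r + K * indicat_real (bad_set r) y"
        using K True by (intro add_mono) simp_all
      finally show ?thesis .
    next
      case False
      then have D: "dist_two (dec y) (dec (trunc (2 * r) y)) \<le> exp (- real (Suc r))"
        by (intro dist_dec_trunc) (auto simp: bad_set_def)
      have "\<bar>\<phi> (dec y) - \<phi> (dec (trunc (2 * r) y))\<bar> \<le> K * dist_two (dec y) (dec (trunc (2 * r) y)) powr \<eta>"
        by (intro H dec_in_dyck)
      also have "\<dots> \<le> K * exp (- real (Suc r)) powr \<eta>"
        using D K \<eta> by (intro mult_left_mono powr_mono2) (auto simp: dist_two_nonneg)
      also have "exp (- real (Suc r)) powr \<eta> = exp (- \<eta>) ^ Suc r"
        by (simp add: powr_def exp_of_nat_mult[symmetric] algebra_simps flip: exp_add)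
      also have "K * exp (- \<eta>) ^ Suc r \<le> K * exp (- \<eta>) ^ r"
        using K \<eta> by (intro mult_left_mono power_decreasing) auto
      finally show ?thesis using False by simp
    qed
  qed
  also have "\<dots> = K * exp (- \<eta>) ^ r + K * measure bern (bad_set r)"
    using ib bs prob_space by simp
  also have "\<dots> \<le> K * exp (- \<eta>) ^ r + K * ((2 * real r + 1) * \<rho> ^ r)"
    using bs K by (intro add_left_mono mult_left_mono) auto
  finally show ?thesis by (simp add: algebra_simps)
qed

lemma holder_bounded:
  fixes \<phi> :: "(int \<Rightarrow> 'm dyck_symbol) \<Rightarrow> real"
  assumes "0 < \<eta>" "\<phi> \<in> holder \<eta> dyck dist_two"
  obtains K B where "K \<ge> 0" "\<And>x y. x \<in> dyck \<Longrightarrow> y \<in> dyck \<Longrightarrow> \<bar>\<phi> x - \<phi> y\<bar> \<le> K * dist_two x y powr \<eta>"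
    "\<And>x. x \<in> dyck \<Longrightarrow> \<bar>\<phi> x\<bar> \<le> B"
proof -
  from assms obtain K where K: "K \<ge> 0" "\<And>x y. x \<in> dyck \<Longrightarrow> y \<in> dyck \<Longrightarrow> \<bar>\<phi> x - \<phi> y\<bar> \<le> K * dist_two x y powr \<eta>"
    by (auto simp: holder_def)
  have "\<bar>\<phi> x\<bar> \<le> \<bar>\<phi> (dec (\<lambda>_. None))\<bar> + K" if "x \<in> dyck" for x
  proof -
    have "dist_two x (dec (\<lambda>_. None)) powr \<eta> \<le> 1"
      using assms(1) by (intro powr_le1) (auto simp: dist_two_nonneg dist_two_le_1)
    then have "K * dist_two x (dec (\<lambda>_. None)) powr \<eta> \<le> K" using K(1) by (rule mult_left_le)
    then show ?thesis using K(2)[OF that dec_in_dyck, of "\<lambda>_. None"] by linarith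
  qed
  with K show ?thesis by (rule that)
qed

lemma Cor_\<mu>:
  assumes "\<phi> \<in> borel_measurable dyck_borel" "\<psi> \<in> borel_measurable dyck_borel"
  shows "Cor n shift_two \<phi> \<psi> \<mu> =
    \<bar>(\<integral>y. \<phi> (dec y) * \<psi> (dec (\<lambda>i. y (i + int n))) \<partial>bern) - (\<integral>y. \<phi> (dec y) \<partial>bern) * (\<integral>y. \<psi> (dec y) \<partial>bern)\<bar>"
  using assms measurable_compose[OF funpow_measurable_self[OF shift_two_measurable, of n] assms(2)]
  unfolding Cor_def \<mu>_def by (simp add: integral_distr[OF dec_measurable_bern] shift_dec)

lemma exponentially_mixing_\<mu>: "exponentially_mixing dyck dist_two shift_two \<mu>"
  unfolding exponentially_mixing_def
proof (intro conjI \<mu>_invariant allI impI)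
  fix \<eta> :: real assume "0 < \<eta> \<and> \<eta> \<le> 1"
  then have \<eta>: "0 < \<eta>" by simp
  \<comment> \<open>The midpoint of \<open>\<rho>\<close> and 1 keeps \<open>\<tau>\<close> strictly
    above \<open>\<rho>\<close>, which leaves room for the linear factor. The choice depends on
    \<open>\<eta>\<close> but not on the functions.\<close>
  define \<tau> where "\<tau> = max (exp (- \<eta>)) ((1 + \<rho>) / 2)"
  have \<tau>: "0 < \<tau>" "\<tau> < 1" "\<rho> < \<tau>" "exp (- \<eta>) \<le> \<tau>" using \<rho> \<eta> by (auto simp: \<tau>_def less_max_iff_disj)
  \<comment> \<open>The truncation parameter below is about \<open>n / 4\<close>, so decay at rate
    \<open>\<tau>\<close> in it is decay at the fourth root of \<open>\<tau>\<close> in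
    \<open>n\<close>.\<close>
  define \<theta> where "\<theta> = root 4 \<tau>"
  have \<theta>: "0 < \<theta>" "\<theta> < 1" "\<theta> ^ 4 = \<tau>" using \<tau> by (simp_all add: \<theta>_def)
  obtain c where c: "\<And>r::nat. (2 * real r + 1) * (\<rho> / \<tau>) ^ r \<le> c"
    using linear_times_power_bounded[of "\<rho> / \<tau>"] \<rho> \<tau> by auto
  have "0 \<le> c" using c[of 0] by simp
  have rate: "exp (- \<eta>) ^ r + (2 * real r + 1) * \<rho> ^ r \<le> (1 + c) * \<tau> ^ r" for r
  proof -
    have "(2 * real r + 1) * \<rho> ^ r = (2 * real r + 1) * (\<rho> / \<tau>) ^ r * \<tau> ^ r"
      using \<tau> by (simp add: power_divide)
    also have "\<dots> \<le> c * \<tau> ^ r" using c \<tau> by (intro mult_right_mono) auto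
    finally show ?thesis
      using power_mono[OF \<tau>(4), of r] by (simp add: algebra_simps)
  qed
  have "\<exists>C>0. \<forall>n\<ge>1. Cor n shift_two \<phi> \<psi> \<mu> \<le> C * \<theta> ^ n"
    if h: "\<phi> \<in> holder \<eta> dyck dist_two" "\<psi> \<in> holder \<eta> dyck dist_two" for \<phi> \<psi>
  proof -
    note meas = holder_measurable[OF Metric_space_dist_two \<eta> h(1)] holder_measurable[OF Metric_space_dist_two \<eta> h(2)]
    obtain K1 B1 where 1: "K1 \<ge> 0" "\<And>x y. x \<in> dyck \<Longrightarrow> y \<in> dyck \<Longrightarrow> \<bar>\<phi> x - \<phi> y\<bar> \<le> K1 * dist_two x y powr \<eta>"
      "\<And>x. x \<in> dyck \<Longrightarrow> \<bar>\<phi> x\<bar> \<le> B1" using holder_bounded[OF \<eta> h(1)] by blast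
    obtain K2 B2 where 2: "K2 \<ge> 0" "\<And>x y. x \<in> dyck \<Longrightarrow> y \<in> dyck \<Longrightarrow> \<bar>\<psi> x - \<psi> y\<bar> \<le> K2 * dist_two x y powr \<eta>"
      "\<And>x. x \<in> dyck \<Longrightarrow> \<bar>\<psi> x\<bar> \<le> B2" using holder_bounded[OF \<eta> h(2)] by blast
    define K where "K = max K1 K2"
    define B where "B = max B1 B2"
    have K: "0 \<le> K" "K1 \<le> K" "K2 \<le> K" using 1(1) by (auto simp: K_def)
    have \<phi>B: "\<bar>\<phi> (dec y)\<bar> \<le> B" and \<psi>B: "\<bar>\<psi> (dec y)\<bar> \<le> B" for y
      using 1(3)[OF dec_in_dyck, of y] 2(3)[OF dec_in_dyck, of y] by (auto simp: B_def)
    have "0 \<le> B" using \<phi>B[of undefined] by linarith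
    note f = measurable_compose[OF dec_measurable meas(1)] measurable_compose[OF dec_measurable meas(2)]
    note f' = measurable_compose[OF trunc_measurable f(1)] measurable_compose[OF trunc_measurable f(2)]
    \<comment> \<open>The division by \<open>\<theta> ^ 4\<close> pays for rounding \<open>n\<close>
      up to \<open>4 * r + 4\<close>; the summand 1 makes \<open>C\<close> positive even if the
      other term is 0.\<close>
    define C where "C = 4 * B * (K * (1 + c)) / \<theta> ^ 4 + 1"
    have "0 \<le> 4 * B * (K * (1 + c)) / \<theta> ^ 4" using \<open>0 \<le> B\<close> K \<open>0 \<le> c\<close> \<theta>(1) by simp
    then have "0 < C" by (simp add: C_def)
    have "Cor n shift_two \<phi> \<psi> \<mu> \<le> C * \<theta> ^ n" if n: "n \<ge> 1" for n
    proof -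
      \<comment> \<open>The largest \<open>r\<close> with \<open>4 * r < n\<close>: two windows of
        radius \<open>2 * r\<close> around 0 and \<open>n\<close> are then disjoint.\<close>
      define r where "r = (n - 1) div 4"
      have err: "(\<integral>y. \<bar>\<xi> (dec y) - \<xi> (dec (trunc (2 * r) y))\<bar> \<partial>bern) \<le> K * ((1 + c) * \<tau> ^ r)"
        if "\<xi> \<in> borel_measurable dyck_borel" "0 \<le> K'" "K' \<le> K"
          "\<And>x y. x \<in> dyck \<Longrightarrow> y \<in> dyck \<Longrightarrow> \<bar>\<xi> x - \<xi> y\<bar> \<le> K' * dist_two x y powr \<eta>" for \<xi> K'
      proof -
        have "(\<integral>y. \<bar>\<xi> (dec y) - \<xi> (dec (trunc (2 * r) y))\<bar> \<partial>bern) \<le> K' * (exp (- \<eta>) ^ r + (2 * real r + 1) * \<rho> ^ r)"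
          using that \<eta> by (intro holder_trunc_error) auto
        also have "\<dots> \<le> K * ((1 + c) * \<tau> ^ r)"
          using that rate \<rho> by (intro mult_mono) auto
        finally show ?thesis .
      qed
      have "Cor n shift_two \<phi> \<psi> \<mu> \<le> 4 * B * (K * ((1 + c) * \<tau> ^ r))"
        unfolding Cor_\<mu>[OF meas]
      proof (rule bern_correlation_bound[where R = "2 * r"])
        show "2 * (2 * r) < n" using n by (simp add: r_def)
        show "\<phi> (dec (trunc (2 * r) y)) = \<phi> (dec (trunc (2 * r) y'))"
          "\<psi> (dec (trunc (2 * r) y)) = \<psi> (dec (trunc (2 * r) y'))"
          if "\<And>i. \<bar>i\<bar> \<le> int (2 * r) \<Longrightarrow> y i = y' i" for y y'
        proof -
          have "trunc (2 * r) y = trunc (2 * r) y'" using that by (auto simp: trunc_def fun_eq_iff)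
          then show "\<phi> (dec (trunc (2 * r) y)) = \<phi> (dec (trunc (2 * r) y'))"
            "\<psi> (dec (trunc (2 * r) y)) = \<psi> (dec (trunc (2 * r) y'))" by simp_all
        qed
        show "(\<integral>y. \<bar>\<phi> (dec y) - \<phi> (dec (trunc (2 * r) y))\<bar> \<partial>bern) \<le> K * ((1 + c) * \<tau> ^ r)"
          by (rule err[OF meas(1) 1(1) K(2) 1(2)])
        show "(\<integral>y. \<bar>\<psi> (dec y) - \<psi> (dec (trunc (2 * r) y))\<bar> \<partial>bern) \<le> K * ((1 + c) * \<tau> ^ r)"
          by (rule err[OF meas(2) 2(1) K(3) 2(2)])
      qed (rule f f' \<phi>B \<psi>B)+
      also have "\<tau> ^ r = \<theta> ^ (4 * r + 4) / \<theta> ^ 4"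
        using \<theta> \<tau>(1) by (simp add: power_mult power_add)
      also have "4 * B * (K * ((1 + c) * (\<theta> ^ (4 * r + 4) / \<theta> ^ 4))) = 4 * B * (K * (1 + c)) / \<theta> ^ 4 * \<theta> ^ (4 * r + 4)"
        by simp
      also have "\<dots> \<le> C * \<theta> ^ n"
      proof (rule mult_mono)
        have "n \<le> 4 * r + 4" using n by (simp add: r_def)
        then show "\<theta> ^ (4 * r + 4) \<le> \<theta> ^ n" using \<theta> by (intro power_decreasing) auto
      qed (use \<theta> \<open>0 < C\<close> in \<open>auto simp: C_def\<close>)
      finally show ?thesis .
    qed
    with \<open>0 < C\<close> show ?thesis by blast
  qed
  with \<theta> show "\<exists>\<theta>>0. \<theta> < 1 \<and> (\<forall>\<phi>\<in>holder \<eta> dyck dist_two. \<forall>\<psi>\<in>holder \<eta> dyck dist_two.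
      \<exists>C>0. \<forall>n\<ge>1. Cor n shift_two \<phi> \<psi> \<mu> \<le> C * \<theta> ^ n)"
    by blast
qed

text \<open>\<open>\<mu>\<close> competes in the supremum, so maximality forces the entropy of
  \<open>\<nu>\<close> up to the threshold at which \<open>\<nu>\<close> must coincide with
  \<open>\<mu>\<close>.\<close>

lemma exponentially_mixing_if_max_entropy:
  assumes max: "max_entropy_measure dyck dist_two shift_two \<nu>"
    and AE: "AE \<omega> in \<nu>. dec (\<lambda>i. q (\<omega> i)) = \<omega>"
  shows "exponentially_mixing dyck dist_two shift_two \<nu>"
proof -
  have inv: "\<nu> \<in> invariant_measures dyck dist_two shift_two"
    and sup: "measure_entropy shift_two \<nu> = (SUP N\<in>(invariant_measures dyck dist_two shift_two
          :: (int \<Rightarrow> 'm dyck_symbol) measure set). measure_entropy shift_two N)"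
    using max unfolding max_entropy_measure_def by blast+
  have "ln (CARD('m) + 1) \<le> measure_entropy shift_two \<nu>"
    unfolding sup using \<mu>_invariant measure_entropy_\<mu> by (rule SUP_upper2)
  from eq_\<mu>_if_entropy_ge[OF inv this AE] show ?thesis
    using exponentially_mixing_\<mu> by simp
qed

end

section \<open>The two measures of maximal entropy\<close>

lemma coding_decode:
  assumes "CARD('m::finite) \<ge> 2"
  shows "coding forget (decode :: (int \<Rightarrow> 'm option) \<Rightarrow> _) matched_within (unmatched_rate TYPE('m))"
  by unfold_locales
    (use assms in \<open>auto simp: decode_in_dyck decode_shift measurable_decode measurable_matched_within
      bern_not_matched_within unmatched_rate_pos unmatched_rate_less_1 intro: decode_local\<close>)

text \<open>The reflection of the index set preserves the Bernoulli measure, so the reversed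
  matching event has the same probability as the original one.\<close>

lemma coding_decode_rev:
  assumes "CARD('m::finite) \<ge> 2"
  shows "coding (\<lambda>s. forget (swap s)) (decode_rev :: (int \<Rightarrow> 'm option) \<Rightarrow> _)
    (\<lambda>L y. matched_within L (\<lambda>i. y (- i))) (unmatched_rate TYPE('m))"
proof
  fix L :: nat
  have M: "{y :: int \<Rightarrow> 'm option. \<not> matched_within L y} \<in> sets bern"
  proof -
    have "{y \<in> space seqs. \<not> matched_within L (y :: int \<Rightarrow> 'm option)} \<in> sets seqs"
      using measurable_matched_within[of L] by measurable
    then show ?thesis by simp
  qed
  have r: "(\<lambda>y i. y (- i)) \<in> measurable bern (bern :: (int \<Rightarrow> 'm option) measure)"
    using measurable_reindex by (simp cong: measurable_cong_sets)
  have "measure bern {y :: int \<Rightarrow> 'm option. \<not> matched_within L (\<lambda>i. y (- i))} =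
      measure (distr bern bern (\<lambda>y i. y (- i))) {y :: int \<Rightarrow> 'm option. \<not> matched_within L y}"
    using measure_distr[OF r M] by (simp add: vimage_def)
  then show "measure bern {y :: int \<Rightarrow> 'm option. \<not> matched_within L (\<lambda>i. y (- i))} \<le> unmatched_rate TYPE('m) ^ L"
    using bern_not_matched_within[of L] by (simp add: distr_bern_reindex)
  show "Measurable.pred seqs (\<lambda>y :: int \<Rightarrow> 'm option. matched_within L (\<lambda>i. y (- i)))"
    by (rule measurable_compose[OF measurable_reindex measurable_matched_within])
qed (use assms in \<open>auto simp: forget_decode_rev decode_rev_in_dyck decode_rev_shift measurable_decode_rev
      unmatched_rate_pos unmatched_rate_less_1 intro: decode_rev_local\<close>)

lemma AE_if_measure_1:
  assumes "max_entropy_measure X d T \<nu>" "measure \<nu> A = 1"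
  shows "AE \<omega> in \<nu>. \<omega> \<in> A"
  using assms prob_space.AE_prob_1[of \<nu> A]
  by (simp add: max_entropy_measure_def invariant_measures_def)

theorem theoremC:
  fixes \<nu>\<^sub>\<alpha> \<nu>\<^sub>\<beta> :: "(int \<Rightarrow> 'm::finite dyck_symbol) measure"
  assumes "CARD('m) \<ge> 2"
    and "is_nu_alpha \<nu>\<^sub>\<alpha>"
    and "is_nu_beta \<nu>\<^sub>\<beta>"
  shows "exponentially_mixing dyck_plus dist_plus shift_plus (push_plus \<nu>\<^sub>\<alpha>) \<and>
         exponentially_mixing dyck_plus dist_plus shift_plus (push_plus \<nu>\<^sub>\<beta>) \<and>
         exponentially_mixing dyck dist_two shift_two \<nu>\<^sub>\<alpha> \<and>
         exponentially_mixing dyck dist_two shift_two \<nu>\<^sub>\<beta>"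
proof -
  have \<alpha>: "max_entropy_measure dyck dist_two shift_two \<nu>\<^sub>\<alpha>" "measure \<nu>\<^sub>\<alpha> A_alpha = 1"
    and \<beta>: "max_entropy_measure dyck dist_two shift_two \<nu>\<^sub>\<beta>" "measure \<nu>\<^sub>\<beta> A_beta = 1"
    using assms(2,3) by (simp_all add: is_nu_alpha_def is_nu_beta_def)
  interpret A: coding forget "decode :: (int \<Rightarrow> 'm option) \<Rightarrow> _" matched_within "unmatched_rate TYPE('m)"
    by (rule coding_decode[OF assms(1)])
  interpret B: coding "\<lambda>s. forget (swap s)" "decode_rev :: (int \<Rightarrow> 'm option) \<Rightarrow> _"
    "\<lambda>L y. matched_within L (\<lambda>i. y (- i))" "unmatched_rate TYPE('m)"
    by (rule coding_decode_rev[OF assms(1)])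
  have "AE \<omega> in \<nu>\<^sub>\<alpha>. decode (\<lambda>i. forget (\<omega> i)) = \<omega>"
    using AE_if_measure_1[OF \<alpha>] by eventually_elim (rule decode_forget_A_alpha)
  then have "exponentially_mixing dyck dist_two shift_two \<nu>\<^sub>\<alpha>"
    by (rule A.exponentially_mixing_if_max_entropy[OF \<alpha>(1)])
  moreover have "AE \<omega> in \<nu>\<^sub>\<beta>. decode_rev (\<lambda>i. forget (swap (\<omega> i))) = \<omega>"
    using AE_if_measure_1[OF \<beta>] by eventually_elim (rule decode_forget_A_beta)
  then have "exponentially_mixing dyck dist_two shift_two \<nu>\<^sub>\<beta>"
    by (rule B.exponentially_mixing_if_max_entropy[OF \<beta>(1)])
  ultimately show ?thesis using exponentially_mixing_push_plus by blast
qed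

end
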